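(* Let $(\mathbb{X},\mathcal{X})$ be a substandard Borel space (localized by $B_1\subset B_2\subset\dots$) and let $\lambda$ be a locally finite measure on $\mathbb{X}$. Let $\eta_1,\eta_2,\ldots$ be point processes in $\mathbb{X}$ such that, for all $n\in\mathbb{N}$, $B\in\mathcal{X}_b$ and $m\in\mathbb{N}$, the Janossy density $j_{n,B,m}=j_{\eta_n,B,m}$ exists, and such that for each $B\in\mathcal{X}_b$ and $m\in\mathbb{N}$ $$\lim_{c\to\infty}\ \sup_{n\in\mathbb{N}}\int_{\mathbb{X}^m} j_{n,B,m}(x_1,\dots,x_m)\,\mathbf{1}\{j_{n,B,m}(x_1,\dots,x_m)\ge c\}\,\mathrm{d}\lambda_B^m(x_1,\dots,x_m)=0 .$$ Also assume that for each $B\in\mathcal{X}_b$ there exists a map $c_B:\mathbb{N}\to[0,\infty)$ with $\sum_{m=1}^\infty c_B(m)<\infty$ such that $$\sup_{n\in\mathbb{N}}\int_{\mathbb{X}^m} j_{n,B,m}(x_1,\dots,x_m)\,\mathrm{d}\lambda_B^m(x_1,\dots,x_m)\le c_B(m)$$ for each $m\in\mathbb{N}$. Then there exist a point process $\eta$ in $\mathbb{X}$ and a subsequence $(\eta_{n_k})_{k\in\mathbb{N}}$ such that $\mathbb{E}[F(\eta_{n_k})]\to\mathbb{E}[F(\eta)]$ as $k\to\infty$ for all measurable, local, and bounded functions $F:\mathbf{N}\to[0,\infty)$. If the maps $c_B$ are such that $\sum_{m=1}^\infty m\cdot c_B(m)<\infty$, then even $\eta_{n_k}\to\eta$ locally as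 $k\to\infty$.
   Context: Setting. $(\mathbb{X},\mathcal{X})$ is a measurable space which is localized: there are fixed sets $B_1\subset B_2\subset\dots$ in $\mathcal{X}$ with $\bigcup_j B_j=\mathbb{X}$. $\mathcal{X}_b$ is the collection of all sets in $\mathcal{X}$ contained in some $B_j$ (the bounded sets). A measure $\lambda$ on $\mathbb{X}$ is locally finite if $\lambda(B)<\infty$ for all $B\in\mathcal{X}_b$. $\mathbb{N}=\{1,2,\dots\}$, $\mathbb{N}_0=\mathbb{N}\cup\{0\}$. $\mathbf{N}$ is the set of all measures $\mu$ on $\mathbb{X}$ with $\mu(B)\in\mathbb{N}_0$ for each $B\in\mathcal{X}_b$, with the $\sigma$-field $\mathcal{N}$ generated by the maps $\mu\mapsto\mu(B)$, $B\in\mathcal{X}$. A point process in $\mathbb{X}$ is a random element of $\mathbf{N}$ on some probability space. For $B\in\mathcal{X}$ and a measure $\mu$, $\mu_B(\cdot)=\mu(\cdot\cap B)$; $\lambda_B^m=(\lambda_B)^m$ is the $m$-fold product measure. Substandard Borel space. Let $\mathbb{S}=\{0,1\}^\infty$ be the space of $0$-$1$ sequences with the metric $d((s_n),(s'_n))=\sum_{n=1}^\infty|s_n-s'_n|2^{-n}$ and Borel $\sigma$-field $\mathcal{B}(\mathbb{S})$. $(\mathbb{X},\mathcal{X})$ is substandard Borel if there is a map $f:\mathbb{X}\to\mathbb{S}$ with $f^{-1}(\mathcal{B}(\mathbb{S}))=\mathcal{X}$ and $f(\mathbb{X})\in\mathcal{B}(\mathbb{S})$. Factorial measures. For each $\mu\in\mathbf{N}$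 there is a unique sequence of symmetric measures $\mu^{(m)}$ on $(\mathbb{X}^m,\mathcal{X}^{\otimes m})$, $m\in\mathbb{N}$, taking values in $\mathbb{N}_0$ on measurable subsets of $B_j^m$ (for each $j$), with $\mu^{(1)}=\mu$ and $$\mu^{(m+1)}(\cdot)=\int_{\mathbb{X}^m}\Big(\int_{\mathbb{X}}\mathbf{1}\{(x_1,\dots,x_{m+1})\in\cdot\}\,\mathrm{d}\mu(x_{m+1})-\sum_{j=1}^m\mathbf{1}\{(x_1,\dots,x_m,x_j)\in\cdot\}\Big)\mathrm{d}\mu^{(m)}(x_1,\dots,x_m).$$ Janossy measures and densities. For a point process $\eta$, $B\in\mathcal{X}$, $m\in\mathbb{N}$: $J_{\eta,B,m}(\cdot)=\frac1{m!}\mathbb{E}\big[\mathbf{1}\{\eta(B)=m\}\,\eta_B^{(m)}(\cdot)\big]$, a measure on $(\mathbb{X}^m,\mathcal{X}^{\otimes m})$. If $J_{\eta,B,m}$ is absolutely continuous with respect to $\lambda_B^m$, its density $j_{\eta,B,m}$ is the Janossy density. Local and tame functions, local convergence. A function $F:\mathbf{N}\to[-\infty,\infty]$ is local if there is $B\in\mathcal{X}_b$ with $F(\mu)=F(\mu_B)$ for all $\mu\in\mathbf{N}$; it is tame if there are $C\ge0$ and $B\in\mathcal{X}_b$ with $|F(\mu)|\le C(1+\mu(B))$ for all $\mu\in\mathbf{N}$. Point processes $\eta_n$ converge locally to $\eta$ if $\mathbb{E}[F(\eta_n)]\to\mathbb{E}[F(\eta)]$ as $n\to\infty$ for every measurable,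 local, and tame $F:\mathbf{N}\to[0,\infty)$ for which the expectations are finite. *)

theory Defs
  imports "HOL-Probability.Probability"
begin

text \<open>
  A measurable space is given by \<^term>\<open>space M\<close> and \<^term>\<open>sets M\<close> of some
  \<^term>\<open>M :: 'a measure\<close>; the measure carried by \<^term>\<open>M\<close> is never used.
\<close>

definition localizing :: "'a measure \<Rightarrow> (nat \<Rightarrow> 'a set) \<Rightarrow> bool" where
  "localizing M L \<longleftrightarrow> range L \<subseteq> sets M \<and> incseq L \<and> (\<Union>j. L j) = space M"

definition bounded_sets :: "'a measure \<Rightarrow> (nat \<Rightarrow> 'a set) \<Rightarrow> 'a set set" where
  "bounded_sets M L = {B \<in> sets M. \<exists>j. B \<subseteq> L j}"

definition locally_finite :: "'a measure \<Rightarrow> (nat \<Rightarrow> 'a set) \<Rightarrow> 'a measure \<Rightarrow> bool" where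
  "locally_finite M L \<nu> \<longleftrightarrow>
     sets \<nu> = sets M \<and> (\<forall>B\<in>bounded_sets M L. emeasure \<nu> B < \<infinity>)"

text \<open>
  The 0-1 sequences are modelled by \<^typ>\<open>nat \<Rightarrow> bool\<close>, indexed from 0, hence the
  exponent \<^term>\<open>Suc n\<close>.
\<close>

definition cantor_dist :: "(nat \<Rightarrow> bool) \<Rightarrow> (nat \<Rightarrow> bool) \<Rightarrow> real" where
  "cantor_dist s t = (\<Sum>n. \<bar>of_bool (s n) - of_bool (t n)\<bar> * (1/2) ^ Suc n)"

definition cantor_borel :: "(nat \<Rightarrow> bool) measure" where
  "cantor_borel = sigma UNIV {U. openin (Metric_space.mtopology UNIV cantor_dist) U}"

definition substandard_borel :: "'a measure \<Rightarrow> bool" where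
  "substandard_borel M \<longleftrightarrow>
     (\<exists>f :: 'a \<Rightarrow> nat \<Rightarrow> bool.
        sets M = (\<lambda>A. f -` A \<inter> space M) ` sets cantor_borel \<and>
        f ` space M \<in> sets cantor_borel)"

definition counting_measures :: "'a measure \<Rightarrow> (nat \<Rightarrow> 'a set) \<Rightarrow> 'a measure set" where
  "counting_measures M L =
     {\<mu>. sets \<mu> = sets M \<and> (\<forall>B\<in>bounded_sets M L. emeasure \<mu> B \<in> \<nat>)}"

definition counting_algebra :: "'a measure \<Rightarrow> (nat \<Rightarrow> 'a set) \<Rightarrow> 'a measure measure" where
  "counting_algebra M L =
     sigma (counting_measures M L)
       {(\<lambda>\<mu>. emeasure \<mu> A) -` U \<inter> counting_measures M L | A U.
          A \<in> sets M \<and> U \<in> sets borel}"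

definition point_process ::
    "'a measure \<Rightarrow> (nat \<Rightarrow> 'a set) \<Rightarrow> 'w measure \<Rightarrow> ('w \<Rightarrow> 'a measure) \<Rightarrow> bool" where
  "point_process M L P \<eta> \<longleftrightarrow> prob_space P \<and> \<eta> \<in> measurable P (counting_algebra M L)"

text \<open>
  The restriction of \<open>\<mu>\<close> to \<open>B\<close> keeps the whole space as its carrier (unlike
  \<^const>\<open>restrict_space\<close>): it maps a measurable \<open>A\<close> to \<open>\<mu> (A \<inter> B)\<close>.
\<close>

definition restr :: "'a measure \<Rightarrow> 'a set \<Rightarrow> 'a measure" where
  "restr \<mu> B = density \<mu> (indicator B)"

text \<open>
  Points of the \<open>m\<close>-fold product are extensional functions on \<^term>\<open>{..<m::nat}\<close>, and
  \<^term>\<open>x(m := y)\<close> appends \<open>y\<close> to the \<open>m\<close>-tuple \<open>x\<close>. Subtraction on \<^typ>\<open>ennreal\<close>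
  is truncated at 0. This is harmless: the integrand in the recursion is nonnegative almost
  everywhere with respect to the \<open>m\<close>-th factorial measure, and the subtrahend is at most
  \<open>m\<close>, so that infinity minus infinity does not occur. The case \<open>m = 0\<close> is a convention.
\<close>

fun factorial_measure :: "'a measure \<Rightarrow> nat \<Rightarrow> (nat \<Rightarrow> 'a) measure" where
  "factorial_measure \<mu> 0 = return (PiM {} (\<lambda>_. \<mu>)) (\<lambda>_. undefined)"
| "factorial_measure \<mu> (Suc 0) = distr \<mu> (PiM {..<1} (\<lambda>_. \<mu>)) (\<lambda>x. \<lambda>i\<in>{..<1}. x)"
| "factorial_measure \<mu> (Suc (Suc k)) =
     (let m = Suc k in
      measure_of (space (PiM {..<Suc m} (\<lambda>_. \<mu>))) (sets (PiM {..<Suc m} (\<lambda>_. \<mu>)))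
        (\<lambda>C. \<integral>\<^sup>+x. ((\<integral>\<^sup>+y. indicator C (x(m := y)) \<partial>\<mu>)
                    - (\<Sum>j<m. indicator C (x(m := x j)))) \<partial>factorial_measure \<mu> m))"

definition janossy_measure ::
    "'a measure \<Rightarrow> 'w measure \<Rightarrow> ('w \<Rightarrow> 'a measure) \<Rightarrow> 'a set \<Rightarrow> nat \<Rightarrow> (nat \<Rightarrow> 'a) measure"
  where
  "janossy_measure M P \<eta> B m =
     measure_of (space (PiM {..<m} (\<lambda>_. M))) (sets (PiM {..<m} (\<lambda>_. M)))
       (\<lambda>C. ennreal (1 / fact m) *
         (\<integral>\<^sup>+\<omega>. indicator {\<omega>. emeasure (\<eta> \<omega>) B = of_nat m} \<omega> *
               emeasure (factorial_measure (restr (\<eta> \<omega>) B) m) C \<partial>P))"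

definition restr_power :: "'a measure \<Rightarrow> 'a set \<Rightarrow> nat \<Rightarrow> (nat \<Rightarrow> 'a) measure" where
  "restr_power \<nu> B m = PiM {..<m} (\<lambda>_. restr \<nu> B)"

definition is_janossy_density ::
    "'a measure \<Rightarrow> 'a measure \<Rightarrow> 'w measure \<Rightarrow> ('w \<Rightarrow> 'a measure) \<Rightarrow> 'a set \<Rightarrow> nat \<Rightarrow>
     ((nat \<Rightarrow> 'a) \<Rightarrow> ennreal) \<Rightarrow> bool" where
  "is_janossy_density M \<nu> P \<eta> B m j \<longleftrightarrow>
     j \<in> borel_measurable (restr_power \<nu> B m) \<and>
     janossy_measure M P \<eta> B m = density (restr_power \<nu> B m) j"

definition local_function ::
    "'a measure \<Rightarrow> (nat \<Rightarrow> 'a set) \<Rightarrow> ('a measure \<Rightarrow> 'b) \<Rightarrow> bool" where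
  "local_function M L F \<longleftrightarrow>
     (\<exists>B\<in>bounded_sets M L. \<forall>\<mu>\<in>counting_measures M L. F \<mu> = F (restr \<mu> B))"

definition tame_function ::
    "'a measure \<Rightarrow> (nat \<Rightarrow> 'a set) \<Rightarrow> ('a measure \<Rightarrow> ereal) \<Rightarrow> bool" where
  "tame_function M L F \<longleftrightarrow>
     (\<exists>C::real. C \<ge> 0 \<and> (\<exists>B\<in>bounded_sets M L. \<forall>\<mu>\<in>counting_measures M L.
        \<bar>F \<mu>\<bar> \<le> ereal C * (1 + enn2ereal (emeasure \<mu> B))))"

definition converges_locally ::
    "'a measure \<Rightarrow> (nat \<Rightarrow> 'a set) \<Rightarrow> (nat \<Rightarrow> 'w measure) \<Rightarrow> (nat \<Rightarrow> 'w \<Rightarrow> 'a measure) \<Rightarrow>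
     'v measure \<Rightarrow> ('v \<Rightarrow> 'a measure) \<Rightarrow> bool" where
  "converges_locally M L P \<eta> Q \<xi> \<longleftrightarrow>
     (\<forall>F :: 'a measure \<Rightarrow> real.
        F \<in> borel_measurable (counting_algebra M L) \<and>
        (\<forall>\<mu>\<in>counting_measures M L. 0 \<le> F \<mu>) \<and>
        local_function M L F \<and> tame_function M L (\<lambda>\<mu>. ereal (F \<mu>)) \<and>
        (\<forall>n. integrable (P n) (\<lambda>\<omega>. F (\<eta> n \<omega>))) \<and> integrable Q (\<lambda>\<omega>. F (\<xi> \<omega>))
        \<longrightarrow> (\<lambda>n. \<integral>\<omega>. F (\<eta> n \<omega>) \<partial>P n) \<longlonglongrightarrow> (\<integral>\<omega>. F (\<xi> \<omega>) \<partial>Q))"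

end

theory Submission
  imports Defs "HOL-Library.Diagonal_Subsequence"
begin

text \<open>
  Restrict the processes to a bounded set \<open>B\<close>. The Janossy density of order \<open>m\<close> is the density
  of the law of \<open>(\<eta> n)\<^sub>B\<close> on the event of exactly \<open>m\<close> points, written on ordered tuples
  (\<open>emeasure_law_eq_integral\<close>). Uniform integrability of these densities for each \<open>m\<close>, together
  with the summable bound on the probabilities of \<open>m\<close> points, makes the laws uniformly countably
  additive: if measurable sets of configurations decrease to the empty set, then their probabilities
  tend to 0 uniformly in \<open>n\<close> (\<open>law_uniformly_countably_additive\<close>).

  The \<open>\<sigma>\<close>-field of the counting measures is countably generated, so a diagonal argument gives a
  subsequence along which the probabilities converge on a countable \<open>\<inter>\<close>-stable generator, for all the
  sets \<open>L j\<close> at once. Uniform countable additivity extends the convergence to the whole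
  \<open>\<sigma>\<close>-field by Dynkin's theorem, and makes the limits countably additive
  (\<open>setwise_sequential_compactness\<close>). Setwise convergence gives convergence of the expectations of
  bounded local functions. Tame functions are reduced to bounded ones by truncation, with the tail
  controlled by the summability of \<open>m * c B m\<close> (\<open>tame_convergence\<close>).

  The limits for the different \<open>L j\<close> are consistent. To obtain one point process from them, a counting
  measure is coded by its numbers of points in countably many cells of the sets \<open>L j\<close> minus their
  predecessors. The codes lie in a product of Polish spaces, where Kolmogorov's extension theorem applies
  (\<open>consistent_laws_extend\<close>).

  Both the evaluation of Janossy measures and the decoding rest on a measurable enumeration of the
  points of a counting measure in a bounded set (\<open>emeasure_eq_card_points\<close>). The space is coded by
  0-1 sequences; a finite integer-valued measure on the Cantor space is a sum of Dirac measures, and the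
  \<open>k\<close>-th of its atoms in lexicographic order is found by descending the binary tree with the help of the
  numbers of points in the cylinders (\<open>bij_betw_rank\<close>).
\<close>

section \<open>The Cantor space and its cylinders\<close>

definition cylinder :: "bool list \<Rightarrow> (nat \<Rightarrow> bool) set" where
  "cylinder w = {s. map s [0..<length w] = w}"

lemma cylinder_Nil [simp]: "cylinder [] = UNIV"
  by (simp add: cylinder_def)

lemma mem_cylinder_snoc:
  "s \<in> cylinder (w @ [b]) \<longleftrightarrow> s \<in> cylinder w \<and> s (length w) = b"
  by (simp add: cylinder_def)

lemma mem_cylinder_iff: "s \<in> cylinder w \<longleftrightarrow> (\<forall>i<length w. s i = w ! i)"
  unfolding cylinder_def mem_Collect_eq list_eq_iff_nth_eq by simp

lemma cantor_dist_summable: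
  "summable (\<lambda>n. \<bar>of_bool (s n) - of_bool (t n) :: real\<bar> * (1/2) ^ Suc n)"
  by (rule summable_comparison_test'[where N = 0 and g = "\<lambda>n. (1/2::real) ^ Suc n"])
     (auto simp: summable_mult summable_geometric)

lemma Metric_space_cantor: "Metric_space UNIV cantor_dist"
proof
  fix s t u :: "nat \<Rightarrow> bool"
  show "0 \<le> cantor_dist s t"
    unfolding cantor_dist_def by (rule suminf_nonneg[OF cantor_dist_summable]) auto
  show "cantor_dist s t = cantor_dist t s"
    unfolding cantor_dist_def by (simp add: abs_minus_commute)
  show "cantor_dist s t = 0 \<longleftrightarrow> s = t"
  proof
    assume "cantor_dist s t = 0"
    then have "\<bar>of_bool (s n) - of_bool (t n) :: real\<bar> * (1/2) ^ Suc n = 0" for n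
      unfolding cantor_dist_def by (subst (asm) suminf_eq_zero_iff[OF cantor_dist_summable]) simp_all
    then have *: "(of_bool (s n) :: real) = of_bool (t n)" for n
      by (metis abs_eq_0 mult_eq_0_iff power_not_zero right_minus_eq zero_neq_numeral
          divide_eq_0_iff zero_neq_one)
    have "s n = t n" for n using *[of n] by (simp only: of_bool_eq_iff)
    then show "s = t" by (rule ext)
  qed (simp add: cantor_dist_def)
  show "cantor_dist s u \<le> cantor_dist s t + cantor_dist t u"
    unfolding cantor_dist_def suminf_add[OF cantor_dist_summable cantor_dist_summable]
  proof (rule suminf_le)
    show "\<bar>of_bool (s n) - of_bool (u n)\<bar> * (1/2) ^ Suc n
        \<le> \<bar>of_bool (s n) - of_bool (t n)\<bar> * (1/2) ^ Suc n
          + \<bar>of_bool (t n) - of_bool (u n) :: real\<bar> * (1/2) ^ Suc n" for n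
      unfolding distrib_right[symmetric] by (rule mult_right_mono) auto
  qed (intro summable_add cantor_dist_summable)+
qed

lemma cantor_dist_ge:
  assumes "s i \<noteq> t i"
  shows "(1/2) ^ Suc i \<le> cantor_dist s t"
proof -
  have "(\<Sum>n\<in>{i}. \<bar>of_bool (s n) - of_bool (t n) :: real\<bar> * (1/2) ^ Suc n) \<le> cantor_dist s t"
    unfolding cantor_dist_def by (rule sum_le_suminf[OF cantor_dist_summable]) auto
  then show ?thesis using assms by (auto split: if_splits)
qed

lemma cantor_dist_le:
  assumes "\<And>i. i < m \<Longrightarrow> s i = t i"
  shows "cantor_dist s t \<le> (1/2) ^ m"
proof -
  let ?f = "\<lambda>n. \<bar>of_bool (s n) - of_bool (t n) :: real\<bar> * (1/2) ^ Suc n"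
  have "cantor_dist s t = (\<Sum>n. ?f (n + m)) + (\<Sum>n<m. ?f n)"
    unfolding cantor_dist_def by (rule suminf_split_initial_segment[OF cantor_dist_summable])
  also have "(\<Sum>n<m. ?f n) = 0"
    using assms by (intro sum.neutral) auto
  also have "(\<Sum>n. ?f (n + m)) \<le> (\<Sum>n. (1/2) ^ Suc m * (1/2) ^ n)"
  proof (rule suminf_le)
    show "?f (n + m) \<le> (1/2) ^ Suc m * (1/2) ^ n" for n
    proof -
      have "?f (n + m) \<le> 1 * (1/2) ^ Suc (n + m)"
        by (rule mult_right_mono) (auto simp: of_bool_def)
      also have "\<dots> = (1/2) ^ Suc m * (1/2) ^ n"
        by (simp add: power_add)
      finally show ?thesis .
    qed
    show "summable (\<lambda>n. ?f (n + m))"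
      using cantor_dist_summable by (rule summable_ignore_initial_segment)
    show "summable (\<lambda>n. (1/2) ^ Suc m * (1/2::real) ^ n)"
      by (intro summable_mult summable_geometric) simp
  qed
  also have "(\<Sum>n. (1/2) ^ Suc m * (1/2) ^ n) = (1/2::real) ^ m"
    using suminf_mult[of "\<lambda>n. (1/2::real) ^ n" "(1/2) ^ Suc m"] suminf_geometric[of "1/2::real"]
      summable_geometric[of "1/2::real"] by simp
  finally show ?thesis by simp
qed

lemma open_cylinder: "openin (Metric_space.mtopology UNIV cantor_dist) (cylinder w)"
proof -
  interpret Metric_space UNIV cantor_dist by (rule Metric_space_cantor)
  show ?thesis
    unfolding openin_mtopology
  proof (intro conjI allI impI)
    fix s assume s: "s \<in> cylinder w"
    have "mball s ((1/2) ^ length w) \<subseteq> cylinder w"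
    proof (safe, rule ccontr)
      fix t assume t: "t \<in> mball s ((1/2) ^ length w)" "t \<notin> cylinder w"
      then obtain i where i: "i < length w" "s i \<noteq> t i"
        using s by (auto simp: mem_cylinder_iff)
      have "(1/2::real) ^ length w \<le> (1/2) ^ Suc i"
        using i by (intro power_decreasing) auto
      also have "\<dots> \<le> cantor_dist s t"
        by (rule cantor_dist_ge) fact
      finally show False using t(1) by (simp add: in_mball)
    qed
    moreover have "(0::real) < (1/2) ^ length w" by simp
    ultimately show "\<exists>r>0. mball s r \<subseteq> cylinder w" by blast
  qed simp
qed

text \<open>Every open set of the Cantor space is the union of the countably many cylinders inside it.\<close>

lemma sets_cantor_borel: "sets cantor_borel = sigma_sets UNIV (range cylinder)"
proof -
  interpret Metric_space UNIV cantor_dist by (rule Metric_space_cantor)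
  have "sets cantor_borel = sigma_sets UNIV {U. openin mtopology U}"
    by (simp add: cantor_borel_def)
  also have "\<dots> = sigma_sets UNIV (range cylinder)"
  proof (rule sigma_sets_eqI)
    fix U assume "U \<in> {U. openin mtopology U}"
    then have U: "\<exists>r>0. mball s r \<subseteq> U" if "s \<in> U" for s
      using that by (auto simp: openin_mtopology)
    have "U = (\<Union>w\<in>{w. cylinder w \<subseteq> U}. cylinder w)"
    proof (intro equalityI subsetI)
      fix s assume "s \<in> U"
      with U obtain r where r: "r > 0" "mball s r \<subseteq> U" by blast
      obtain m where m: "(1/2::real) ^ m < r"
        using real_arch_pow_inv[OF r(1), of "1/2"] by auto
      have "cylinder (map s [0..<m]) \<subseteq> mball s r"
      proof
        fix t assume "t \<in> cylinder (map s [0..<m])"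
        then have "cantor_dist s t \<le> (1/2) ^ m"
          by (intro cantor_dist_le) (simp add: mem_cylinder_iff)
        then show "t \<in> mball s r" using m by (simp add: in_mball)
      qed
      then show "s \<in> (\<Union>w\<in>{w. cylinder w \<subseteq> U}. cylinder w)"
        using r by (intro UN_I[of "map s [0..<m]"]) (simp_all add: mem_cylinder_iff)
    qed auto
    moreover have "\<Union> (cylinder ` {w. cylinder w \<subseteq> U}) \<in> sigma_sets UNIV (range cylinder)"
      by (rule sigma_sets_UNION) (auto intro: sigma_sets.Basic)
    ultimately show "U \<in> sigma_sets UNIV (range cylinder)" by (rule ssubst)
  qed (use open_cylinder in \<open>auto intro: sigma_sets.Basic\<close>)
  finally show ?thesis .
qed

lemma space_cantor_borel [simp]: "space cantor_borel = UNIV"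
  by (simp add: cantor_borel_def space_measure_of_conv)

lemma cylinder_in_sets [measurable, simp]: "cylinder w \<in> sets cantor_borel"
  by (simp add: sets_cantor_borel sigma_sets.Basic)

lemma cylinder_Int_cases:
  "cylinder v \<inter> cylinder w \<in> insert {} (range cylinder)"
proof -
  have *: "cylinder v \<inter> cylinder w \<in> insert {} (range cylinder)" if "length v \<le> length w" for v w
  proof (cases "cylinder v \<inter> cylinder w = {}")
    case False
    then obtain s where s: "s \<in> cylinder v" "s \<in> cylinder w" by auto
    have "cylinder w \<subseteq> cylinder v"
    proof
      fix t assume "t \<in> cylinder w"
      then have "t i = s i" if "i < length w" for i
        using s(2) that by (simp add: mem_cylinder_iff)
      then show "t \<in> cylinder v"
        using s(1) \<open>length v \<le> length w\<close> by (simp add: mem_cylinder_iff)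
    qed
    then have "cylinder v \<inter> cylinder w = cylinder w" by (rule Int_absorb1)
    then show ?thesis by simp
  qed simp
  show ?thesis
  proof (cases "length v \<le> length w")
    case False
    with *[of w v] show ?thesis by (subst Int_commute) simp
  qed (rule *)
qed

lemma measure_eqI_cylinders:
  assumes "sets \<mu> = sets cantor_borel" "sets \<mu>' = sets cantor_borel"
    and "\<And>w. emeasure \<mu> (cylinder w) = emeasure \<mu>' (cylinder w)"
    and "emeasure \<mu> UNIV \<noteq> \<infinity>"
  shows "\<mu> = \<mu>'"
proof (rule measure_eqI_generator_eq[where \<Omega> = UNIV and E = "insert {} (range cylinder)"
      and A = "\<lambda>_. UNIV"])
  have "sigma_sets UNIV (range cylinder) = sigma_sets UNIV (insert {} (range cylinder))"
    by (intro sigma_sets_eqI) (auto intro: sigma_sets.Basic sigma_sets.Empty)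
  then show "sets \<mu> = sigma_sets UNIV (insert {} (range cylinder))"
    "sets \<mu>' = sigma_sets UNIV (insert {} (range cylinder))"
    by (simp_all add: assms sets_cantor_borel)
  show "Int_stable (insert {} (range cylinder))"
    using cylinder_Int_cases by (auto simp: Int_stable_def)
  show "range (\<lambda>_. UNIV) \<subseteq> insert {} (range cylinder)"
    by (auto intro: image_eqI[of _ _ "[]"])
  show "emeasure \<mu> X = emeasure \<mu>' X" if "X \<in> insert {} (range cylinder)" for X
    using that assms(3) by (elim insertE) auto
  show "emeasure \<mu> UNIV \<noteq> \<infinity>" by fact
qed auto

lemma measurable_into_cantor:
  assumes "\<And>i. (\<lambda>x. t x i) \<in> measurable N (count_space UNIV)"
  shows "t \<in> measurable N cantor_borel"
proof -
  have "t \<in> measurable N (sigma UNIV (range cylinder))"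
  proof (rule measurable_measure_of)
    fix y assume "y \<in> range cylinder"
    then obtain w where y: "y = cylinder w" by auto
    have "t -` y \<inter> space N = {x\<in>space N. \<forall>i<length w. t x i = w ! i}"
      by (auto simp: y mem_cylinder_iff)
    also have "\<dots> \<in> sets N"
      using assms by measurable
    finally show "t -` y \<inter> space N \<in> sets N" .
  qed auto
  moreover have "sets (sigma UNIV (range cylinder)) = sets cantor_borel"
    by (simp add: sets_cantor_borel)
  ultimately show ?thesis
    by (simp cong: measurable_cong_sets)
qed

section \<open>Ranking the atoms of an integer-valued measure on the Cantor space\<close>

text \<open>
  \<open>a w\<close> is thought of as the number of atoms in the cylinder of \<open>w\<close>. Number the atoms
  \<open>0, \<dots>, a [] - 1\<close> in lexicographic order, with multiplicity. After \<open>m\<close> steps down the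
  binary tree, the state of the \<open>k\<close>-th atom is its prefix of length \<open>m\<close> together with its rank
  among the atoms that share this prefix. Only finitely many values of \<open>a\<close> enter each step, and
  that is what makes the atoms measurable functions of \<open>a\<close>.
\<close>

fun descend :: "(bool list \<Rightarrow> nat) \<Rightarrow> nat \<Rightarrow> nat \<Rightarrow> bool list \<times> nat" where
  "descend a k 0 = ([], k)"
| "descend a k (Suc m) =
     (let (w, r) = descend a k m; l = a (w @ [False])
      in if r < l then (w @ [False], r) else (w @ [True], r - l))"

definition atom :: "(bool list \<Rightarrow> nat) \<Rightarrow> nat \<Rightarrow> nat \<Rightarrow> bool" where
  "atom a k i = last (fst (descend a k (Suc i)))"

lemma fst_descend: "fst (descend a k m) = map (atom a k) [0..<m]"
proof (induction m)
  case (Suc m)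
  then show ?case
    by (cases "descend a k m") (auto simp: atom_def Let_def)
qed simp

lemma atom_in_cylinder_iff: "atom a k \<in> cylinder w \<longleftrightarrow> fst (descend a k (length w)) = w"
  by (simp add: cylinder_def fst_descend)

text \<open>
  The second component of the state is the rank of the \<open>k\<close>-th atom among the atoms in the
  current cylinder. It therefore numbers them bijectively by \<open>0, \<dots>, a w - 1\<close>.
\<close>

lemma bij_betw_rank:
  assumes add: "\<And>w. a w = a (w @ [False]) + a (w @ [True])"
  shows "bij_betw (\<lambda>k. snd (descend a k (length w)))
           {k. k < a [] \<and> fst (descend a k (length w)) = w} {..<a w}"
proof (induction w rule: rev_induct)
  case Nil
  show ?case by (auto simp: bij_betw_def inj_on_def)
next
  case (snoc b w)
  let ?rk = "\<lambda>k. snd (descend a k (length w))"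
  let ?S = "{k. k < a [] \<and> fst (descend a k (length w)) = w}"
  let ?T = "{k. k < a [] \<and> fst (descend a k (length (w @ [b]))) = w @ [b]}"
  have step: "descend a k (length (w @ [b'])) =
      (if ?rk k < a (w @ [False]) then (w @ [False], ?rk k)
       else (w @ [True], ?rk k - a (w @ [False])))"
    if "fst (descend a k (length w)) = w" for k b'
    using that by (cases "descend a k (length w)") (auto simp: Let_def)
  have pre: "fst (descend a k (length w)) = w"
    if "fst (descend a k (length (w @ [b]))) = w @ [b]" for k
    using that by (simp add: fst_descend del: descend.simps)
  from snoc have inj: "inj_on ?rk ?S" and im: "?rk ` ?S = {..<a w}"
    by (auto simp: bij_betw_def)
  show ?case
  proof (cases b)
    case False
    have T: "?T = {k\<in>?S. ?rk k < a (w @ [False])}"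
    proof -
      have "fst (descend a k (length (w @ [b]))) = w @ [b] \<longleftrightarrow>
          fst (descend a k (length w)) = w \<and> ?rk k < a (w @ [False])" for k
      proof (cases "fst (descend a k (length w)) = w")
        case eq: True
        show ?thesis using \<open>\<not> b\<close> eq step[OF eq, of b] by (simp del: descend.simps)
      next
        case False
        with pre[of k] show ?thesis by blast
      qed
      then show ?thesis by (simp del: descend.simps add: conj_assoc)
    qed
    have "bij_betw ?rk ?T {..<a (w @ [False])}"
      unfolding bij_betw_def
    proof
      show "inj_on ?rk ?T" unfolding T by (rule inj_on_subset[OF inj]) blast
      show "?rk ` ?T = {..<a (w @ [False])}"
      proof (intro equalityI subsetI)
        fix r assume r: "r \<in> {..<a (w @ [False])}"
        then have "r \<in> ?rk ` ?S" unfolding im using add[of w] by simp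
        then obtain k where k: "r = ?rk k" "k \<in> ?S" by (rule imageE)
        with r have "k \<in> ?T" unfolding T by simp
        with k(1) show "r \<in> ?rk ` ?T" by (rule image_eqI)
      next
        fix r assume "r \<in> ?rk ` ?T"
        then show "r \<in> {..<a (w @ [False])}" unfolding T by (elim imageE) simp
      qed
    qed
    moreover have "snd (descend a k (length (w @ [b]))) = ?rk k" if "k \<in> ?T" for k
      using that step[of k b] unfolding T by (simp del: descend.simps)
    ultimately have "bij_betw (\<lambda>k. snd (descend a k (length (w @ [b])))) ?T {..<a (w @ [False])}"
      by (subst bij_betw_cong)
    then show ?thesis using False by simp
  next
    case True
    let ?l = "a (w @ [False])"
    have T: "?T = {k\<in>?S. ?l \<le> ?rk k}"
    proof -
      have "fst (descend a k (length (w @ [b]))) = w @ [b] \<longleftrightarrow>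
          fst (descend a k (length w)) = w \<and> ?l \<le> ?rk k" for k
      proof (cases "fst (descend a k (length w)) = w")
        case eq: True
        show ?thesis using \<open>b\<close> eq step[OF eq, of b] by (simp del: descend.simps)
      next
        case False
        with pre[of k] show ?thesis by blast
      qed
      then show ?thesis by (simp del: descend.simps add: conj_assoc)
    qed
    have "bij_betw (\<lambda>k. ?rk k - ?l) ?T {..<a (w @ [True])}"
      unfolding bij_betw_def
    proof
      show "inj_on (\<lambda>k. ?rk k - ?l) ?T"
      proof (rule inj_onI)
        fix x y assume xy: "x \<in> ?T" "y \<in> ?T" "?rk x - ?l = ?rk y - ?l"
        then have "?l \<le> ?rk x" "?l \<le> ?rk y" unfolding T by simp_all
        with xy(3) have "?rk x = ?rk y" by arith
        then show "x = y" using xy inj_onD[OF inj, of x y] unfolding T by blast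
      qed
      show "(\<lambda>k. ?rk k - ?l) ` ?T = {..<a (w @ [True])}"
      proof (intro equalityI subsetI)
        fix y assume "y \<in> (\<lambda>k. ?rk k - ?l) ` ?T"
        then obtain k where "k \<in> ?T" and y: "y = ?rk k - ?l" by blast
        then have k: "k \<in> ?S" "?l \<le> ?rk k" unfolding T by blast+
        from k(1) have "?rk k \<in> ?rk ` ?S" by (rule imageI)
        then have "?rk k < a w" unfolding im by simp
        then show "y \<in> {..<a (w @ [True])}" using add[of w] y k(2) by simp
      next
        fix r assume "r \<in> {..<a (w @ [True])}"
        then have "r + ?l \<in> ?rk ` ?S" unfolding im using add[of w] by simp
        then obtain k where k: "r + ?l = ?rk k" "k \<in> ?S" by (rule imageE)
        then have "k \<in> ?T" "r = ?rk k - ?l" unfolding T by simp_all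
        then show "r \<in> (\<lambda>k. ?rk k - ?l) ` ?T" by (rule rev_image_eqI)
      qed
    qed
    moreover have "snd (descend a k (length (w @ [b]))) = ?rk k - ?l" if "k \<in> ?T" for k
      using that step[of k b] unfolding T by (simp del: descend.simps)
    ultimately have "bij_betw (\<lambda>k. snd (descend a k (length (w @ [b])))) ?T {..<a (w @ [True])}"
      by (subst bij_betw_cong)
    then show ?thesis using True by simp
  qed
qed

lemma card_atoms_cylinder:
  assumes "\<And>w. a w = a (w @ [False]) + a (w @ [True])"
  shows "card {k. k < a [] \<and> atom a k \<in> cylinder w} = a w"
proof -
  have "bij_betw (\<lambda>k. snd (descend a k (length w)))
      {k. k < a [] \<and> fst (descend a k (length w)) = w} {..<a w}"
    by (rule bij_betw_rank) (rule assms)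
  then show ?thesis
    unfolding atom_in_cylinder_iff by (auto dest: bij_betw_same_card)
qed

lemma measurable_atom:
  assumes a: "\<And>w. (\<lambda>x. a x w) \<in> measurable N (count_space UNIV)"
  shows "(\<lambda>x. atom (a x) k) \<in> measurable N cantor_borel"
proof -
  have d: "(\<lambda>x. descend (a x) k m) \<in> measurable N (count_space UNIV)" for m
  proof (induction m)
    case (Suc m)
    define next_state where "next_state p x =
      (case p of (w, r) \<Rightarrow> let l = a x (w @ [False])
         in if r < l then (w @ [False], r) else (w @ [True], r - l))" for p x
    have "(\<lambda>x. next_state p x) \<in> measurable N (count_space UNIV)" for p
    proof -
      obtain w r where p: "p = (w, r)" by (cases p)
      have "(\<lambda>l::nat. if r < l then (w @ [False], r) else (w @ [True], r - l))
          \<in> measurable (count_space UNIV) (count_space UNIV)"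
        by simp
      from measurable_compose[OF a[of "w @ [False]"] this] show ?thesis
        by (simp add: next_state_def p Let_def)
    qed
    from measurable_compose_countable[where f = next_state, OF this Suc]
    show ?case
      unfolding descend.simps next_state_def Let_def case_prod_beta .
  qed simp
  show ?thesis
  proof (rule measurable_into_cantor)
    show "(\<lambda>x. atom (a x) k i) \<in> measurable N (count_space UNIV)" for i
      unfolding atom_def
      by (rule measurable_compose[OF d[of "Suc i"], where g = "\<lambda>p. last (fst p)"]) simp
  qed
qed

section \<open>Counting measures on a localized space\<close>

locale localized_space =
  fixes M :: "'a measure" and L :: "nat \<Rightarrow> 'a set"
  assumes localizing: "localizing M L"
begin

abbreviation bounded where "bounded B \<equiv> B \<in> bounded_sets M L"
abbreviation CM where "CM \<equiv> counting_measures M L"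
abbreviation CA where "CA \<equiv> counting_algebra M L"

lemma sets_L [measurable, simp]: "L i \<in> sets M"
  using localizing by (auto simp: localizing_def)

lemma incseq_L: "incseq L"
  using localizing by (simp add: localizing_def)

lemma UN_L: "(\<Union>i. L i) = space M"
  using localizing by (simp add: localizing_def)

lemma bounded_L [simp]: "bounded (L i)"
  by (auto simp: bounded_sets_def)

lemma bounded_subset: "bounded B \<Longrightarrow> C \<in> sets M \<Longrightarrow> C \<subseteq> B \<Longrightarrow> bounded C"
  by (auto simp: bounded_sets_def)

lemma bounded_sets_D [measurable_dest]: "bounded B \<Longrightarrow> B \<in> sets M"
  by (simp add: bounded_sets_def)

lemma bounded_imp_subset_L: "bounded B \<Longrightarrow> \<exists>i. B \<subseteq> L i"
  by (auto simp: bounded_sets_def)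

lemma bounded_Int: "bounded B \<Longrightarrow> C \<in> sets M \<Longrightarrow> bounded (C \<inter> B)"
  by (rule bounded_subset[of B]) (auto dest: bounded_sets_D)

lemma sets_CM: "\<mu> \<in> CM \<Longrightarrow> sets \<mu> = sets M"
  by (simp add: counting_measures_def)

lemma space_CM: "\<mu> \<in> CM \<Longrightarrow> space \<mu> = space M"
  by (rule sets_eq_imp_space_eq) (rule sets_CM)

lemma emeasure_CM_bounded:
  assumes "\<mu> \<in> CM" "bounded B"
  obtains k where "emeasure \<mu> B = of_nat k"
proof -
  have "emeasure \<mu> B \<in> \<nat>" using assms by (auto simp: counting_measures_def)
  then show ?thesis by (auto elim: Nats_cases intro: that)
qed

lemma CM_I:
  assumes "sets \<mu> = sets M" "\<And>B. bounded B \<Longrightarrow> \<exists>k. emeasure \<mu> B = of_nat k"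
  shows "\<mu> \<in> CM"
  using assms by (auto simp: counting_measures_def) (metis of_nat_in_Nats)

lemma space_CA [simp]: "space CA = CM"
  unfolding counting_algebra_def by (rule space_measure_of) auto

lemma sets_CA: "sets CA = sigma_sets CM
    {(\<lambda>\<mu>. emeasure \<mu> A) -` U \<inter> CM | A U. A \<in> sets M \<and> U \<in> sets borel}"
  unfolding counting_algebra_def by (rule sets_measure_of) auto

lemma measurable_emeasure_CA [measurable]:
  assumes "A \<in> sets M"
  shows "(\<lambda>\<mu>. emeasure \<mu> A) \<in> borel_measurable CA"
proof (rule measurableI)
  fix U :: "ennreal set" assume "U \<in> sets borel"
  with assms show "(\<lambda>\<mu>. emeasure \<mu> A) -` U \<inter> space CA \<in> sets CA"
    unfolding sets_CA space_CA by (intro sigma_sets.Basic) blast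
qed simp

lemma measurable_into_CA:
  assumes "\<And>\<omega>. \<omega> \<in> space K \<Longrightarrow> X \<omega> \<in> CM"
    and "\<And>A. A \<in> sets M \<Longrightarrow> (\<lambda>\<omega>. emeasure (X \<omega>) A) \<in> borel_measurable K"
  shows "X \<in> measurable K CA"
  unfolding counting_algebra_def
proof (rule measurable_measure_of)
  show "X \<in> space K \<rightarrow> CM" using assms(1) by blast
  fix y assume "y \<in> {(\<lambda>\<mu>. emeasure \<mu> A) -` U \<inter> CM |A U. A \<in> sets M \<and> U \<in> sets borel}"
  then obtain A U where y: "y = (\<lambda>\<mu>. emeasure \<mu> A) -` U \<inter> CM"
    and A: "A \<in> sets M" and U: "U \<in> sets borel" by blast
  have "X -` y \<inter> space K = (\<lambda>\<omega>. emeasure (X \<omega>) A) -` U \<inter> space K"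
    using assms(1) by (auto simp: y)
  also have "\<dots> \<in> sets K" using assms(2)[OF A] U by (rule measurable_sets)
  finally show "X -` y \<inter> space K \<in> sets K" .
qed blast

lemma sets_restr [simp, measurable_cong]: "sets (restr \<mu> B) = sets \<mu>"
  by (simp add: restr_def)

lemma space_restr [simp]: "space (restr \<mu> B) = space \<mu>"
  by (simp add: restr_def)

lemma emeasure_restr:
  assumes "B \<in> sets \<mu>" "A \<in> sets \<mu>"
  shows "emeasure (restr \<mu> B) A = emeasure \<mu> (A \<inter> B)"
proof -
  have "emeasure (restr \<mu> B) A = (\<integral>\<^sup>+x. indicator B x * indicator A x \<partial>\<mu>)"
    unfolding restr_def using assms by (intro emeasure_density) simp_all
  also have "\<dots> = (\<integral>\<^sup>+x. indicator (A \<inter> B) x \<partial>\<mu>)"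
    by (intro nn_integral_cong) (simp split: split_indicator)
  also have "\<dots> = emeasure \<mu> (A \<inter> B)"
    using assms by (intro nn_integral_indicator) simp
  finally show ?thesis .
qed

lemma restr_in_CM [simp]:
  assumes "\<mu> \<in> CM" "B \<in> sets M"
  shows "restr \<mu> B \<in> CM"
proof (rule CM_I)
  fix C assume C: "bounded C"
  have "emeasure (restr \<mu> B) C = emeasure \<mu> (C \<inter> B)"
    using assms C by (intro emeasure_restr) (auto simp: sets_CM dest: bounded_sets_D)
  moreover have "bounded (C \<inter> B)"
    using C assms(2) by (metis bounded_Int Int_commute)
  then obtain k where "emeasure \<mu> (C \<inter> B) = of_nat k"
    using emeasure_CM_bounded[OF assms(1)] by blast
  ultimately show "\<exists>k. emeasure (restr \<mu> B) C = of_nat k" by simp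
qed (simp add: sets_CM assms)

lemma measurable_restr [measurable]:
  assumes [measurable]: "B \<in> sets M"
  shows "(\<lambda>\<mu>. restr \<mu> B) \<in> measurable CA CA"
proof (rule measurable_into_CA)
  fix A assume A [measurable]: "A \<in> sets M"
  have "(\<lambda>\<mu>. emeasure \<mu> (A \<inter> B)) \<in> borel_measurable CA" by measurable
  then show "(\<lambda>\<mu>. emeasure (restr \<mu> B) A) \<in> borel_measurable CA"
    by (rule measurable_cong[THEN iffD1, rotated]) (simp add: emeasure_restr sets_CM A assms)
qed (use assms in simp)

lemma restr_restr:
  assumes "\<mu> \<in> CM" "A \<in> sets M" "B \<in> sets M"
  shows "restr (restr \<mu> A) B = restr \<mu> (A \<inter> B)"
proof (rule measure_eqI)
  fix C assume "C \<in> sets (restr (restr \<mu> A) B)"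
  then show "emeasure (restr (restr \<mu> A) B) C = emeasure (restr \<mu> (A \<inter> B)) C"
    using assms by (simp add: emeasure_restr sets_CM Int_assoc Int_commute[of B A])
qed simp

end

section \<open>Measurable enumeration of the points in a bounded set\<close>

locale localized_cantor = localized_space M L
  for M :: "'a measure" and L :: "nat \<Rightarrow> 'a set" +
  fixes f :: "'a \<Rightarrow> nat \<Rightarrow> bool"
  assumes sets_M: "sets M = (\<lambda>A. f -` A \<inter> space M) ` sets cantor_borel"
    and sets_image: "f ` space M \<in> sets cantor_borel"
    and space_nonempty: "space M \<noteq> {}"
begin

lemma measurable_code [measurable]: "f \<in> measurable M cantor_borel"
proof (rule measurableI)
  fix C assume "C \<in> sets cantor_borel"
  then show "f -` C \<inter> space M \<in> sets M" unfolding sets_M by (rule imageI)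
qed simp

lemma sets_codeE:
  assumes "A \<in> sets M"
  obtains C where "C \<in> sets cantor_borel" "A = f -` C \<inter> space M"
proof -
  from assms have "A \<in> (\<lambda>C. f -` C \<inter> space M) ` sets cantor_borel" unfolding sets_M .
  then show thesis by (elim imageE) (rule that)
qed

text \<open>
  A right inverse of the coding \<open>f\<close>. Sequences that code no point are sent to a fixed point, so
  that the function is total; it stays measurable because the set of codes is a Borel set. The coding may
  identify points, but measurable sets do not separate points with the same code.
\<close>

definition decode :: "(nat \<Rightarrow> bool) \<Rightarrow> 'a" where
  "decode s = (if s \<in> f ` space M then inv_into (space M) f s else (SOME x. x \<in> space M))"

lemma decode_in_space: "decode s \<in> space M"
  using space_nonempty by (simp add: decode_def inv_into_into some_in_eq)

lemma code_decode: "s \<in> f ` space M \<Longrightarrow> f (decode s) = s"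
  by (simp add: decode_def f_inv_into_f)

lemma measurable_decode [measurable]: "decode \<in> measurable cantor_borel M"
proof (rule measurableI)
  fix A assume "A \<in> sets M"
  then obtain C where C: "C \<in> sets cantor_borel" "A = f -` C \<inter> space M"
    by (rule sets_codeE)
  define x0 where "x0 = (SOME x. x \<in> space M)"
  have "decode -` A \<inter> space cantor_borel
      = (C \<inter> f ` space M) \<union> (if x0 \<in> A then UNIV - f ` space M else {})"
  proof (rule set_eqI)
    fix s show "s \<in> decode -` A \<inter> space cantor_borel \<longleftrightarrow>
        s \<in> (C \<inter> f ` space M) \<union> (if x0 \<in> A then UNIV - f ` space M else {})"
    proof (cases "s \<in> f ` space M")
      case True
      then show ?thesis
        using code_decode[OF True] decode_in_space[of s] by (simp add: C(2))
    next
      case False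
      then have "decode s = x0" by (simp add: decode_def x0_def)
      with False show ?thesis by simp
    qed
  qed
  also have "\<dots> \<in> sets cantor_borel"
  proof -
    have "UNIV - f ` space M \<in> sets cantor_borel"
      using sets.compl_sets[OF sets_image] by simp
    then show ?thesis using C(1) sets_image by (simp add: sets.Un sets.Int)
  qed
  finally show "decode -` A \<inter> space cantor_borel \<in> sets cantor_borel" .
qed (rule decode_in_space)

definition cell :: "bool list \<Rightarrow> 'a set" where
  "cell w = f -` cylinder w \<inter> space M"

lemma sets_cell [measurable, simp]: "cell w \<in> sets M"
  unfolding cell_def by (rule measurable_sets[OF measurable_code]) simp

text \<open>
  The cell counts of \<open>\<mu>\<close> in \<open>D\<close> determine \<open>\<mu>\<close> on \<open>D\<close>. They are
  taken as real numbers in order to lie in a Polish space.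
\<close>

definition counts :: "'a set \<Rightarrow> 'a measure \<Rightarrow> bool list \<Rightarrow> real" where
  "counts D \<mu> w = enn2real (emeasure \<mu> (D \<inter> cell w))"

definition number :: "(bool list \<Rightarrow> real) \<Rightarrow> nat" where
  "number z = nat \<lfloor>z []\<rfloor>"

definition code_point :: "(bool list \<Rightarrow> real) \<Rightarrow> nat \<Rightarrow> nat \<Rightarrow> bool" where
  "code_point z k = atom (\<lambda>w. nat \<lfloor>z w\<rfloor>) k"

definition point :: "(bool list \<Rightarrow> real) \<Rightarrow> nat \<Rightarrow> 'a" where
  "point z k = decode (code_point z k)"

lemma point_in_space [simp]: "point z k \<in> space M"
  by (simp add: point_def decode_in_space)

lemma measurable_counts [measurable]:
  assumes [measurable]: "D \<in> sets M"
  shows "counts D \<in> borel_measurable CA"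
proof (rule measurable_coordinatewise_then_product)
  show "(\<lambda>\<mu>. counts D \<mu> w) \<in> borel_measurable CA" for w
    unfolding counts_def by measurable
qed

lemma measurable_floor_coordinate:
  "(\<lambda>z :: bool list \<Rightarrow> real. nat \<lfloor>z w\<rfloor>) \<in> measurable borel (count_space UNIV)"
proof -
  have "(\<lambda>z :: bool list \<Rightarrow> real. z w) \<in> borel_measurable borel"
    by (rule measurable_product_coordinates)
  then show ?thesis by measurable
qed

lemma measurable_number [measurable]: "number \<in> measurable borel (count_space UNIV)"
  unfolding number_def by (rule measurable_floor_coordinate)

lemma measurable_point [measurable]: "(\<lambda>z. point z k) \<in> measurable borel M"
  unfolding point_def code_point_def
  by (rule measurable_compose[OF measurable_atom[OF measurable_floor_coordinate] measurable_decode])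

lemma counts_nat:
  assumes "\<mu> \<in> CM" "bounded D"
  shows "emeasure \<mu> (D \<inter> cell w) = of_nat (nat \<lfloor>counts D \<mu> w\<rfloor>)"
proof -
  have "bounded (cell w \<inter> D)" using assms by (intro bounded_Int) auto
  then obtain k where "emeasure \<mu> (D \<inter> cell w) = of_nat k"
    using emeasure_CM_bounded[OF assms(1)] by (metis Int_commute)
  moreover from this have "counts D \<mu> w = real k"
    by (simp add: counts_def)
  ultimately show ?thesis by simp
qed

lemma emeasure_eq_number:
  assumes "\<mu> \<in> CM" "bounded D"
  shows "emeasure \<mu> D = of_nat (number (counts D \<mu>))"
proof -
  have "D \<inter> cell [] = D"
    using sets.sets_into_space[OF bounded_sets_D[OF assms(2)]] by (auto simp: cell_def)
  with counts_nat[OF assms, of "[]"] show ?thesis by (simp add: number_def)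
qed

lemma counts_additive:
  assumes "\<mu> \<in> CM" "bounded D"
  shows "nat \<lfloor>counts D \<mu> w\<rfloor> = nat \<lfloor>counts D \<mu> (w @ [False])\<rfloor> + nat \<lfloor>counts D \<mu> (w @ [True])\<rfloor>"
proof -
  have [measurable]: "D \<in> sets M" using assms(2) by (rule bounded_sets_D)
  have "D \<inter> cell w = (D \<inter> cell (w @ [False])) \<union> (D \<inter> cell (w @ [True]))"
    by (auto simp: cell_def mem_cylinder_snoc)
  also have "emeasure \<mu> \<dots> = emeasure \<mu> (D \<inter> cell (w @ [False])) + emeasure \<mu> (D \<inter> cell (w @ [True]))"
    by (rule plus_emeasure[symmetric]) (auto simp: sets_CM[OF assms(1)] cell_def mem_cylinder_snoc)
  finally have "of_nat (nat \<lfloor>counts D \<mu> w\<rfloor>) =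
      (of_nat (nat \<lfloor>counts D \<mu> (w @ [False])\<rfloor> + nat \<lfloor>counts D \<mu> (w @ [True])\<rfloor>) :: ennreal)"
    by (simp add: counts_nat[OF assms])
  then show ?thesis by (simp only: of_nat_eq_iff)
qed

text \<open>
  The atoms ranked by the cell counts have the same numbers in all cylinders as the image of \<open>\<mu>\<^sub>D\<close>
  under the coding, so the two measures on the Cantor space coincide.
\<close>

lemma card_code_points:
  assumes \<mu>: "\<mu> \<in> CM" and D: "bounded D" and C: "C \<in> sets cantor_borel"
  shows "of_nat (card {k. k < number (counts D \<mu>) \<and> code_point (counts D \<mu>) k \<in> C})
    = emeasure \<mu> ((f -` C \<inter> space M) \<inter> D)"
proof -
  let ?n = "number (counts D \<mu>)" and ?p = "code_point (counts D \<mu>)"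
  let ?K = "distr (count_space {..<?n}) cantor_borel ?p"
  have [measurable]: "D \<in> sets M" using D by (rule bounded_sets_D)
  have [simp]: "sets \<mu> = sets M" "space \<mu> = space M" using \<mu> by (simp_all add: sets_CM space_CM)
  have K: "emeasure ?K C = of_nat (card {k. k < ?n \<and> ?p k \<in> C})" if "C \<in> sets cantor_borel" for C
  proof -
    have "emeasure ?K C = emeasure (count_space {..<?n}) (?p -` C \<inter> {..<?n})"
      using that by (subst emeasure_distr) auto
    also have "?p -` C \<inter> {..<?n} = {k. k < ?n \<and> ?p k \<in> C}"
      by (simp add: set_eq_iff conj_commute)
    also have "emeasure (count_space {..<?n}) \<dots> = of_nat (card {k. k < ?n \<and> ?p k \<in> C})"
      by (rule emeasure_count_space_finite) (simp_all add: subset_eq)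
    finally show ?thesis .
  qed
  have f_\<mu>: "f \<in> measurable (restr \<mu> D) cantor_borel"
    using measurable_code by (simp cong: measurable_cong_sets)
  have fK: "emeasure (distr (restr \<mu> D) cantor_borel f) C = emeasure \<mu> ((f -` C \<inter> space M) \<inter> D)"
    if "C \<in> sets cantor_borel" for C
    using that measurable_sets[OF measurable_code that]
    by (subst emeasure_distr[OF f_\<mu>]) (simp_all add: emeasure_restr)
  have "?K = distr (restr \<mu> D) cantor_borel f"
  proof (rule measure_eqI_cylinders)
    fix w
    have "card {k. k < ?n \<and> ?p k \<in> cylinder w} = nat \<lfloor>counts D \<mu> w\<rfloor>"
      unfolding number_def code_point_def
      by (rule card_atoms_cylinder[where a = "\<lambda>w. nat \<lfloor>counts D \<mu> w\<rfloor>"]) (rule counts_additive[OF \<mu> D])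
    then have "emeasure ?K (cylinder w) = of_nat (nat \<lfloor>counts D \<mu> w\<rfloor>)"
      using K[of "cylinder w"] by simp
    also have "\<dots> = emeasure \<mu> (D \<inter> cell w)"
      by (rule counts_nat[OF \<mu> D, symmetric])
    also have "D \<inter> cell w = (f -` cylinder w \<inter> space M) \<inter> D"
      by (simp add: cell_def Int_commute)
    also have "emeasure \<mu> \<dots> = emeasure (distr (restr \<mu> D) cantor_borel f) (cylinder w)"
      by (rule fK[symmetric]) simp
    finally show "emeasure ?K (cylinder w) = emeasure (distr (restr \<mu> D) cantor_borel f) (cylinder w)" .
  next
    show "emeasure ?K UNIV \<noteq> \<infinity>"
      using K[of UNIV] sets.top[of cantor_borel] by simp
  qed simp_all
  then show ?thesis
    using K[OF C] fK[OF C] by simp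
qed

text \<open>
  All the mass of \<open>\<mu>\<close> on \<open>D\<close> sits on codes of points of the space, so the
  ranked atoms are such codes and decoding loses nothing.
\<close>

lemma code_point_in_image:
  assumes \<mu>: "\<mu> \<in> CM" and D: "bounded D" and k: "k < number (counts D \<mu>)"
  shows "code_point (counts D \<mu>) k \<in> f ` space M"
proof -
  let ?n = "number (counts D \<mu>)" and ?p = "code_point (counts D \<mu>)"
  let ?S = "{k. k < ?n \<and> ?p k \<in> f ` space M}"
  have "D \<in> sets M" using D by (rule bounded_sets_D)
  have "f -` (f ` space M) \<inter> space M = space M"
    by (rule Int_absorb1) (simp add: subset_eq)
  then have "(f -` (f ` space M) \<inter> space M) \<inter> D = D"
    using sets.sets_into_space[OF \<open>D \<in> sets M\<close>] by (simp add: Int_absorb1)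
  with card_code_points[OF \<mu> D sets_image] have "of_nat (card ?S) = emeasure \<mu> D"
    by simp
  then have "card ?S = card {..<?n}"
    by (simp add: emeasure_eq_number[OF \<mu> D])
  then have "?S = {..<?n}"
    by (intro card_subset_eq) (simp_all add: subset_eq)
  with k have "k \<in> ?S" by simp
  then show ?thesis by simp
qed

text \<open>
  Every counting measure is thus, on a bounded set, a finite sum of Dirac measures at points that depend
  measurably on it.
\<close>

lemma emeasure_eq_card_points:
  assumes \<mu>: "\<mu> \<in> CM" and D: "bounded D" and A: "A \<in> sets M"
  shows "emeasure \<mu> (A \<inter> D)
    = of_nat (card {k. k < number (counts D \<mu>) \<and> point (counts D \<mu>) k \<in> A})"
proof -
  let ?z = "counts D \<mu>"
  obtain C where C: "C \<in> sets cantor_borel" "A = f -` C \<inter> space M"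
    using A by (rule sets_codeE)
  have "point ?z k \<in> A \<longleftrightarrow> code_point ?z k \<in> C" if "k < number ?z" for k
    using code_decode[OF code_point_in_image[OF \<mu> D that]] decode_in_space[of "code_point ?z k"]
    by (simp add: C(2) point_def)
  then have "{k. k < number ?z \<and> point ?z k \<in> A} = {k. k < number ?z \<and> code_point ?z k \<in> C}"
    by (simp cong: conj_cong)
  with card_code_points[OF \<mu> D C(1)] show ?thesis by (simp add: C(2))
qed

definition configuration :: "nat \<Rightarrow> (nat \<Rightarrow> 'a) \<Rightarrow> 'a measure" where
  "configuration n x = distr (count_space {..<n}) M x"

lemma sets_configuration [simp, measurable_cong]: "sets (configuration n x) = sets M"
  and space_configuration [simp]: "space (configuration n x) = space M"
  by (simp_all add: configuration_def)

lemma emeasure_configuration: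
  assumes "\<And>k. k < n \<Longrightarrow> x k \<in> space M" "A \<in> sets M"
  shows "emeasure (configuration n x) A = of_nat (card {k. k < n \<and> x k \<in> A})"
proof -
  have "emeasure (configuration n x) A = emeasure (count_space {..<n}) (x -` A \<inter> {..<n})"
    unfolding configuration_def using assms by (subst emeasure_distr) auto
  also have "x -` A \<inter> {..<n} = {k. k < n \<and> x k \<in> A}" by auto
  also have "emeasure (count_space {..<n}) \<dots> = of_nat (card {k. k < n \<and> x k \<in> A})"
    by (rule emeasure_count_space_finite) auto
  finally show ?thesis .
qed

lemma configuration_in_CM:
  "(\<And>k. k < n \<Longrightarrow> x k \<in> space M) \<Longrightarrow> configuration n x \<in> CM"
  by (intro CM_I) (auto simp: emeasure_configuration dest: bounded_sets_D)

lemma restr_eq_configuration: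
  assumes "\<mu> \<in> CM" "bounded D"
  shows "restr \<mu> D = configuration (number (counts D \<mu>)) (point (counts D \<mu>))"
proof (rule measure_eqI)
  fix A assume "A \<in> sets (restr \<mu> D)"
  then have "A \<in> sets M" by (simp add: sets_CM assms)
  then show "emeasure (restr \<mu> D) A
      = emeasure (configuration (number (counts D \<mu>)) (point (counts D \<mu>))) A"
    using assms
    by (simp add: emeasure_restr sets_CM emeasure_eq_card_points emeasure_configuration bounded_sets_D)
qed (simp add: sets_CM assms)

lemma of_nat_card_eq_sum_indicator:
  fixes n :: nat
  shows "of_nat (card {k. k < n \<and> x k \<in> A}) = (\<Sum>k<n. indicator A (x k) :: ennreal)"
proof -
  have "(\<Sum>k<n. indicator A (x k) :: ennreal) = (\<Sum>k\<in>{k. k < n \<and> x k \<in> A}. 1)"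
    by (rule sum.mono_neutral_cong_right) (auto simp: indicator_def)
  then show ?thesis by simp
qed

lemma measurable_configuration [measurable]:
  "configuration m \<in> measurable (PiM {..<m} (\<lambda>_. M)) CA"
proof (rule measurable_into_CA)
  fix x assume "x \<in> space (PiM {..<m} (\<lambda>_. M))"
  then show "configuration m x \<in> CM"
    by (intro configuration_in_CM) (auto simp: space_PiM)
next
  fix A assume A [measurable]: "A \<in> sets M"
  have "(\<lambda>x. \<Sum>k<m. indicator A (x k) :: ennreal) \<in> borel_measurable (PiM {..<m} (\<lambda>_. M))"
    by (intro borel_measurable_sum measurable_compose[OF measurable_component_singleton]) auto
  moreover have "emeasure (configuration m x) A = (\<Sum>k<m. indicator A (x k))"
    if "x \<in> space (PiM {..<m} (\<lambda>_. M))" for x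
    using that A by (subst emeasure_configuration)
      (auto simp: space_PiM of_nat_card_eq_sum_indicator)
  ultimately show "(\<lambda>x. emeasure (configuration m x) A) \<in> borel_measurable (PiM {..<m} (\<lambda>_. M))"
    by (simp cong: measurable_cong)
qed

end

section \<open>Factorial measures of finite configurations\<close>

lemma nn_integral_distr_count_space:
  fixes h :: "'b \<Rightarrow> ennreal"
  assumes "finite S" "g \<in> S \<rightarrow> space N" "h \<in> borel_measurable N"
  shows "(\<integral>\<^sup>+x. h x \<partial>distr (count_space S) N g) = (\<Sum>s\<in>S. h (g s))"
proof -
  have "(\<integral>\<^sup>+x. h x \<partial>distr (count_space S) N g) = (\<integral>\<^sup>+s. h (g s) \<partial>count_space S)"
    using assms by (intro nn_integral_distr) (simp_all add: measurable_count_space_eq1)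
  also have "\<dots> = (\<Sum>s\<in>S. h (g s))"
    by (rule nn_integral_count_space_finite) fact
  finally show ?thesis .
qed

lemma emeasure_distr_count_space:
  assumes "finite S" "g \<in> S \<rightarrow> space N" "C \<in> sets N"
  shows "emeasure (distr (count_space S) N g) C = (\<Sum>s\<in>S. indicator C (g s))"
proof -
  have "emeasure (distr (count_space S) N g) C = (\<integral>\<^sup>+x. indicator C x \<partial>distr (count_space S) N g)"
    using assms(3) by simp
  also have "\<dots> = (\<Sum>s\<in>S. indicator C (g s))"
    using assms by (intro nn_integral_distr_count_space) simp_all
  finally show ?thesis .
qed

definition injections :: "nat \<Rightarrow> nat \<Rightarrow> (nat \<Rightarrow> nat) set" where
  "injections m n = {i \<in> {..<m} \<rightarrow>\<^sub>E {..<n}. inj_on i {..<m}}"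

lemma finite_injections [simp]: "finite (injections m n)"
  unfolding injections_def by (rule finite_subset[of _ "{..<m} \<rightarrow>\<^sub>E {..<n}"]) (auto intro: finite_PiE)

lemma card_injections_self: "card (injections m m) = fact m"
  unfolding injections_def
  by (subst card_inj_on_subset_funcset) (auto simp: fact_prod_rev atLeast0LessThan)

lemma injections_less: "i \<in> injections m n \<Longrightarrow> k < m \<Longrightarrow> i k < n"
  by (auto simp: injections_def)

lemma injections_self_bij: "i \<in> injections m m \<Longrightarrow> bij_betw i {..<m} {..<m}"
  unfolding injections_def bij_betw_def
  by (intro conjI endo_inj_surj) auto

lemma bij_betw_injections_1:
  "bij_betw (\<lambda>i. i 0) (injections (Suc 0) n) {..<n}"
proof (rule bij_betw_byWitness[where f' = "\<lambda>l. \<lambda>k\<in>{..<Suc 0}. l"])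
  show "\<forall>i\<in>injections (Suc 0) n. (\<lambda>k\<in>{..<Suc 0}. i 0) = i"
    by (auto simp: injections_def PiE_def extensional_def fun_eq_iff)
qed (auto simp: injections_def lessThan_Suc split: if_splits)

lemma bij_betw_injections_Suc:
  "bij_betw (\<lambda>(i, l). i(m := l)) (SIGMA i:injections m n. {..<n} - i ` {..<m}) (injections (Suc m) n)"
proof (rule bij_betw_byWitness[where f' = "\<lambda>i. (restrict i {..<m}, i m)"])
  have undef: "i k = undefined" if "i \<in> injections m n" "\<not> k < m" for i k m
    using that by (auto simp: injections_def intro: PiE_arb)
  show "\<forall>p\<in>SIGMA i:injections m n. {..<n} - i ` {..<m}.
      (restrict (case p of (i, l) \<Rightarrow> i(m := l)) {..<m}, (case p of (i, l) \<Rightarrow> i(m := l)) m) = p"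
  proof
    fix p assume "p \<in> (SIGMA i:injections m n. {..<n} - i ` {..<m})"
    then obtain i l where p: "p = (i, l)" and "i \<in> injections m n" by (rule SigmaE)
    from undef[OF this(2)] have "restrict (i(m := l)) {..<m} = i"
      by (simp add: fun_eq_iff restrict_def)
    then show "(restrict (case p of (i, l) \<Rightarrow> i(m := l)) {..<m}, (case p of (i, l) \<Rightarrow> i(m := l)) m) = p"
      by (simp add: p)
  qed
  show "\<forall>i\<in>injections (Suc m) n.
      (case (restrict i {..<m}, i m) of (i, l) \<Rightarrow> i(m := l)) = i"
  proof
    fix i assume "i \<in> injections (Suc m) n"
    from undef[OF this] have "i k = undefined" if "\<not> k < m" "k \<noteq> m" for k
      using that by simp
    then show "(case (restrict i {..<m}, i m) of (i, l) \<Rightarrow> i(m := l)) = i"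
      by (simp add: fun_eq_iff restrict_def)
  qed
  show "(\<lambda>(i, l). i(m := l)) ` (SIGMA i:injections m n. {..<n} - i ` {..<m}) \<subseteq> injections (Suc m) n"
  proof (intro image_subsetI, clarify)
    fix i l assume i: "i \<in> injections m n" and l: "l < n" "l \<notin> i ` {..<m}"
    have "inj_on (i(m := l)) (insert m {..<m})"
      using i l by (intro inj_on_insert[THEN iffD2] conjI inj_on_fun_updI) (auto simp: injections_def)
    moreover have "i(m := l) \<in> insert m {..<m} \<rightarrow>\<^sub>E {..<n}"
      using i l by (intro PiE_fun_upd) (auto simp: injections_def)
    ultimately show "i(m := l) \<in> injections (Suc m) n"
      by (simp add: injections_def lessThan_Suc)
  qed
  show "(\<lambda>i. (restrict i {..<m}, i m)) ` injections (Suc m) n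
      \<subseteq> (SIGMA i:injections m n. {..<n} - i ` {..<m})"
  proof (intro image_subsetI SigmaI DiffI)
    fix i assume i: "i \<in> injections (Suc m) n"
    then have inj: "inj_on i {..<Suc m}" and i': "i \<in> {..<Suc m} \<rightarrow>\<^sub>E {..<n}"
      by (simp_all add: injections_def)
    have "inj_on (restrict i {..<m}) {..<m}"
      using inj_on_subset[OF inj, of "{..<m}"] by (simp add: inj_on_restrict_eq)
    then show "restrict i {..<m} \<in> injections m n"
      unfolding injections_def using i' by (simp add: PiE_iff)
    show "i m \<in> {..<n}" using i' by auto
    show "i m \<notin> restrict i {..<m} ` {..<m}"
    proof
      assume "i m \<in> restrict i {..<m} ` {..<m}"
      then obtain k where "k < m" "i m = i k" by auto
      with inj_onD[OF inj, of m k] show False by simp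
    qed
  qed
qed

text \<open>
  The factorial measure of a sum of \<open>n\<close> Dirac measures is the sum of the Dirac measures at all
  \<open>m\<close>-tuples of points with pairwise distinct indices. In the recursion the subtracted sum
  removes exactly the extensions that repeat an index.
\<close>

lemma factorial_measure_finite:
  fixes x :: "nat \<Rightarrow> 'a" and M :: "'a measure"
  assumes x: "\<And>k. k < n \<Longrightarrow> x k \<in> space M"
  shows "factorial_measure (distr (count_space {..<n}) M x) (Suc m) =
    distr (count_space (injections (Suc m) n)) (PiM {..<Suc m} (\<lambda>_. M)) (\<lambda>i. \<lambda>k\<in>{..<Suc m}. x (i k))"
proof (induction m)
  case 0
  let ?\<mu> = "distr (count_space {..<n}) M x"
  have sets: "sets (PiM {..<1::nat} (\<lambda>_. ?\<mu>)) = sets (PiM {..<1} (\<lambda>_. M))"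
    by (intro sets_PiM_cong) simp_all
  have g: "(\<lambda>y. \<lambda>k\<in>{..<1::nat}. y) \<in> measurable M (PiM {..<1} (\<lambda>_. M))"
    by (intro measurable_restrict) simp
  have xm: "x \<in> measurable (count_space {..<n}) M"
    using x by (simp add: measurable_count_space_eq1)
  let ?P = "PiM {..<1::nat} (\<lambda>_. M)"
  have 1: "(\<lambda>l. \<lambda>k\<in>{..<1::nat}. x l) \<in> count_space {..<n} \<rightarrow>\<^sub>M ?P"
    using measurable_comp[OF xm g] by (simp only: comp_def)
  have 2: "(\<lambda>i. i (0::nat)) \<in> count_space (injections (Suc 0) n) \<rightarrow>\<^sub>M count_space {..<n}"
    by (auto simp: injections_less)
  have "factorial_measure ?\<mu> (Suc 0) = distr ?\<mu> ?P (\<lambda>y. \<lambda>k\<in>{..<1}. y)"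
    by (simp only: factorial_measure.simps) (rule distr_cong[OF refl sets refl])
  also have "\<dots> = distr (count_space {..<n}) ?P (\<lambda>l. \<lambda>k\<in>{..<1}. x l)"
    by (subst distr_distr[OF g xm]) (simp only: comp_def)
  also have "\<dots> = distr (distr (count_space (injections (Suc 0) n)) (count_space {..<n}) (\<lambda>i. i 0))
      ?P (\<lambda>l. \<lambda>k\<in>{..<1}. x l)"
    unfolding distr_bij_count_space[OF bij_betw_injections_1] ..
  also have "\<dots> = distr (count_space (injections (Suc 0) n)) ?P (\<lambda>i. \<lambda>k\<in>{..<1}. x (i 0))"
    unfolding distr_distr[OF 1 2] comp_def ..
  also have "\<dots> = distr (count_space (injections (Suc 0) n)) (PiM {..<Suc 0} (\<lambda>_. M))
      (\<lambda>i. \<lambda>k\<in>{..<Suc 0}. x (i k))"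
    by (intro distr_cong) (auto simp: fun_eq_iff restrict_def)
  finally show ?case .
next
  case (Suc m')
  define m where "m = Suc m'"
  let ?\<mu> = "distr (count_space {..<n}) M x"
  let ?F = "factorial_measure ?\<mu> m"
  let ?G = "\<lambda>i. \<lambda>k\<in>{..<m}. x (i k)"
  let ?D = "distr (count_space (injections (Suc m) n)) (PiM {..<Suc m} (\<lambda>_. M)) (\<lambda>i. \<lambda>k\<in>{..<Suc m}. x (i k))"
  have IH: "?F = distr (count_space (injections m n)) (PiM {..<m} (\<lambda>_. M)) ?G"
    unfolding m_def by (rule Suc)
  have G: "(\<lambda>i. \<lambda>k\<in>{..<l}. x (i k)) \<in> injections l n \<rightarrow> space (PiM {..<l} (\<lambda>_. M))" for l
    using x by (auto simp: space_PiM PiE_iff injections_less)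
  have sets: "sets (PiM {..<Suc m} (\<lambda>_. ?\<mu>)) = sets (PiM {..<Suc m} (\<lambda>_. M))"
    by (intro sets_PiM_cong) simp_all
  have space: "space (PiM {..<Suc m} (\<lambda>_. ?\<mu>)) = space (PiM {..<Suc m} (\<lambda>_. M))"
    by (rule sets_eq_imp_space_eq[OF sets])
  have content: "(\<integral>\<^sup>+y. ((\<integral>\<^sup>+z. indicator C (y(m := z)) \<partial>?\<mu>)
        - (\<Sum>j<m. indicator C (y(m := y j)))) \<partial>?F) = emeasure ?D C"
    if C: "C \<in> sets (PiM {..<Suc m} (\<lambda>_. M))" for C
  proof -
    define h :: "(nat \<Rightarrow> 'a) \<Rightarrow> ennreal" where
      "h y = (\<Sum>l<n. indicator C (y(m := x l))) - (\<Sum>j<m. indicator C (y(m := y j)))" for y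
    have upd: "(\<lambda>y. y(m := u y)) \<in> measurable (PiM {..<m} (\<lambda>_. M)) (PiM {..<Suc m} (\<lambda>_. M))"
      if "u \<in> measurable (PiM {..<m} (\<lambda>_. M)) M" for u
      unfolding lessThan_Suc using that by (intro measurable_fun_upd[where J = "{..<m}"]) auto
    have ind: "(\<lambda>y. indicator C (y(m := u y)) :: ennreal) \<in> borel_measurable (PiM {..<m} (\<lambda>_. M))"
      if "u \<in> measurable (PiM {..<m} (\<lambda>_. M)) M" for u
      using C by (intro measurable_compose[OF upd[OF that]]) simp
    have h_meas: "h \<in> borel_measurable (PiM {..<m} (\<lambda>_. M))"
      unfolding h_def
    proof (rule borel_measurable_minus_ennreal)
      show "(\<lambda>y. \<Sum>l<n. indicator C (y(m := x l)) :: ennreal) \<in> borel_measurable (PiM {..<m} (\<lambda>_. M))"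
        by (rule borel_measurable_sum, rule ind, rule measurable_const) (simp add: x)
      show "(\<lambda>y. \<Sum>j<m. indicator C (y(m := y j)) :: ennreal) \<in> borel_measurable (PiM {..<m} (\<lambda>_. M))"
        by (rule borel_measurable_sum, rule ind, rule measurable_component_singleton)
    qed
    have inner: "(\<integral>\<^sup>+z. indicator C (y(m := z)) \<partial>?\<mu>) = (\<Sum>l<n. indicator C (y(m := x l)))"
      if y: "y \<in> space (PiM {..<m} (\<lambda>_. M))" for y
    proof (rule nn_integral_distr_count_space)
      have "(\<lambda>z. y(m := z)) \<in> measurable M (PiM {..<Suc m} (\<lambda>_. M))"
        unfolding lessThan_Suc using y by (intro measurable_fun_upd[where J = "{..<m}"]) auto
      then show "(\<lambda>z. indicator C (y(m := z)) :: ennreal) \<in> borel_measurable M"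
        by (rule measurable_compose) (use C in simp)
    next
      show "x \<in> {..<n} \<rightarrow> space M" using x by simp
    qed simp
    have spF: "space ?F = space (PiM {..<m} (\<lambda>_. M))" by (simp add: IH)
    have "(\<integral>\<^sup>+y. ((\<integral>\<^sup>+z. indicator C (y(m := z)) \<partial>?\<mu>)
        - (\<Sum>j<m. indicator C (y(m := y j)))) \<partial>?F) = (\<integral>\<^sup>+y. h y \<partial>?F)"
      unfolding h_def by (intro nn_integral_cong) (simp only: inner spF)
    also have "\<dots> = (\<Sum>i\<in>injections m n. h (?G i))"
      unfolding IH by (intro nn_integral_distr_count_space finite_injections G h_meas)
    also have "\<dots> = (\<Sum>i\<in>injections m n. \<Sum>l\<in>{..<n} - i ` {..<m}. indicator C ((?G i)(m := x l)))"
    proof (rule sum.cong[OF refl])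
      fix i assume i: "i \<in> injections m n"
      then have inj: "inj_on i {..<m}" and im: "i ` {..<m} \<subseteq> {..<n}"
        by (auto simp: injections_def)
      let ?e = "\<lambda>l. indicator C ((?G i)(m := x l)) :: ennreal"
      have "(\<Sum>j<m. indicator C ((?G i)(m := ?G i j))) = (\<Sum>j<m. ?e (i j))"
        by (intro sum.cong) simp_all
      also have "\<dots> = (\<Sum>l\<in>i ` {..<m}. ?e l)"
        by (simp add: sum.reindex[OF inj])
      finally have rep: "(\<Sum>j<m. indicator C ((?G i)(m := ?G i j))) = (\<Sum>l\<in>i ` {..<m}. ?e l)" .
      have "(\<Sum>l<n. ?e l) = (\<Sum>l\<in>{..<n} - i ` {..<m}. ?e l) + (\<Sum>l\<in>i ` {..<m}. ?e l)"
        by (rule sum.subset_diff[OF im]) simp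
      then have "h (?G i) = (\<Sum>l\<in>{..<n} - i ` {..<m}. ?e l) + (\<Sum>l\<in>i ` {..<m}. ?e l)
          - (\<Sum>l\<in>i ` {..<m}. ?e l)"
        unfolding h_def rep by (rule arg_cong)
      also have "\<dots> = (\<Sum>l\<in>{..<n} - i ` {..<m}. ?e l)"
      proof (rule ennreal_add_diff_cancel_right)
        have "?e l \<noteq> \<top>" for l by (simp split: split_indicator)
        then show "(\<Sum>l\<in>i ` {..<m}. ?e l) \<noteq> \<top>"
          unfolding ennreal_sum_eq_top[OF finite_imageI[OF finite_lessThan]] by blast
      qed
      finally show "h (?G i) = (\<Sum>l\<in>{..<n} - i ` {..<m}. ?e l)" .
    qed
    also have "\<dots> = (\<Sum>(i, l)\<in>(SIGMA i:injections m n. {..<n} - i ` {..<m}).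
        indicator C ((?G i)(m := x l)))"
      by (rule sum.Sigma) simp_all
    also have "\<dots> = (\<Sum>p\<in>(SIGMA i:injections m n. {..<n} - i ` {..<m}).
        indicator C (\<lambda>k\<in>{..<Suc m}. x ((case p of (i, l) \<Rightarrow> i(m := l)) k)))"
    proof (rule sum.cong[OF refl], clarify)
      fix i l
      have "(?G i)(m := x l) = (\<lambda>k\<in>{..<Suc m}. x ((i(m := l)) k))"
        by (simp add: fun_eq_iff restrict_def less_Suc_eq)
      then show "indicator C ((?G i)(m := x l)) = indicator C (\<lambda>k\<in>{..<Suc m}. x ((i(m := l)) k))"
        by (rule arg_cong)
    qed
    also have "\<dots> = (\<Sum>i\<in>injections (Suc m) n. indicator C (\<lambda>k\<in>{..<Suc m}. x (i k)))"
      by (rule sum.reindex_bij_betw[OF bij_betw_injections_Suc])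
    also have "\<dots> = emeasure ?D C"
      by (rule emeasure_distr_count_space[symmetric]) (rule finite_injections G C)+
    finally show ?thesis .
  qed
  have "factorial_measure ?\<mu> (Suc m) =
      measure_of (space (PiM {..<Suc m} (\<lambda>_. ?\<mu>))) (sets (PiM {..<Suc m} (\<lambda>_. ?\<mu>)))
        (\<lambda>C. \<integral>\<^sup>+y. ((\<integral>\<^sup>+z. indicator C (y(m := z)) \<partial>?\<mu>)
          - (\<Sum>j<m. indicator C (y(m := y j)))) \<partial>?F)"
    unfolding m_def by (simp only: factorial_measure.simps Let_def)
  also have "\<dots> = measure_of (space (PiM {..<Suc m} (\<lambda>_. M))) (sets (PiM {..<Suc m} (\<lambda>_. M)))
        (\<lambda>C. \<integral>\<^sup>+y. ((\<integral>\<^sup>+z. indicator C (y(m := z)) \<partial>?\<mu>)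
          - (\<Sum>j<m. indicator C (y(m := y j)))) \<partial>?F)"
    unfolding sets space ..
  also have "\<dots> = measure_of (space ?D) (sets ?D) (emeasure ?D)"
    unfolding space_distr sets_distr
    by (intro measure_of_eq sets.space_closed content) (simp only: sets.sigma_sets_eq)
  also have "\<dots> = ?D" by (rule measure_of_of_measure)
  finally show ?case unfolding m_def .
qed

section \<open>Janossy measures and the law of the restricted process\<close>

context localized_cantor
begin

lemma factorial_measure_restr:
  assumes \<mu>: "\<mu> \<in> CM" and B: "bounded B" and m: "emeasure \<mu> B = of_nat m" "m \<ge> 1"
  shows "factorial_measure (restr \<mu> B) m = distr (count_space (injections m m)) (PiM {..<m} (\<lambda>_. M))
    (\<lambda>i. \<lambda>k\<in>{..<m}. point (counts B \<mu>) (i k))"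
proof -
  have "number (counts B \<mu>) = m"
    using emeasure_eq_number[OF \<mu> B] m(1) by simp
  then have "restr \<mu> B = distr (count_space {..<m}) M (point (counts B \<mu>))"
    using restr_eq_configuration[OF \<mu> B] by (simp add: configuration_def)
  then show ?thesis
    using factorial_measure_finite[of m "point (counts B \<mu>)" M "m - 1"] m(2) by simp
qed

lemma configuration_cong:
  "(\<And>k. k < m \<Longrightarrow> x k = y k) \<Longrightarrow> configuration m x = configuration m y"
  unfolding configuration_def by (rule distr_cong) simp_all

lemma configuration_permute:
  assumes "i \<in> injections m m" "\<And>k. k < m \<Longrightarrow> x k \<in> space M"
  shows "configuration m (\<lambda>k. x (i k)) = configuration m x"
proof -
  have i: "i \<in> count_space {..<m} \<rightarrow>\<^sub>M count_space {..<m}"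
    using assms(1) by (simp add: injections_less Pi_iff)
  have x: "x \<in> count_space {..<m} \<rightarrow>\<^sub>M M"
    using assms(2) by (simp add: Pi_iff)
  have "configuration m x = distr (distr (count_space {..<m}) (count_space {..<m}) i) M x"
    unfolding configuration_def distr_bij_count_space[OF injections_self_bij[OF assms(1)]] ..
  also have "\<dots> = configuration m (\<lambda>k. x (i k))"
    unfolding configuration_def distr_distr[OF x i] comp_def ..
  finally show ?thesis ..
qed

lemma restr_eq_configuration_permuted:
  assumes \<mu>: "\<mu> \<in> CM" and B: "bounded B" and m: "emeasure \<mu> B = of_nat m"
    and i: "i \<in> injections m m"
  shows "configuration m (\<lambda>k\<in>{..<m}. point (counts B \<mu>) (i k)) = restr \<mu> B"
proof -
  have "number (counts B \<mu>) = m"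
    using emeasure_eq_number[OF \<mu> B] m by simp
  have "configuration m (\<lambda>k\<in>{..<m}. point (counts B \<mu>) (i k))
      = configuration m (\<lambda>k. point (counts B \<mu>) (i k))"
    by (rule configuration_cong) simp
  also have "\<dots> = configuration m (point (counts B \<mu>))"
    by (rule configuration_permute[OF i]) simp
  also have "\<dots> = restr \<mu> B"
    using restr_eq_configuration[OF \<mu> B] \<open>number (counts B \<mu>) = m\<close> by simp
  finally show ?thesis .
qed

text \<open>
  On \<open>\<eta>(B) = m\<close> the \<open>m\<close>-th factorial measure of \<open>\<eta>\<^sub>B\<close> has the \<open>m!\<close> enumerations of
  the points of \<open>\<eta>\<^sub>B\<close> as its atoms, and each of them gives back \<open>\<eta>\<^sub>B\<close>. The factor
  \<open>1/m!\<close> in the Janossy measure compensates exactly for that. Measurability of the enumeration is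
  what makes the Janossy measure countably additive.
\<close>

lemma emeasure_janossy_measure:
  assumes pp: "point_process M L P \<eta>" and B: "bounded B" and m: "m \<ge> 1" and A: "A \<in> sets CA"
  shows "emeasure (janossy_measure M P \<eta> B m) {x \<in> space (PiM {..<m} (\<lambda>_. M)). configuration m x \<in> A}
    = emeasure P {\<omega> \<in> space P. restr (\<eta> \<omega>) B \<in> A \<and> emeasure (\<eta> \<omega>) B = of_nat m}"
proof -
  have \<eta> [measurable]: "\<eta> \<in> measurable P CA" using pp by (simp add: point_process_def)
  have CM: "\<eta> \<omega> \<in> CM" if "\<omega> \<in> space P" for \<omega>
    using measurable_space[OF \<eta> that] by simp
  have [measurable]: "B \<in> sets M" using B by (rule bounded_sets_D)
  let ?PM = "PiM {..<m} (\<lambda>_. M)"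
  define E where "E = {\<omega>. emeasure (\<eta> \<omega>) B = of_nat m}"
  define pts where "pts i \<omega> = (\<lambda>k\<in>{..<m}. point (counts B (\<eta> \<omega>)) (i k))" for i \<omega>
  define F where "F C \<omega> = indicator E \<omega> * emeasure (factorial_measure (restr (\<eta> \<omega>) B) m) C" for C \<omega>
  define J where "J C = ennreal (1 / fact m) * (\<integral>\<^sup>+\<omega>. F C \<omega> \<partial>P)" for C
  have F_eq: "F C \<omega> = indicator E \<omega> * (\<Sum>i\<in>injections m m. indicator C (pts i \<omega>))"
    if C: "C \<in> sets ?PM" and \<omega>: "\<omega> \<in> space P" for C \<omega>
  proof (cases "\<omega> \<in> E")
    case True
    then have "emeasure (\<eta> \<omega>) B = of_nat m" by (simp add: E_def)
    then have "emeasure (factorial_measure (restr (\<eta> \<omega>) B) m) C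
        = emeasure (distr (count_space (injections m m)) ?PM (\<lambda>i. pts i \<omega>)) C"
      using factorial_measure_restr[OF CM[OF \<omega>] B _ m] by (simp add: pts_def)
    also have "\<dots> = (\<Sum>i\<in>injections m m. indicator C (pts i \<omega>))"
      by (rule emeasure_distr_count_space) (simp_all add: C pts_def space_PiM)
    finally show ?thesis by (simp add: F_def)
  qed (simp add: F_def)
  have counts_meas: "(\<lambda>\<omega>. counts B (\<eta> \<omega>)) \<in> borel_measurable P"
    by (rule measurable_compose[OF \<eta>]) (rule measurable_counts, measurable)
  have pts_meas: "pts i \<in> measurable P ?PM" for i
    unfolding pts_def
    by (rule measurable_restrict) (rule measurable_compose[OF counts_meas measurable_point])
  have E_meas: "E \<inter> space P \<in> sets P"
  proof -
    have "{\<omega>\<in>space P. emeasure (\<eta> \<omega>) B = of_nat m} \<in> sets P" by measurable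
    also have "{\<omega>\<in>space P. emeasure (\<eta> \<omega>) B = of_nat m} = E \<inter> space P"
      by (simp add: E_def Int_def conj_commute)
    finally show ?thesis .
  qed
  have F_meas: "F C \<in> borel_measurable P" if C: "C \<in> sets ?PM" for C
  proof -
    have "(\<lambda>\<omega>. indicator (E \<inter> space P) \<omega> * (\<Sum>i\<in>injections m m. indicator C (pts i \<omega>)) :: ennreal)
        \<in> borel_measurable P"
      using E_meas measurable_compose[OF pts_meas borel_measurable_indicator[OF C]]
      by (intro borel_measurable_times_ennreal borel_measurable_sum) simp_all
    then show ?thesis
      by (rule measurable_cong[THEN iffD1, rotated]) (simp add: F_eq C indicator_def)
  qed
  have J: "emeasure (janossy_measure M P \<eta> B m) C = J C" if C: "C \<in> sets ?PM" for C
  proof -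
    have "emeasure (measure_of (space ?PM) (sets ?PM) J) C = J C"
    proof (rule emeasure_measure_of_sigma[OF sets.sigma_algebra_axioms _ _ C])
      show "positive (sets ?PM) J" by (simp add: positive_def J_def F_def)
      show "countably_additive (sets ?PM) J"
        unfolding countably_additive_def
      proof (intro allI impI)
        fix D :: "nat \<Rightarrow> (nat \<Rightarrow> 'a) set"
        assume D: "range D \<subseteq> sets ?PM" "disjoint_family D" "(\<Union>i. D i) \<in> sets ?PM"
        have "(\<Sum>i. J (D i)) = ennreal (1 / fact m) * (\<Sum>i. \<integral>\<^sup>+\<omega>. F (D i) \<omega> \<partial>P)"
          unfolding J_def by (rule ennreal_suminf_cmult)
        also have "(\<Sum>i. \<integral>\<^sup>+\<omega>. F (D i) \<omega> \<partial>P) = (\<integral>\<^sup>+\<omega>. (\<Sum>i. F (D i) \<omega>) \<partial>P)"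
          using D(1) by (intro nn_integral_suminf[symmetric] F_meas) blast
        also have "\<dots> = (\<integral>\<^sup>+\<omega>. F (\<Union>i. D i) \<omega> \<partial>P)"
        proof (rule nn_integral_cong)
          fix \<omega> assume \<omega>: "\<omega> \<in> space P"
          show "(\<Sum>i. F (D i) \<omega>) = F (\<Union>i. D i) \<omega>"
          proof (cases "\<omega> \<in> E")
            case True
            then have "emeasure (\<eta> \<omega>) B = of_nat m" by (simp add: E_def)
            then have "sets (factorial_measure (restr (\<eta> \<omega>) B) m) = sets ?PM"
              using factorial_measure_restr[OF CM[OF \<omega>] B _ m] by simp
            with D show ?thesis
              unfolding F_def by (simp add: True suminf_emeasure)
          qed (simp add: F_def)
        qed
        finally show "(\<Sum>i. J (D i)) = J (\<Union>i. D i)" unfolding J_def .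
      qed
    qed
    then show ?thesis
      unfolding janossy_measure_def J_def F_def E_def .
  qed
  let ?C = "{x \<in> space ?PM. configuration m x \<in> A}"
  have C: "?C \<in> sets ?PM"
    using measurable_sets[OF measurable_configuration A] by (simp add: vimage_def Int_def conj_commute)
  have "F ?C \<omega> = fact m * indicator {\<omega> \<in> space P. restr (\<eta> \<omega>) B \<in> A \<and> emeasure (\<eta> \<omega>) B = of_nat m} \<omega>"
    if \<omega>: "\<omega> \<in> space P" for \<omega>
  proof (cases "\<omega> \<in> E")
    case True
    have "indicator ?C (pts i \<omega>) = (indicator A (restr (\<eta> \<omega>) B) :: ennreal)"
      if "i \<in> injections m m" for i
    proof -
      have "configuration m (pts i \<omega>) = restr (\<eta> \<omega>) B"
        unfolding pts_def
        by (rule restr_eq_configuration_permuted[OF CM[OF \<omega>] B _ that]) (use True in \<open>simp add: E_def\<close>)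
      moreover have "pts i \<omega> \<in> space ?PM"
        using measurable_space[OF pts_meas \<omega>] .
      ultimately show ?thesis by (simp add: indicator_def)
    qed
    then have "F ?C \<omega> = (\<Sum>i\<in>injections m m. indicator A (restr (\<eta> \<omega>) B))"
      using True by (simp add: F_eq[OF C \<omega>])
    also have "\<dots> = fact m * indicator A (restr (\<eta> \<omega>) B)"
      by (simp add: card_injections_self)
    finally show ?thesis using True \<omega> by (simp add: E_def indicator_def)
  next
    case False
    then show ?thesis by (simp add: F_def E_def)
  qed
  then have "J ?C = ennreal (1 / fact m) *
      (\<integral>\<^sup>+\<omega>. fact m * indicator {\<omega> \<in> space P. restr (\<eta> \<omega>) B \<in> A \<and> emeasure (\<eta> \<omega>) B = of_nat m} \<omega> \<partial>P)"
    unfolding J_def by (intro arg_cong[where f = "(*) (ennreal (1 / fact m))"] nn_integral_cong) blast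
  also have "\<dots> = ennreal (1 / fact m) * (fact m *
      emeasure P {\<omega> \<in> space P. restr (\<eta> \<omega>) B \<in> A \<and> emeasure (\<eta> \<omega>) B = of_nat m})"
  proof -
    have [measurable]: "(\<lambda>\<omega>. restr (\<eta> \<omega>) B) \<in> measurable P CA"
      by (rule measurable_compose[OF \<eta> measurable_restr]) measurable
    have "{\<omega> \<in> space P. restr (\<eta> \<omega>) B \<in> A \<and> emeasure (\<eta> \<omega>) B = of_nat m} \<in> sets P"
      using A by measurable
    then show ?thesis by (simp add: nn_integral_cmult_indicator)
  qed
  also have "\<dots> = emeasure P {\<omega> \<in> space P. restr (\<eta> \<omega>) B \<in> A \<and> emeasure (\<eta> \<omega>) B = of_nat m}"
  proof -
    have "ennreal (1 / fact m) * fact m = ennreal (1 / fact m) * ennreal (fact m)"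
      by (metis ennreal_of_nat_eq_real_of_nat of_nat_fact)
    also have "\<dots> = 1"
      by (subst ennreal_mult[symmetric]) simp_all
    finally show ?thesis by (simp add: mult.assoc[symmetric])
  qed
  finally show ?thesis using J[OF C] by simp
qed

end

section \<open>Uniform countable additivity of the restricted laws\<close>

locale janossy_sequence = localized_cantor M L f
  for M :: "'a measure" and L :: "nat \<Rightarrow> 'a set" and f :: "'a \<Rightarrow> nat \<Rightarrow> bool" +
  fixes \<nu> :: "'a measure" and P :: "nat \<Rightarrow> 'w measure" and \<eta> :: "nat \<Rightarrow> 'w \<Rightarrow> 'a measure"
    and dens :: "nat \<Rightarrow> 'a set \<Rightarrow> nat \<Rightarrow> (nat \<Rightarrow> 'a) \<Rightarrow> ennreal"
    and c :: "'a set \<Rightarrow> nat \<Rightarrow> real"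
  assumes locally_finite: "locally_finite M L \<nu>"
    and point_process: "\<And>n. point_process M L (P n) (\<eta> n)"
    and density: "\<And>n B m. bounded B \<Longrightarrow> m \<ge> 1 \<Longrightarrow> is_janossy_density M \<nu> (P n) (\<eta> n) B m (dens n B m)"
    and uniformly_integrable: "\<And>B m. bounded B \<Longrightarrow> m \<ge> 1 \<Longrightarrow>
           ((\<lambda>t::real. SUP n. \<integral>\<^sup>+x. dens n B m x * indicator {x. dens n B m x \<ge> ennreal t} x
               \<partial>restr_power \<nu> B m) \<longlongrightarrow> 0) at_top"
    and c_nonneg: "\<And>B m. bounded B \<Longrightarrow> m \<ge> 1 \<Longrightarrow> 0 \<le> c B m"
    and c_summable: "\<And>B. bounded B \<Longrightarrow> summable (\<lambda>m. c B (Suc m))"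
    and c_bound: "\<And>B m. bounded B \<Longrightarrow> m \<ge> 1 \<Longrightarrow>
           (SUP n. \<integral>\<^sup>+x. dens n B m x \<partial>restr_power \<nu> B m) \<le> ennreal (c B m)"
begin

lemma prob_space_P: "prob_space (P n)"
  using point_process[of n] by (simp add: point_process_def)

lemma measurable_\<eta> [measurable]: "\<eta> n \<in> measurable (P n) CA"
  using point_process[of n] by (simp add: point_process_def)

lemma \<eta>_in_CM: "\<omega> \<in> space (P n) \<Longrightarrow> \<eta> n \<omega> \<in> CM"
  using measurable_space[OF measurable_\<eta>, of \<omega> n] by simp

lemma measurable_restr_\<eta> [measurable]:
  "B \<in> sets M \<Longrightarrow> (\<lambda>\<omega>. restr (\<eta> n \<omega>) B) \<in> measurable (P n) CA"
  by (rule measurable_compose[OF measurable_\<eta> measurable_restr])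

definition law :: "'a set \<Rightarrow> nat \<Rightarrow> 'a measure measure" where
  "law B n = distr (P n) CA (\<lambda>\<omega>. restr (\<eta> n \<omega>) B)"

lemma sets_law [simp, measurable_cong]: "sets (law B n) = sets CA"
  and space_law [simp]: "space (law B n) = CM"
  by (simp_all add: law_def)

lemma prob_space_law: "B \<in> sets M \<Longrightarrow> prob_space (law B n)"
  unfolding law_def by (rule prob_space.prob_space_distr[OF prob_space_P measurable_restr_\<eta>])

definition exactly :: "'a set \<Rightarrow> nat \<Rightarrow> 'a measure set" where
  "exactly B m = {\<mu> \<in> CM. emeasure \<mu> B = of_nat m}"

lemma sets_exactly [measurable]: "B \<in> sets M \<Longrightarrow> exactly B m \<in> sets CA"
proof -
  assume [measurable]: "B \<in> sets M"
  have "{\<mu> \<in> space CA. emeasure \<mu> B = of_nat m} \<in> sets CA" by measurable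
  then show ?thesis by (simp add: exactly_def)
qed

lemma emeasure_law_exactly:
  assumes B: "bounded B" and A: "A \<in> sets CA"
  shows "emeasure (law B n) (A \<inter> exactly B m)
    = emeasure (P n) {\<omega> \<in> space (P n). restr (\<eta> n \<omega>) B \<in> A \<and> emeasure (\<eta> n \<omega>) B = of_nat m}"
proof -
  have BM: "B \<in> sets M" using B by (rule bounded_sets_D)
  have "emeasure (law B n) (A \<inter> exactly B m)
      = emeasure (P n) ((\<lambda>\<omega>. restr (\<eta> n \<omega>) B) -` (A \<inter> exactly B m) \<inter> space (P n))"
    unfolding law_def using A sets_exactly[OF BM]
    by (intro emeasure_distr measurable_restr_\<eta> BM) simp
  also have "(\<lambda>\<omega>. restr (\<eta> n \<omega>) B) -` (A \<inter> exactly B m) \<inter> space (P n)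
      = {\<omega> \<in> space (P n). restr (\<eta> n \<omega>) B \<in> A \<and> emeasure (\<eta> n \<omega>) B = of_nat m}"
  proof (intro set_eqI)
    fix \<omega>
    have "restr (\<eta> n \<omega>) B \<in> exactly B m \<longleftrightarrow> emeasure (\<eta> n \<omega>) B = of_nat m" if "\<omega> \<in> space (P n)"
      using \<eta>_in_CM[OF that] BM by (simp add: exactly_def emeasure_restr sets_CM)
    then show "\<omega> \<in> (\<lambda>\<omega>. restr (\<eta> n \<omega>) B) -` (A \<inter> exactly B m) \<inter> space (P n) \<longleftrightarrow>
        \<omega> \<in> {\<omega> \<in> space (P n). restr (\<eta> n \<omega>) B \<in> A \<and> emeasure (\<eta> n \<omega>) B = of_nat m}"
      by (cases "\<omega> \<in> space (P n)") simp_all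
  qed
  finally show ?thesis .
qed

lemma sets_restr_power [simp, measurable_cong]:
  "sets (restr_power \<nu> B m) = sets (PiM {..<m} (\<lambda>_. M))"
  unfolding restr_power_def
  using locally_finite by (intro sets_PiM_cong) (simp_all add: locally_finite_def)

lemma space_restr_power [simp]: "space (restr_power \<nu> B m) = space (PiM {..<m} (\<lambda>_. M))"
  by (rule sets_eq_imp_space_eq) simp

lemma finite_measure_restr_power:
  assumes B: "bounded B"
  shows "finite_measure (restr_power \<nu> B m)"
proof
  have sets: "sets \<nu> = sets M" and fin: "emeasure \<nu> B < \<infinity>"
    using locally_finite B by (auto simp: locally_finite_def)
  have BM: "B \<in> sets M" using B by (rule bounded_sets_D)
  have tot: "emeasure (restr \<nu> B) (space (restr \<nu> B)) = emeasure \<nu> B"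
    using BM sets.sets_into_space[of B \<nu>]
    by (subst emeasure_restr) (simp_all add: sets[symmetric] Int_absorb1)
  then have "finite_measure (restr \<nu> B)"
    using fin by (intro finite_measureI) simp
  then interpret finite_measure "restr \<nu> B" .
  interpret product_sigma_finite "\<lambda>_::nat. restr \<nu> B"
    by standard
  have "emeasure (restr_power \<nu> B m) (space (restr_power \<nu> B m))
      = (\<Prod>k<m. emeasure (restr \<nu> B) (space (restr \<nu> B)))"
    unfolding restr_power_def space_PiM by (rule emeasure_PiM) simp_all
  also have "\<dots> \<noteq> \<infinity>"
    using fin by (simp add: tot ennreal_prod_eq_top power_eq_top_ennreal)
  finally show "emeasure (restr_power \<nu> B m) (space (restr_power \<nu> B m)) \<noteq> \<infinity>" .
qed

lemma measurable_dens [measurable]: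
  "bounded B \<Longrightarrow> m \<ge> 1 \<Longrightarrow> dens n B m \<in> borel_measurable (restr_power \<nu> B m)"
  using density[of B m n] by (simp add: is_janossy_density_def)

definition tuples :: "nat \<Rightarrow> 'a measure set \<Rightarrow> (nat \<Rightarrow> 'a) set" where
  "tuples m A = {x \<in> space (PiM {..<m} (\<lambda>_. M)). configuration m x \<in> A}"

lemma sets_tuples: "A \<in> sets CA \<Longrightarrow> tuples m A \<in> sets (PiM {..<m} (\<lambda>_. M))"
  using measurable_sets[OF measurable_configuration, of A m]
  by (simp add: tuples_def vimage_def Int_def conj_commute)

text \<open>
  The Janossy density is the density of the law of \<open>\<eta>\<^sub>B\<close> on \<open>m\<close>-point
  configurations, pulled back to ordered tuples.
\<close>

lemma emeasure_law_eq_integral: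
  assumes B: "bounded B" and m: "m \<ge> 1" and A: "A \<in> sets CA"
  shows "emeasure (law B n) (A \<inter> exactly B m)
    = (\<integral>\<^sup>+x. dens n B m x * indicator (tuples m A) x \<partial>restr_power \<nu> B m)"
proof -
  have "emeasure (law B n) (A \<inter> exactly B m) = emeasure (janossy_measure M (P n) (\<eta> n) B m) (tuples m A)"
    unfolding emeasure_law_exactly[OF B A] tuples_def
    by (rule emeasure_janossy_measure[OF point_process B m A, symmetric])
  also have "\<dots> = emeasure (density (restr_power \<nu> B m) (dens n B m)) (tuples m A)"
    using density[OF B m, of n] by (simp add: is_janossy_density_def)
  also have "\<dots> = (\<integral>\<^sup>+x. dens n B m x * indicator (tuples m A) x \<partial>restr_power \<nu> B m)"
    using sets_tuples[OF A] by (intro emeasure_density measurable_dens B m) simp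
  finally show ?thesis .
qed

text \<open>The total mass of the \<open>m\<close>-th Janossy measure is the probability of having \<open>m\<close> points.\<close>

lemma law_exactly_le:
  assumes B: "bounded B" and m: "m \<ge> 1"
  shows "emeasure (law B n) (exactly B m) \<le> ennreal (c B m)"
proof -
  have "exactly B m = space CA \<inter> exactly B m" by (auto simp: exactly_def)
  then have "emeasure (law B n) (exactly B m) = emeasure (law B n) (space CA \<inter> exactly B m)" by simp
  also have "\<dots> = (\<integral>\<^sup>+x. dens n B m x * indicator (tuples m (space CA)) x \<partial>restr_power \<nu> B m)"
    by (rule emeasure_law_eq_integral[OF B m sets.top])
  also have "\<dots> \<le> (\<integral>\<^sup>+x. dens n B m x \<partial>restr_power \<nu> B m)"
    by (intro nn_integral_mono) (simp split: split_indicator)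
  also have "\<dots> \<le> (SUP n. \<integral>\<^sup>+x. dens n B m x \<partial>restr_power \<nu> B m)"
    by (rule SUP_upper) simp
  also have "\<dots> \<le> ennreal (c B m)" by (rule c_bound[OF B m])
  finally show ?thesis .
qed

lemma measure_law_exactly_le:
  assumes B: "bounded B" and m: "m \<ge> 1"
  shows "measure (law B n) (exactly B m) \<le> c B m"
proof -
  interpret prob_space "law B n" using B by (intro prob_space_law bounded_sets_D)
  show ?thesis
    using law_exactly_le[OF B m, of n] c_nonneg[OF B m] by (simp add: emeasure_eq_measure)
qed

definition more_than :: "'a set \<Rightarrow> nat \<Rightarrow> 'a measure set" where
  "more_than B m = {\<mu> \<in> CM. emeasure \<mu> B > of_nat m}"

lemma sets_more_than [measurable]: "B \<in> sets M \<Longrightarrow> more_than B m \<in> sets CA"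
proof -
  assume [measurable]: "B \<in> sets M"
  have "{\<mu> \<in> space CA. emeasure \<mu> B > of_nat m} \<in> sets CA" by measurable
  then show ?thesis by (simp add: more_than_def)
qed

lemma more_than_eq_UN:
  assumes B: "bounded B"
  shows "more_than B m = (\<Union>k. exactly B (Suc (k + m)))"
proof (intro equalityI subsetI)
  fix \<mu> assume \<mu>: "\<mu> \<in> more_than B m"
  then have "\<mu> \<in> CM" by (simp add: more_than_def)
  then obtain l where l: "emeasure \<mu> B = of_nat l"
    using B by (rule emeasure_CM_bounded)
  with \<mu> have "m < l" by (simp add: more_than_def)
  then have "l = Suc ((l - Suc m) + m)" by simp
  with l \<open>\<mu> \<in> CM\<close> have "\<mu> \<in> exactly B (Suc ((l - Suc m) + m))" by (simp add: exactly_def)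
  then show "\<mu> \<in> (\<Union>k. exactly B (Suc (k + m)))" by blast
next
  fix \<mu> assume "\<mu> \<in> (\<Union>k. exactly B (Suc (k + m)))"
  then obtain k where "\<mu> \<in> CM" "emeasure \<mu> B = of_nat (Suc (k + m))"
    by (auto simp: exactly_def)
  then show "\<mu> \<in> more_than B m"
    unfolding more_than_def by (simp only: mem_Collect_eq of_nat_less_iff) simp
qed

lemma measure_law_more_than:
  assumes B: "bounded B"
  shows "measure (law B n) (more_than B m) \<le> (\<Sum>k. c B (Suc (k + m)))"
proof -
  interpret prob_space "law B n" using B by (intro prob_space_law bounded_sets_D)
  have BM: "B \<in> sets M" using B by (rule bounded_sets_D)
  have sum: "summable (\<lambda>k. c B (Suc (k + m)))"
    using summable_ignore_initial_segment[OF c_summable[OF B], of m] by simp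
  have le: "measure (law B n) (exactly B (Suc (k + m))) \<le> c B (Suc (k + m))" for k
    by (rule measure_law_exactly_le[OF B]) simp
  have sum': "summable (\<lambda>k. measure (law B n) (exactly B (Suc (k + m))))"
    by (rule summable_comparison_test'[OF sum, of 0]) (simp add: le)
  have "measure (law B n) (more_than B m) \<le> (\<Sum>k. measure (law B n) (exactly B (Suc (k + m))))"
    unfolding more_than_eq_UN[OF B]
    using sets_exactly[OF BM] by (intro finite_measure_subadditive_countably sum') (simp add: image_subset_iff)
  also have "\<dots> \<le> (\<Sum>k. c B (Suc (k + m)))"
    by (rule suminf_le[OF le sum' sum])
  finally show ?thesis .
qed

lemma c_tail_tendsto_0:
  assumes B: "bounded B"
  shows "(\<lambda>m. \<Sum>k. c B (Suc (k + m))) \<longlonglongrightarrow> 0"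
  using suminf_exist_split2[OF c_summable[OF B]] by simp

text \<open>
  For a fixed number \<open>m\<close> of points this is the classical argument that uniformly integrable densities
  are uniformly absolutely continuous: truncate the density at a large level \<open>t\<close>, and use that the
  product measure is finite.
\<close>

lemma uniformly_small_exactly:
  assumes B: "bounded B" and A: "\<And>i. A i \<in> sets CA" "decseq A" "(\<Inter>i. A i) = {}" and \<epsilon>: "\<epsilon> > 0"
  shows "\<exists>i0. \<forall>i\<ge>i0. \<forall>n. measure (law B n) (A i \<inter> exactly B m) \<le> \<epsilon>"
proof (cases "m = 0")
  case True
  \<comment> \<open>The empty configuration is the only one without points, and it leaves the decreasing sets.\<close>
  let ?o = "configuration 0 undefined"
  obtain i0 where i0: "?o \<notin> A i0"
    using A(3) by blast
  have BM: "B \<in> sets M" using B by (rule bounded_sets_D)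
  have "measure (law B n) (A i \<inter> exactly B m) \<le> \<epsilon>" if "i \<ge> i0" for i n
  proof -
    have "restr (\<eta> n \<omega>) B \<notin> A i"
      if \<omega>: "\<omega> \<in> space (P n)" "emeasure (\<eta> n \<omega>) B = of_nat m" for \<omega>
    proof -
      have "number (counts B (\<eta> n \<omega>)) = 0"
        using emeasure_eq_number[OF \<eta>_in_CM[OF \<omega>(1)] B] \<omega>(2) True by simp
      then have "restr (\<eta> n \<omega>) B = configuration 0 (point (counts B (\<eta> n \<omega>)))"
        using restr_eq_configuration[OF \<eta>_in_CM[OF \<omega>(1)] B] by simp
      also have "\<dots> = ?o" by (rule configuration_cong) simp
      finally show ?thesis using i0 decseqD[OF A(2) \<open>i \<ge> i0\<close>] by auto
    qed
    then have empty: "{\<omega> \<in> space (P n). restr (\<eta> n \<omega>) B \<in> A i \<and> emeasure (\<eta> n \<omega>) B = of_nat m} = {}"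
      by blast
    have "emeasure (law B n) (A i \<inter> exactly B m) = 0"
      unfolding emeasure_law_exactly[OF B A(1)] empty by simp
    then show ?thesis using \<epsilon> by (simp add: measure_def)
  qed
  then show ?thesis by blast
next
  case False
  then have m: "m \<ge> 1" by simp
  let ?K = "restr_power \<nu> B m"
  interpret lam: finite_measure ?K by (rule finite_measure_restr_power[OF B])
  have "eventually (\<lambda>t::real. (SUP n. \<integral>\<^sup>+x. dens n B m x * indicator {x. dens n B m x \<ge> ennreal t} x \<partial>?K)
      < ennreal (\<epsilon> / 2)) at_top"
    using \<epsilon> by (intro order_tendstoD(2)[OF uniformly_integrable[OF B m]]) simp
  then have "eventually (\<lambda>t::real. t \<ge> 0 \<and> (SUP n. \<integral>\<^sup>+x. dens n B m x * indicator {x. dens n B m x \<ge> ennreal t} x \<partial>?K)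
      < ennreal (\<epsilon> / 2)) at_top"
    using eventually_ge_at_top[of "0::real"] by (rule eventually_conj[rotated])
  then obtain t :: real where t: "t \<ge> 0"
    and UI: "(SUP n. \<integral>\<^sup>+x. dens n B m x * indicator {x. dens n B m x \<ge> ennreal t} x \<partial>?K) < ennreal (\<epsilon> / 2)"
    unfolding eventually_at_top_linorder by blast
  have tup: "tuples m (A i) \<in> sets ?K" for i
    using sets_tuples[OF A(1)] by simp
  have "(\<lambda>i. measure ?K (tuples m (A i))) \<longlonglongrightarrow> measure ?K (\<Inter>i. tuples m (A i))"
  proof (rule lam.finite_Lim_measure_decseq)
    show "range (\<lambda>i. tuples m (A i)) \<subseteq> sets ?K" using tup by blast
    show "decseq (\<lambda>i. tuples m (A i))"
      using A(2) by (fastforce simp: decseq_def tuples_def)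
  qed
  also have "(\<Inter>i. tuples m (A i)) = {}"
    using A(3) by (auto simp: tuples_def)
  finally have "(\<lambda>i. t * measure ?K (tuples m (A i))) \<longlonglongrightarrow> t * 0"
    by (intro tendsto_mult tendsto_const) simp
  then have "eventually (\<lambda>i. t * measure ?K (tuples m (A i)) < \<epsilon> / 2) sequentially"
    using \<epsilon> by (intro order_tendstoD(2)[where y = "t * 0"]) simp_all
  then obtain i0 where i0: "\<And>i. i \<ge> i0 \<Longrightarrow> t * measure ?K (tuples m (A i)) < \<epsilon> / 2"
    unfolding eventually_sequentially by blast
  have "measure (law B n) (A i \<inter> exactly B m) \<le> \<epsilon>" if "i \<ge> i0" for i n
  proof -
    interpret prob_space "law B n" using B by (intro prob_space_law bounded_sets_D)
    let ?T = "tuples m (A i)" and ?big = "{x. dens n B m x \<ge> ennreal t}"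
    have jm: "dens n B m \<in> borel_measurable ?K" by (rule measurable_dens[OF B m])
    have "emeasure (law B n) (A i \<inter> exactly B m) = (\<integral>\<^sup>+x. dens n B m x * indicator ?T x \<partial>?K)"
      by (rule emeasure_law_eq_integral[OF B m A(1)])
    also have "\<dots> \<le> (\<integral>\<^sup>+x. ennreal t * indicator ?T x + dens n B m x * indicator ?big x \<partial>?K)"
      by (intro nn_integral_mono) (auto simp: indicator_def not_le intro: less_imp_le)
    also have "\<dots> = (\<integral>\<^sup>+x. ennreal t * indicator ?T x \<partial>?K) + (\<integral>\<^sup>+x. dens n B m x * indicator ?big x \<partial>?K)"
    proof (rule nn_integral_add)
      show "(\<lambda>x. ennreal t * indicator ?T x) \<in> borel_measurable ?K"
        using tup[of i] by (intro borel_measurable_times_ennreal borel_measurable_indicator) simp_all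
      have "(\<lambda>x. (\<lambda>y. y * indicator {y. y \<ge> ennreal t} y) (dens n B m x)) \<in> borel_measurable ?K"
        by (rule measurable_compose[OF jm]) measurable
      then show "(\<lambda>x. dens n B m x * indicator ?big x) \<in> borel_measurable ?K"
        by (simp add: indicator_def)
    qed
    also have "(\<integral>\<^sup>+x. ennreal t * indicator ?T x \<partial>?K) = ennreal (t * measure ?K ?T)"
      using tup[of i] t
      by (simp add: nn_integral_cmult_indicator lam.emeasure_eq_measure ennreal_mult)
    also have "\<dots> \<le> ennreal (\<epsilon> / 2)"
      using i0[OF that] by (intro ennreal_leI) simp
    also have "(\<integral>\<^sup>+x. dens n B m x * indicator ?big x \<partial>?K)
        \<le> (SUP n. \<integral>\<^sup>+x. dens n B m x * indicator {x. dens n B m x \<ge> ennreal t} x \<partial>?K)"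
      by (rule SUP_upper) simp
    also have "\<dots> \<le> ennreal (\<epsilon> / 2)" using UI by simp
    also have "ennreal (\<epsilon> / 2) + ennreal (\<epsilon> / 2) = ennreal \<epsilon>"
      using \<epsilon> by (subst ennreal_plus[symmetric]) simp_all
    finally show ?thesis using \<epsilon> by (simp add: emeasure_eq_measure)
  qed
  then show ?thesis by blast
qed

text \<open>
  The bound \<open>c B\<close> makes many points in \<open>B\<close> uniformly unlikely, which reduces the claim to the
  finitely many point numbers \<open>m \<le> l\<close>.
\<close>

lemma law_uniformly_countably_additive:
  assumes B: "bounded B" and A: "\<And>i. A i \<in> sets CA" "decseq A" "(\<Inter>i. A i) = {}" and \<epsilon>: "\<epsilon> > 0"
  shows "\<exists>i0. \<forall>i\<ge>i0. \<forall>n. measure (law B n) (A i) \<le> \<epsilon>"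
proof -
  have BM: "B \<in> sets M" using B by (rule bounded_sets_D)
  have "eventually (\<lambda>m. (\<Sum>k. c B (Suc (k + m))) < \<epsilon> / 2) sequentially"
    using \<epsilon> by (intro order_tendstoD(2)[OF c_tail_tendsto_0[OF B]]) simp
  then obtain l where l: "(\<Sum>k. c B (Suc (k + l))) < \<epsilon> / 2"
    unfolding eventually_sequentially by blast
  define \<delta> where "\<delta> = \<epsilon> / (2 * real (Suc l))"
  have \<delta>: "\<delta> > 0" using \<epsilon> by (simp add: \<delta>_def)
  have "\<exists>i0. \<forall>i\<ge>i0. \<forall>n. measure (law B n) (A i \<inter> exactly B m) \<le> \<delta>" for m
    by (rule uniformly_small_exactly[OF B A \<delta>])
  then obtain i0 where i0: "\<And>m i n. i \<ge> i0 m \<Longrightarrow> measure (law B n) (A i \<inter> exactly B m) \<le> \<delta>"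
    by metis
  have "measure (law B n) (A i) \<le> \<epsilon>" if i: "i \<ge> Max (i0 ` {..l})" for i n
  proof -
    interpret prob_space "law B n" using BM by (rule prob_space_law)
    have sets: "A i \<inter> exactly B m \<in> sets (law B n)" "more_than B l \<in> sets (law B n)" for m
      using A(1)[of i] sets_exactly[OF BM] sets_more_than[OF BM] by auto
    have cover: "A i \<subseteq> (\<Union>m\<in>{..l}. A i \<inter> exactly B m) \<union> more_than B l"
    proof
      fix \<mu> assume \<mu>: "\<mu> \<in> A i"
      then have "\<mu> \<in> CM" using sets.sets_into_space[OF A(1)[of i]] by auto
      then obtain m where m: "emeasure \<mu> B = of_nat m" using B by (rule emeasure_CM_bounded)
      show "\<mu> \<in> (\<Union>m\<in>{..l}. A i \<inter> exactly B m) \<union> more_than B l"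
      proof (cases "m \<le> l")
        case True
        then show ?thesis using \<mu> m \<open>\<mu> \<in> CM\<close> by (intro UnI1 UN_I[of m]) (simp_all add: exactly_def)
      next
        case False
        then show ?thesis using m \<open>\<mu> \<in> CM\<close> by (intro UnI2) (simp add: more_than_def)
      qed
    qed
    have "measure (law B n) (A i) \<le> measure (law B n) ((\<Union>m\<in>{..l}. A i \<inter> exactly B m) \<union> more_than B l)"
      using sets by (intro finite_measure_mono cover sets.Un sets.finite_UN) simp_all
    also have "\<dots> \<le> measure (law B n) (\<Union>m\<in>{..l}. A i \<inter> exactly B m) + measure (law B n) (more_than B l)"
      using sets by (intro measure_Un_le sets.finite_UN) simp_all
    also have "measure (law B n) (\<Union>m\<in>{..l}. A i \<inter> exactly B m)
        \<le> (\<Sum>m\<in>{..l}. measure (law B n) (A i \<inter> exactly B m))"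
      using sets by (intro finite_measure_subadditive_finite) (simp_all add: image_subset_iff)
    also have "\<dots> \<le> (\<Sum>m\<in>{..l}. \<delta>)"
    proof (rule sum_mono)
      fix m assume "m \<in> {..l}"
      then have "i0 m \<le> i" using i by (meson Max_ge finite_atMost finite_imageI image_eqI le_trans)
      then show "measure (law B n) (A i \<inter> exactly B m) \<le> \<delta>" by (rule i0)
    qed
    also have "\<dots> = real (Suc l) * (\<epsilon> / (2 * real (Suc l)))" by (simp add: \<delta>_def)
    also have "\<dots> = \<epsilon> / 2" by (simp del: of_nat_Suc)
    also have "measure (law B n) (more_than B l) \<le> \<epsilon> / 2"
      using measure_law_more_than[OF B, of n l] l by simp
    finally show ?thesis by simp
  qed
  then show ?thesis by blast
qed

end

section \<open>Setwise sequential compactness\<close>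

definition uniformly_countably_additive :: "'x measure \<Rightarrow> (nat \<Rightarrow> 'x measure) \<Rightarrow> bool" where
  "uniformly_countably_additive S u \<longleftrightarrow>
     (\<forall>A \<epsilon>. range A \<subseteq> sets S \<longrightarrow> decseq A \<longrightarrow> (\<Inter>i. A i) = {} \<longrightarrow> 0 < \<epsilon> \<longrightarrow>
        (\<exists>i0::nat. \<forall>i\<ge>i0. \<forall>k. measure (u k) (A i) \<le> (\<epsilon>::real)))"

lemma uniformly_countably_additiveD:
  assumes "uniformly_countably_additive S u" "range A \<subseteq> sets S" "decseq A" "(\<Inter>i. A i) = {}" "0 < \<epsilon>"
  obtains i0 where "\<And>i k. i \<ge> i0 \<Longrightarrow> measure (u k) (A i) \<le> \<epsilon>"
proof -
  have "\<exists>i0::nat. \<forall>i\<ge>i0. \<forall>k. measure (u k) (A i) \<le> \<epsilon>"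
    using assms(1)[unfolded uniformly_countably_additive_def, rule_format, OF assms(2-5)] .
  then show ?thesis using that by blast
qed

lemma uniformly_countably_additive_subseq:
  assumes "uniformly_countably_additive S u"
  shows "uniformly_countably_additive S (\<lambda>k. u (r k))"
  unfolding uniformly_countably_additive_def
proof (intro allI impI)
  fix A and \<epsilon> :: real
  assume A: "range A \<subseteq> sets S" "decseq A" "(\<Inter>i. A i) = {}" "0 < \<epsilon>"
  obtain i0 where "\<And>i k. i \<ge> i0 \<Longrightarrow> measure (u k) (A i) \<le> \<epsilon>"
    using uniformly_countably_additiveD[OF assms A] by blast
  then show "\<exists>i0::nat. \<forall>i\<ge>i0. \<forall>k. measure (u (r k)) (A i) \<le> \<epsilon>" by blast
qed

text \<open>
  Uniform countable additivity makes the class of sets on which the measures converge closed under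
  countable disjoint unions, so that Dynkin's theorem applies to it.
\<close>

lemma setwise_convergent_sigma_sets:
  fixes u :: "nat \<Rightarrow> 'x measure"
  assumes prob: "\<And>k. prob_space (u k)" and sets: "\<And>k. sets (u k) = sets S"
    and uca: "uniformly_countably_additive S u"
    and E: "Int_stable E" "E \<subseteq> Pow (space S)" "sets S = sigma_sets (space S) E"
    and conv: "\<And>A. A \<in> E \<Longrightarrow> convergent (\<lambda>k. measure (u k) A)"
    and A: "A \<in> sets S"
  shows "convergent (\<lambda>k. measure (u k) A)"
proof -
  have space: "space (u k) = space S" for k by (rule sets_eq_imp_space_eq[OF sets])
  have "A \<in> sigma_sets (space S) E" using A E(3) by simp
  with E(1,2) show ?thesis
  proof (induction rule: sigma_sets_induct_disjoint)
    case (basic A)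
    then show ?case by (rule conv)
  next
    case empty
    show ?case by (simp add: convergent_const)
  next
    case (compl A)
    have "measure (u k) (space S - A) = 1 - measure (u k) A" for k
    proof -
      interpret prob_space "u k" by (rule prob)
      have "A \<in> sets (u k)" using compl(1) E(3) sets by simp
      from prob_compl[OF this] show ?thesis by (simp only: space)
    qed
    then show ?case using compl(2) by (simp add: convergent_diff convergent_const)
  next
    case (union A)
    have A: "A i \<in> sets S" for i using union(2) E(3) by blast
    define T where "T N = (\<Union>i\<in>{N..}. A i)" for N
    have T: "T N \<in> sets S" for N using A unfolding T_def by (intro sets.countable_UN') (simp_all add: image_subset_iff)
    have T_dec: "decseq T" unfolding T_def decseq_def by force
    have T_empty: "(\<Inter>N. T N) = {}"
    proof (rule ccontr)
      assume "(\<Inter>N. T N) \<noteq> {}"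
      then obtain x where x: "\<And>N. x \<in> T N" by blast
      from x[of 0] obtain i where i: "x \<in> A i" by (auto simp: T_def)
      from x[of "Suc i"] obtain l where l: "Suc i \<le> l" "x \<in> A l" by (auto simp: T_def)
      then have "A i \<inter> A l = {}" using union(1) by (intro disjoint_family_onD[of A UNIV]) simp_all
      with i l show False by blast
    qed
    have split: "measure (u k) (\<Union>i. A i) = (\<Sum>i<N. measure (u k) (A i)) + measure (u k) (T N)" for k N
    proof -
      interpret prob_space "u k" by (rule prob)
      have "(\<Union>i. A i) = (\<Union>i\<in>{..<N}. A i) \<union> T N"
      proof -
        have "(UNIV::nat set) = {..<N} \<union> {N..}" by auto
        then show ?thesis unfolding T_def by (metis UN_Un)
      qed
      moreover have "(\<Union>i\<in>{..<N}. A i) \<inter> T N = {}"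
      proof (rule equals0I)
        fix x assume "x \<in> (\<Union>i\<in>{..<N}. A i) \<inter> T N"
        then obtain i m where "i < N" "N \<le> m" "x \<in> A i" "x \<in> A m" by (auto simp: T_def)
        moreover from this have "A i \<inter> A m = {}"
          using union(1) by (intro disjoint_family_onD[of A UNIV]) simp_all
        ultimately show False by blast
      qed
      ultimately have "measure (u k) (\<Union>i. A i) = measure (u k) (\<Union>i\<in>{..<N}. A i) + measure (u k) (T N)"
        using A T sets by (simp add: finite_measure_Union)
      also have "measure (u k) (\<Union>i\<in>{..<N}. A i) = (\<Sum>i<N. measure (u k) (A i))"
        using A sets disjoint_family_on_mono[OF subset_UNIV union(1)]
        by (intro finite_measure_finite_Union) (simp_all add: image_subset_iff)
      finally show ?thesis .
    qed
    have "Cauchy (\<lambda>k. measure (u k) (\<Union>i. A i))"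
    proof (rule metric_CauchyI)
      fix \<epsilon> :: real assume \<epsilon>: "0 < \<epsilon>"
      have "range T \<subseteq> sets S" using T by blast
      then obtain N where "\<And>i k. i \<ge> N \<Longrightarrow> measure (u k) (T i) \<le> \<epsilon> / 3"
        using uniformly_countably_additiveD[OF uca _ T_dec T_empty, of "\<epsilon> / 3"] \<epsilon> by auto
      then have N: "measure (u k) (T N) \<le> \<epsilon> / 3" for k by simp
      have "convergent (\<lambda>k. \<Sum>i<N. measure (u k) (A i))"
        by (intro convergent_sum union(3))
      then have "Cauchy (\<lambda>k. \<Sum>i<N. measure (u k) (A i))" by (rule convergent_Cauchy)
      then obtain K where K: "\<And>k l. k \<ge> K \<Longrightarrow> l \<ge> K \<Longrightarrow>
          dist (\<Sum>i<N. measure (u k) (A i)) (\<Sum>i<N. measure (u l) (A i)) < \<epsilon> / 3"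
        using \<epsilon> metric_CauchyD[of "\<lambda>k. \<Sum>i<N. measure (u k) (A i)" "\<epsilon> / 3"] by auto
      show "\<exists>K. \<forall>k\<ge>K. \<forall>l\<ge>K. dist (measure (u k) (\<Union>i. A i)) (measure (u l) (\<Union>i. A i)) < \<epsilon>"
      proof (intro exI allI impI)
        fix k l assume "K \<le> k" "K \<le> l"
        from K[OF this] N[of k] N[of l] measure_nonneg[of "u k" "T N"] measure_nonneg[of "u l" "T N"]
        show "dist (measure (u k) (\<Union>i. A i)) (measure (u l) (\<Union>i. A i)) < \<epsilon>"
          unfolding split[of _ N] dist_real_def by arith
      qed
    qed
    then show ?case by (rule Cauchy_convergent)
  qed
qed

text \<open>
  The limit of the measures of a set is finitely additive in the set. Uniform countable additivity passes
  to the limit as continuity at the empty set.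
\<close>

lemma setwise_limit_prob_space:
  fixes u :: "nat \<Rightarrow> 'x measure"
  assumes prob: "\<And>k. prob_space (u k)" and sets: "\<And>k. sets (u k) = sets S"
    and uca: "uniformly_countably_additive S u"
    and conv: "\<And>A. A \<in> sets S \<Longrightarrow> convergent (\<lambda>k. measure (u k) A)"
  obtains Q where "prob_space Q" "sets Q = sets S"
    "\<And>A. A \<in> sets S \<Longrightarrow> (\<lambda>k. measure (u k) A) \<longlonglongrightarrow> measure Q A"
proof -
  have space: "space (u k) = space S" for k by (rule sets_eq_imp_space_eq[OF sets])
  define l where "l A = lim (\<lambda>k. measure (u k) A)" for A
  have l: "(\<lambda>k. measure (u k) A) \<longlonglongrightarrow> l A" if "A \<in> sets S" for A
    using conv[OF that] unfolding l_def convergent_LIMSEQ_iff .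
  have l_nonneg: "0 \<le> l A" if "A \<in> sets S" for A
    using l[OF that] by (rule LIMSEQ_le_const) simp
  define Q where "Q = measure_of (space S) (sets S) (\<lambda>A. ennreal (l A))"
  have pos: "positive (sets S) (\<lambda>A. ennreal (l A))"
    unfolding positive_def l_def by simp
  have add: "additive (sets S) (\<lambda>A. ennreal (l A))"
    unfolding additive_def
  proof (intro ballI impI)
    fix A B assume AB: "A \<in> sets S" "B \<in> sets S" "A \<inter> B = {}"
    have "measure (u k) (A \<union> B) = measure (u k) A + measure (u k) B" for k
    proof -
      interpret prob_space "u k" by (rule prob)
      show ?thesis using AB sets by (intro finite_measure_Union) simp_all
    qed
    then have "(\<lambda>k. measure (u k) (A \<union> B)) \<longlonglongrightarrow> l A + l B"
      using tendsto_add[OF l[OF AB(1)] l[OF AB(2)]] by simp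
    moreover have "(\<lambda>k. measure (u k) (A \<union> B)) \<longlonglongrightarrow> l (A \<union> B)"
      using AB by (intro l) simp
    ultimately have "l (A \<union> B) = l A + l B" by (rule LIMSEQ_unique[rotated])
    then show "ennreal (l (A \<union> B)) = ennreal (l A) + ennreal (l B)"
      using l_nonneg AB by (simp add: ennreal_plus)
  qed
  have "countably_additive (sets S) (\<lambda>A. ennreal (l A))"
  proof (rule sets.empty_continuous_imp_countably_additive[OF pos add])
    fix A :: "nat \<Rightarrow> 'x set"
    assume A: "range A \<subseteq> sets S" "decseq A" "(\<Inter>i. A i) = {}"
    have "(\<lambda>i. l (A i)) \<longlonglongrightarrow> 0"
    proof (rule LIMSEQ_I)
      fix \<epsilon> :: real assume \<epsilon>: "0 < \<epsilon>"
      obtain i0 where i0: "\<And>i k. i \<ge> i0 \<Longrightarrow> measure (u k) (A i) \<le> \<epsilon> / 2"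
        using uniformly_countably_additiveD[OF uca A, of "\<epsilon> / 2"] \<epsilon> by auto
      show "\<exists>i0. \<forall>i\<ge>i0. norm (l (A i) - 0) < \<epsilon>"
      proof (intro exI allI impI)
        fix i assume "i0 \<le> i"
        have Ai: "A i \<in> sets S" using A(1) by blast
        have "l (A i) \<le> \<epsilon> / 2"
          by (rule LIMSEQ_le_const2[OF l[OF Ai]]) (use i0[OF \<open>i0 \<le> i\<close>] in blast)
        then show "norm (l (A i) - 0) < \<epsilon>" using l_nonneg[OF Ai] \<epsilon> by simp
      qed
    qed
    then show "(\<lambda>i. ennreal (l (A i))) \<longlonglongrightarrow> 0"
      using tendsto_ennrealI[of "\<lambda>i. l (A i)" 0 sequentially] by simp
  qed simp
  then have Q: "emeasure Q A = ennreal (l A)" if "A \<in> sets S" for A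
    unfolding Q_def using that by (intro emeasure_measure_of_sigma sets.sigma_algebra_axioms pos)
  have sets_Q: "sets Q = sets S" "space Q = space S"
    by (simp_all add: Q_def)
  have measure_Q: "measure Q A = l A" if "A \<in> sets S" for A
    using Q[OF that] l_nonneg[OF that] by (simp add: measure_def)
  have "prob_space Q"
  proof
    have "measure (u k) (space S) = 1" for k
      using prob_space.prob_space[OF prob, of k] by (simp add: space)
    then have "l (space S) = 1"
      using LIMSEQ_unique[OF l[OF sets.top]] by simp
    then show "emeasure Q (space Q) = 1"
      by (simp add: sets_Q Q)
  qed
  then show ?thesis
    using sets_Q(1) l by (intro that[of Q]) (simp_all add: measure_Q)
qed

lemma diagonal_convergent_subsequence:
  fixes x :: "nat \<Rightarrow> nat \<Rightarrow> real"
  assumes bounded: "\<And>i n. x i n \<in> {0..1}"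
  obtains r :: "nat \<Rightarrow> nat" where "strict_mono r" "\<And>i. convergent (\<lambda>k. x i (r k))"
proof -
  interpret subseqs "\<lambda>i s. convergent (\<lambda>k. x i (s k))"
  proof
    fix i and s :: "nat \<Rightarrow> nat"
    have "\<forall>k. x i (s k) \<in> {0..1}" using bounded by blast
    then obtain l r where "strict_mono (r :: nat \<Rightarrow> nat)" "((\<lambda>k. x i (s k)) \<circ> r) \<longlonglongrightarrow> l"
      using seq_compactE[OF compact_imp_seq_compact[OF compact_Icc[of "0::real" 1]], of "\<lambda>k. x i (s k)"]
      by metis
    then show "\<exists>r'. strict_mono r' \<and> convergent (\<lambda>k. x i ((s \<circ> r') k))"
      by (auto simp: convergent_def comp_def)
  qed
  have "convergent (\<lambda>k. x i (diagseq k))" for i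
  proof -
    have "convergent (\<lambda>k. x i ((diagseq \<circ> (+) (Suc i)) k))"
    proof (rule diagseq_holds)
      fix r s :: "nat \<Rightarrow> nat" and i assume "strict_mono r" "convergent (\<lambda>k. x i (s k))"
      then have "convergent ((\<lambda>k. x i (s k)) \<circ> r)"
        by (intro convergent_subseq_convergent)
      then show "convergent (\<lambda>k. x i ((s \<circ> r) k))" by (simp add: comp_def)
    qed
    then have "convergent (\<lambda>k. x i (diagseq (k + Suc i)))"
      by (simp add: comp_def add.commute)
    then show ?thesis
      using convergent_ignore_initial_segment[of "\<lambda>k. x i (diagseq k)" "Suc i"] by simp
  qed
  with subseq_diagseq show ?thesis by (rule that)
qed

lemma countable_Int_stable_generator:
  assumes G: "countable G" "G \<subseteq> Pow \<Omega>"
  obtains E where "countable E" "Int_stable E" "E \<subseteq> Pow \<Omega>" "sigma_sets \<Omega> E = sigma_sets \<Omega> G"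
proof -
  define E where "E = (\<lambda>F. \<Omega> \<inter> \<Inter>F) ` {F. finite F \<and> F \<subseteq> G}"
  have "countable E"
    unfolding E_def using G(1) by (intro countable_image countable_Collect_finite_subset)
  moreover have "Int_stable E"
  proof (rule Int_stableI)
    fix a b assume "a \<in> E" "b \<in> E"
    then obtain F F' where F: "finite F" "F \<subseteq> G" "a = \<Omega> \<inter> \<Inter>F" and F': "finite F'" "F' \<subseteq> G" "b = \<Omega> \<inter> \<Inter>F'"
      unfolding E_def by blast
    then have "a \<inter> b = \<Omega> \<inter> \<Inter>(F \<union> F')" by blast
    with F F' show "a \<inter> b \<in> E"
      unfolding E_def by (intro image_eqI[of _ _ "F \<union> F'"]) simp_all
  qed
  moreover have "E \<subseteq> Pow \<Omega>" unfolding E_def by blast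
  moreover have "sigma_sets \<Omega> E = sigma_sets \<Omega> G"
  proof (rule sigma_sets_eqI)
    interpret sigma_algebra \<Omega> "sigma_sets \<Omega> G" by (rule sigma_algebra_sigma_sets[OF G(2)])
    fix a assume "a \<in> E"
    then obtain F where F: "finite F" "F \<subseteq> G" "a = \<Omega> \<inter> \<Inter>F" unfolding E_def by blast
    have "\<Omega> \<inter> \<Inter>F \<in> sigma_sets \<Omega> G"
      using F(1,2)
    proof (induction F)
      case empty
      show ?case using top by simp
    next
      case (insert g F)
      then have "g \<in> sigma_sets \<Omega> G" "\<Omega> \<inter> \<Inter>F \<in> sigma_sets \<Omega> G"
        by (blast intro: sigma_sets.Basic)+
      then have "g \<inter> (\<Omega> \<inter> \<Inter>F) \<in> sigma_sets \<Omega> G" by (rule Int)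
      then show ?case by (simp add: Int_left_commute)
    qed
    then show "a \<in> sigma_sets \<Omega> G" using F(3) by simp
  next
    fix g assume g: "g \<in> G"
    then have "g = \<Omega> \<inter> \<Inter>{g}" using G(2) by blast
    with g have "g \<in> E" unfolding E_def by (intro image_eqI[of _ _ "{g}"]) simp_all
    then show "g \<in> sigma_sets \<Omega> E" by (rule sigma_sets.Basic)
  qed
  ultimately show ?thesis by (rule that)
qed

text \<open>
  One subsequence serves countably many sequences of measures at once. This takes the place of weak
  sequential compactness in \<open>L\<^sup>1\<close>.
\<close>

theorem setwise_sequential_compactness:
  fixes q :: "nat \<Rightarrow> nat \<Rightarrow> 'x measure"
  assumes prob: "\<And>i n. prob_space (q i n)" and sets: "\<And>i n. sets (q i n) = sets S"
    and uca: "\<And>i. uniformly_countably_additive S (q i)"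
    and G: "countable G" "G \<subseteq> Pow (space S)" "sets S = sigma_sets (space S) G"
  obtains r :: "nat \<Rightarrow> nat" and Q :: "nat \<Rightarrow> 'x measure" where "strict_mono r"
    "\<And>i. prob_space (Q i)" "\<And>i. sets (Q i) = sets S"
    "\<And>i A. A \<in> sets S \<Longrightarrow> (\<lambda>k. measure (q i (r k)) A) \<longlonglongrightarrow> measure (Q i) A"
proof -
  obtain E where E: "countable E" "Int_stable E" "E \<subseteq> Pow (space S)"
    "sigma_sets (space S) E = sigma_sets (space S) G"
    by (rule countable_Int_stable_generator[OF G(1,2)])
  define x where "x p n = measure (q (fst (prod_decode p)) n) (from_nat_into E (snd (prod_decode p)))"
    for p n
  have "x p n \<in> {0..1}" for p n
    using prob_space.prob_le_1[OF prob] by (simp add: x_def)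
  then obtain r where r: "strict_mono r" "\<And>p. convergent (\<lambda>k. x p (r k))"
    using diagonal_convergent_subsequence[of x] by metis
  have conv: "convergent (\<lambda>k. measure (q i (r k)) A)" if "A \<in> E" for i A
  proof -
    obtain l where "A = from_nat_into E l"
      using from_nat_into_surj[OF E(1) \<open>A \<in> E\<close>] by metis
    then show ?thesis using r(2)[of "prod_encode (i, l)"] by (simp add: x_def)
  qed
  have uca': "uniformly_countably_additive S (\<lambda>k. q i (r k))" for i
    by (rule uniformly_countably_additive_subseq[OF uca])
  have "convergent (\<lambda>k. measure (q i (r k)) A)" if "A \<in> sets S" for i A
    using E G(3)
    by (intro setwise_convergent_sigma_sets[OF prob sets uca' _ _ _ conv that]) simp_all
  then have "\<exists>Q. prob_space Q \<and> sets Q = sets S \<and>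
      (\<forall>A\<in>sets S. (\<lambda>k. measure (q i (r k)) A) \<longlonglongrightarrow> measure Q A)" for i
    using setwise_limit_prob_space[OF prob sets uca', of i] by metis
  then obtain Q where "\<And>i. prob_space (Q i) \<and> sets (Q i) = sets S \<and>
      (\<forall>A\<in>sets S. (\<lambda>k. measure (q i (r k)) A) \<longlonglongrightarrow> measure (Q i) A)"
    by metis
  then show ?thesis using r(1) by (intro that[of r Q]) simp_all
qed

text \<open>
  Setwise convergence of probability measures carries over to integrals of bounded functions, because
  these are uniform limits of finite combinations of indicators of their upper level sets.
\<close>

lemma setwise_convergence_integral:
  fixes F :: "'x \<Rightarrow> real"
  assumes prob: "\<And>k. prob_space (u k)" "prob_space Q"
    and sets: "\<And>k. sets (u k) = sets S" "sets Q = sets S"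
    and conv: "\<And>A. A \<in> sets S \<Longrightarrow> (\<lambda>k. measure (u k) A) \<longlonglongrightarrow> measure Q A"
    and F: "F \<in> borel_measurable S" "\<And>x. x \<in> space S \<Longrightarrow> 0 \<le> F x" "\<And>x. x \<in> space S \<Longrightarrow> F x \<le> K"
  shows "(\<lambda>k. \<integral>x. F x \<partial>u k) \<longlonglongrightarrow> (\<integral>x. F x \<partial>Q)"
proof (rule LIMSEQ_I)
  fix \<epsilon> :: real assume \<epsilon>: "0 < \<epsilon>"
  obtain l where l: "inverse (real (Suc l)) < \<epsilon> / 3"
    using reals_Archimedean[of "\<epsilon> / 3"] \<epsilon> by auto
  define d where "d = inverse (real (Suc l))"
  have d: "d > 0" "d < \<epsilon> / 3" using l by (simp_all add: d_def)
  define N where "N = nat \<lceil>K / d\<rceil>"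
  define D where "D i = {x \<in> space S. real (Suc i) * d \<le> F x}" for i
  have D: "D i \<in> sets S" for i unfolding D_def using F(1) by measurable
  define H where "H x = (\<Sum>i<N. d * indicator (D i) x)" for x
  have H: "\<bar>F x - H x\<bar> \<le> d" if x: "x \<in> space S" for x
  proof -
    define k where "k = nat \<lfloor>F x / d\<rfloor>"
    have k: "real k * d \<le> F x" "F x \<le> real (Suc k) * d"
    proof -
      have "real k \<le> F x / d" using F(2)[OF x] d(1) by (simp add: k_def)
      then show "real k * d \<le> F x" using d(1) by (simp add: pos_le_divide_eq)
      have "F x / d \<le> real (Suc k)" using F(2)[OF x] d(1) unfolding k_def by linarith
      then show "F x \<le> real (Suc k) * d" using d(1) by (simp add: pos_divide_le_eq del: of_nat_Suc)
    qed
    have "F x / d \<le> K / d" using F(3)[OF x] d(1) by (simp add: divide_right_mono)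
    then have kN: "k \<le> N" unfolding k_def N_def by linarith
    have "indicator (D i) x = (if i < k then 1 else 0 :: real)" if "i < N" for i
    proof (cases "i < k")
      case True
      then have "real (Suc i) * d \<le> real k * d" using d(1) by (intro mult_right_mono) simp_all
      then show ?thesis using True k(1) x by (simp add: D_def del: of_nat_Suc)
    next
      case False
      show ?thesis
      proof (cases "real (Suc i) * d \<le> F x")
        case True
        then have "real (Suc i) \<le> F x / d" using d(1) by (simp add: pos_le_divide_eq del: of_nat_Suc)
        then have "Suc i \<le> k" unfolding k_def by (simp add: le_nat_floor del: of_nat_Suc)
        with False show ?thesis by simp
      qed (use False in \<open>simp add: D_def del: of_nat_Suc\<close>)
    qed
    then have "H x = (\<Sum>i<N. if i < k then d else 0)"
      unfolding H_def by (intro sum.cong) simp_all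
    also have "\<dots> = (\<Sum>i\<in>{..<N} \<inter> {i. i < k}. d)"
      by (subst sum.inter_restrict) simp_all
    also have "{..<N} \<inter> {i. i < k} = {..<k}" using kN by auto
    finally have "H x = real k * d" by simp
    with k show ?thesis by (simp add: algebra_simps)
  qed
  have approx: "\<bar>(\<integral>x. F x \<partial>v) - (\<Sum>i<N. d * measure v (D i))\<bar> \<le> d"
    if v: "prob_space v" "sets v = sets S" for v
  proof -
    interpret prob_space v by fact
    have sp: "space v = space S" by (rule sets_eq_imp_space_eq) fact
    have Dv: "D i \<in> sets v" for i using D v(2) by simp
    have Fv: "F \<in> borel_measurable v" using F(1) v(2) by (simp cong: measurable_cong_sets)
    have intF: "integrable v F"
      using F(2,3) sp Fv by (intro integrable_const_bound[where B = K]) (auto intro!: AE_I2)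
    have intD: "integrable v (\<lambda>x. d * indicator (D i) x)" for i
      using Dv by (intro integrable_mult_right integrable_real_indicator) (simp_all add: less_top[symmetric])
    have "(\<integral>x. H x \<partial>v) = (\<Sum>i<N. d * measure v (D i))"
      unfolding H_def using intD Dv by (subst Bochner_Integration.integral_sum) simp_all
    moreover have intH: "integrable v H"
      unfolding H_def by (intro Bochner_Integration.integrable_sum intD)
    ultimately have "(\<integral>x. F x \<partial>v) - (\<Sum>i<N. d * measure v (D i)) = (\<integral>x. F x - H x \<partial>v)"
      using intF by simp
    also have "\<bar>\<dots>\<bar> \<le> (\<integral>x. \<bar>F x - H x\<bar> \<partial>v)"
      by (rule integral_abs_bound)
    also have "\<dots> \<le> (\<integral>x. d \<partial>v)"
      using intF intH H sp by (intro integral_mono) simp_all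
    finally show ?thesis by (simp add: prob_space)
  qed
  have "(\<lambda>k. \<Sum>i<N. d * measure (u k) (D i)) \<longlonglongrightarrow> (\<Sum>i<N. d * measure Q (D i))"
    by (intro tendsto_sum tendsto_mult tendsto_const conv D)
  then obtain k0 where k0: "\<And>k. k \<ge> k0 \<Longrightarrow>
      norm ((\<Sum>i<N. d * measure (u k) (D i)) - (\<Sum>i<N. d * measure Q (D i))) < \<epsilon> / 3"
    using LIMSEQ_D[of _ _ "\<epsilon> / 3"] \<epsilon> by (metis divide_pos_pos zero_less_numeral)
  show "\<exists>k0. \<forall>k\<ge>k0. norm ((\<integral>x. F x \<partial>u k) - (\<integral>x. F x \<partial>Q)) < \<epsilon>"
  proof (intro exI allI impI)
    fix k assume "k0 \<le> k"
    from k0[OF this] approx[OF prob(1)[of k] sets(1)] approx[OF prob(2) sets(2)] d(2)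
    show "norm ((\<integral>x. F x \<partial>u k) - (\<integral>x. F x \<partial>Q)) < \<epsilon>"
      unfolding real_norm_def by linarith
  qed
qed

context localized_cantor
begin

definition cell_events :: "'a measure set set" where
  "cell_events = range (\<lambda>(i, w, k). {\<mu> \<in> CM. emeasure \<mu> (L i \<inter> cell w) = of_nat k})"

lemma countable_cell_events: "countable cell_events"
  unfolding cell_events_def by (rule countable_image) simp

lemma cell_events_subset: "cell_events \<subseteq> Pow CM"
  unfolding cell_events_def by blast

text \<open>
  The events in \<open>cell_events\<close> determine the enumeration of the points in each \<open>L i\<close>,
  hence all values \<open>\<mu>(A \<inter> L i)\<close> and, in the limit, \<open>\<mu>(A)\<close>.
\<close>

lemma sets_CA_eq_cell_events: "sets CA = sigma_sets CM cell_events"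
proof (intro equalityI)
  define K where "K = sigma CM cell_events"
  have sets_K: "sets K = sigma_sets CM cell_events" and space_K: "space K = CM"
    unfolding K_def using cell_events_subset by (simp_all add: sets_measure_of space_measure_of)
  have nat: "(\<lambda>\<mu>. nat \<lfloor>counts (L i) \<mu> w\<rfloor>) \<in> measurable K (count_space UNIV)" for i w
    unfolding measurable_count_space_eq2_countable
  proof (intro conjI ballI)
    fix k
    have "(\<lambda>\<mu>. nat \<lfloor>counts (L i) \<mu> w\<rfloor>) -` {k} \<inter> space K = {\<mu> \<in> CM. emeasure \<mu> (L i \<inter> cell w) = of_nat k}"
      using counts_nat[OF _ bounded_L, of _ i w] by (auto simp: space_K)
    also have "\<dots> \<in> sets K"
      unfolding sets_K cell_events_def by (rule sigma_sets.Basic) (rule range_eqI[of _ _ "(i, w, k)"], simp)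
    finally show "(\<lambda>\<mu>. nat \<lfloor>counts (L i) \<mu> w\<rfloor>) -` {k} \<inter> space K \<in> sets K" .
  qed simp
  have counts: "(\<lambda>\<mu>. counts (L i) \<mu>) \<in> borel_measurable K" for i
  proof (rule measurable_coordinatewise_then_product)
    fix w
    have "(\<lambda>\<mu>. real (nat \<lfloor>counts (L i) \<mu> w\<rfloor>)) \<in> borel_measurable K"
      by (rule measurable_compose[OF nat]) simp
    moreover have "real (nat \<lfloor>counts (L i) \<mu> w\<rfloor>) = counts (L i) \<mu> w" if "\<mu> \<in> CM" for \<mu>
    proof -
      have "counts (L i) \<mu> w = enn2real (of_nat (nat \<lfloor>counts (L i) \<mu> w\<rfloor>))"
        by (subst counts_def) (rule arg_cong[OF counts_nat[OF that bounded_L]])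
      then show ?thesis by simp
    qed
    ultimately show "(\<lambda>\<mu>. counts (L i) \<mu> w) \<in> borel_measurable K"
      by (rule measurable_cong[THEN iffD1, rotated]) (simp add: space_K)
  qed
  have "(\<lambda>\<mu>. \<mu>) \<in> measurable K CA"
  proof (rule measurable_into_CA)
    fix A assume A: "A \<in> sets M"
    have "(\<lambda>\<mu>. emeasure \<mu> (A \<inter> L i)) \<in> borel_measurable K" for i
    proof -
      have "(\<lambda>\<mu>. (\<lambda>n \<mu>. \<Sum>k<n. indicator A (point (counts (L i) \<mu>) k) :: ennreal)
          (number (counts (L i) \<mu>)) \<mu>) \<in> borel_measurable K"
      proof (rule measurable_compose_countable)
        show "(\<lambda>\<mu>. number (counts (L i) \<mu>)) \<in> measurable K (count_space UNIV)"
          by (rule measurable_compose[OF counts measurable_number])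
        show "(\<lambda>\<mu>. \<Sum>k<n. indicator A (point (counts (L i) \<mu>) k) :: ennreal) \<in> borel_measurable K" for n
          by (intro borel_measurable_sum measurable_compose[OF measurable_compose[OF counts measurable_point]
                borel_measurable_indicator] A)
      qed
      then show ?thesis
        by (rule measurable_cong[THEN iffD1, rotated])
          (simp add: space_K emeasure_eq_card_points A of_nat_card_eq_sum_indicator)
    qed
    then have "(\<lambda>\<mu>. SUP i. emeasure \<mu> (A \<inter> L i)) \<in> borel_measurable K"
      by (intro borel_measurable_SUP) simp_all
    moreover have "(SUP i. emeasure \<mu> (A \<inter> L i)) = emeasure \<mu> A" if "\<mu> \<in> CM" for \<mu>
    proof -
      have "(SUP i. emeasure \<mu> (A \<inter> L i)) = emeasure \<mu> (\<Union>i. A \<inter> L i)"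
        using A incseq_L sets_CM[OF that] by (intro SUP_emeasure_incseq) (auto simp: incseq_def)
      also have "(\<Union>i. A \<inter> L i) = A"
        using sets.sets_into_space[OF A] UN_L by blast
      finally show ?thesis .
    qed
    ultimately show "(\<lambda>\<mu>. emeasure \<mu> A) \<in> borel_measurable K"
      by (rule measurable_cong[THEN iffD1, rotated]) (simp add: space_K)
  qed (simp add: space_K)
  then show "sets CA \<subseteq> sigma_sets CM cell_events"
    unfolding sets_K[symmetric] using sets.sets_into_space space_K
    by (intro subsetI) (drule (1) measurable_sets, force simp: Int_absorb2)
  show "sigma_sets CM cell_events \<subseteq> sets CA"
    unfolding space_CA[symmetric]
  proof (intro sets.sigma_sets_subset subsetI)
    fix y assume "y \<in> cell_events"
    then obtain i w k where "y = {\<mu> \<in> space CA. emeasure \<mu> (L i \<inter> cell w) = of_nat k}"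
      unfolding cell_events_def by auto
    also have "\<dots> \<in> sets CA" by measurable
    finally show "y \<in> sets CA" .
  qed
qed

end

section \<open>Gluing consistent laws on an exhausting sequence\<close>

context localized_cantor
begin

abbreviation ring where "ring \<equiv> disjointed L"

lemma sets_ring [measurable, simp]: "ring i \<in> sets M"
  by (rule sets.range_disjointed_sets[THEN range_subsetD]) (simp add: image_subset_iff)

lemma ring_subset: "i \<le> j \<Longrightarrow> ring i \<subseteq> L j"
  using disjointed_subset[of L i] incseqD[OF incseq_L, of i j] by (rule subset_trans)

lemma bounded_ring: "bounded (ring i)"
  by (rule bounded_subset[OF bounded_L[of i]]) (simp_all add: ring_subset)

lemma ring_Int_L: "j < i \<Longrightarrow> ring i \<inter> L j = {}"
  unfolding disjointed_def by auto

lemma UN_ring: "(\<Union>i\<in>{..j}. ring i) = L j"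
proof -
  have "(\<Union>i\<in>{..j}. ring i) = (\<Union>i\<in>{0..<Suc j}. ring i)"
    by (simp add: atLeast0LessThan lessThan_Suc_atMost)
  also have "\<dots> = (\<Union>i\<in>{0..<Suc j}. L i)" by (rule finite_UN_disjointed_eq)
  also have "\<dots> = L j"
    using incseqD[OF incseq_L] by (fastforce simp: less_Suc_eq_le)
  finally show ?thesis .
qed

lemma emeasure_sum_rings:
  assumes \<mu>: "\<mu> \<in> CM" and A: "A \<in> sets M"
  shows "(\<Sum>i\<le>j. emeasure \<mu> (A \<inter> ring i)) = emeasure \<mu> (A \<inter> L j)"
proof -
  have "(\<Sum>i\<le>j. emeasure \<mu> (A \<inter> ring i)) = emeasure \<mu> (\<Union>i\<in>{..j}. A \<inter> ring i)"
  proof (rule sum_emeasure)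
    show "(\<lambda>i. A \<inter> ring i) ` {..j} \<subseteq> sets \<mu>"
      using A by (simp add: sets_CM[OF \<mu>] image_subset_iff)
    show "disjoint_family_on (\<lambda>i. A \<inter> ring i) {..j}"
      using disjoint_family_disjointed[of L] unfolding disjoint_family_on_def by blast
  qed simp
  also have "(\<Union>i\<in>{..j}. A \<inter> ring i) = A \<inter> L j"
    using UN_ring[of j] by blast
  finally show ?thesis .
qed

lemma counts_restr:
  assumes "\<mu> \<in> CM" "D \<in> sets M" "B \<in> sets M" "D \<subseteq> B"
  shows "counts D (restr \<mu> B) = counts D \<mu>"
proof
  fix w
  have "emeasure (restr \<mu> B) (D \<inter> cell w) = emeasure \<mu> ((D \<inter> cell w) \<inter> B)"
    using assms by (intro emeasure_restr) (simp_all add: sets_CM)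
  also have "(D \<inter> cell w) \<inter> B = D \<inter> cell w" using assms(4) by blast
  finally show "counts D (restr \<mu> B) w = counts D \<mu> w" by (simp add: counts_def)
qed

text \<open>
  The superposition of the configurations that the coordinates \<open>\<omega> i\<close> code in the rings. Coordinates
  need not come from a counting measure: points that a coordinate places outside its ring are dropped,
  which makes the result locally finite for every \<open>\<omega>\<close>.
\<close>

definition glue :: "(nat \<Rightarrow> bool list \<Rightarrow> real) \<Rightarrow> 'a measure" where
  "glue \<omega> = distr (count_space {(i, k). k < number (\<omega> i) \<and> point (\<omega> i) k \<in> ring i}) M
     (\<lambda>(i, k). point (\<omega> i) k)"

lemma sets_glue [simp, measurable_cong]: "sets (glue \<omega>) = sets M"
  and space_glue [simp]: "space (glue \<omega>) = space M"
  by (simp_all add: glue_def)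

lemma emeasure_glue:
  assumes A: "A \<in> sets M"
  shows "emeasure (glue \<omega>) (A \<inter> L j)
    = (\<Sum>i\<le>j. of_nat (card {k. k < number (\<omega> i) \<and> point (\<omega> i) k \<in> A \<inter> ring i}))"
proof -
  let ?S = "{(i, k). k < number (\<omega> i) \<and> point (\<omega> i) k \<in> ring i}"
  let ?T = "SIGMA i:{..j}. {k. k < number (\<omega> i) \<and> point (\<omega> i) k \<in> A \<inter> ring i}"
  have eq: "(\<lambda>(i, k). point (\<omega> i) k) -` (A \<inter> L j) \<inter> ?S = ?T"
  proof (intro equalityI subsetI)
    fix p assume p: "p \<in> (\<lambda>(i, k). point (\<omega> i) k) -` (A \<inter> L j) \<inter> ?S"
    obtain i k where ik: "p = (i, k)" by (cases p)
    with p have *: "k < number (\<omega> i)" "point (\<omega> i) k \<in> ring i" "point (\<omega> i) k \<in> A" "point (\<omega> i) k \<in> L j"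
      by simp_all
    then have "i \<le> j" using ring_Int_L[of j i] by (cases "j < i") auto
    with * show "p \<in> ?T" by (simp add: ik)
  next
    fix p assume p: "p \<in> ?T"
    obtain i k where ik: "p = (i, k)" by (cases p)
    with p ring_subset[of i j] show "p \<in> (\<lambda>(i, k). point (\<omega> i) k) -` (A \<inter> L j) \<inter> ?S" by auto
  qed
  have pts: "(\<lambda>(i, k). point (\<omega> i) k) \<in> measurable (count_space ?S) M"
    by (simp add: Pi_iff split_beta)
  have "emeasure (glue \<omega>) (A \<inter> L j)
      = emeasure (count_space ?S) ((\<lambda>(i, k). point (\<omega> i) k) -` (A \<inter> L j) \<inter> space (count_space ?S))"
    unfolding glue_def using A by (intro emeasure_distr[OF pts]) simp
  also have "\<dots> = emeasure (count_space ?S) ?T"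
    by (simp only: space_count_space eq)
  also have "\<dots> = of_nat (card ?T)"
    by (rule emeasure_count_space_finite) auto
  also have "card ?T = (\<Sum>i\<le>j. card {k. k < number (\<omega> i) \<and> point (\<omega> i) k \<in> A \<inter> ring i})"
    by (rule card_SigmaI) simp_all
  finally show ?thesis by simp
qed

lemma glue_in_CM: "glue \<omega> \<in> CM"
proof (rule CM_I)
  fix B assume B: "bounded B"
  then obtain j where "B \<subseteq> L j" using bounded_imp_subset_L by blast
  then have "B \<inter> L j = B" by blast
  with emeasure_glue[OF bounded_sets_D[OF B], of \<omega> j]
  have "emeasure (glue \<omega>) B
      = of_nat (\<Sum>i\<le>j. card {k. k < number (\<omega> i) \<and> point (\<omega> i) k \<in> B \<inter> ring i})" by simp
  then show "\<exists>k. emeasure (glue \<omega>) B = of_nat k" ..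
qed simp

lemma measurable_glue: "glue \<in> measurable (PiM UNIV (\<lambda>_. borel)) CA"
proof (rule measurable_into_CA)
  let ?K = "PiM UNIV (\<lambda>_. borel) :: (nat \<Rightarrow> bool list \<Rightarrow> real) measure"
  fix A assume A: "A \<in> sets M"
  have coord: "(\<lambda>\<omega>. \<omega> i) \<in> borel_measurable ?K" for i
    by (rule measurable_component_singleton) simp
  have "(\<lambda>\<omega>. emeasure (glue \<omega>) (A \<inter> L j)) \<in> borel_measurable ?K" for j
    unfolding emeasure_glue[OF A] of_nat_card_eq_sum_indicator
  proof (rule borel_measurable_sum)
    fix i
    show "(\<lambda>\<omega>. \<Sum>k<number (\<omega> i). indicator (A \<inter> ring i) (point (\<omega> i) k) :: ennreal) \<in> borel_measurable ?K"
    proof (rule measurable_compose_countable[where f = "\<lambda>n \<omega>. \<Sum>k<n. indicator (A \<inter> ring i) (point (\<omega> i) k)"])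
      show "(\<lambda>\<omega>. number (\<omega> i)) \<in> measurable ?K (count_space UNIV)"
        by (rule measurable_compose[OF coord measurable_number])
      show "(\<lambda>\<omega>. \<Sum>k<n. indicator (A \<inter> ring i) (point (\<omega> i) k) :: ennreal) \<in> borel_measurable ?K" for n
        using A by (intro borel_measurable_sum measurable_compose[OF measurable_compose[OF coord measurable_point]
              borel_measurable_indicator]) simp
    qed
  qed
  then have "(\<lambda>\<omega>. SUP j. emeasure (glue \<omega>) (A \<inter> L j)) \<in> borel_measurable ?K"
    by (intro borel_measurable_SUP) simp_all
  moreover have "(SUP j. emeasure (glue \<omega>) (A \<inter> L j)) = emeasure (glue \<omega>) A" for \<omega>
  proof -
    have "(SUP j. emeasure (glue \<omega>) (A \<inter> L j)) = emeasure (glue \<omega>) (\<Union>j. A \<inter> L j)"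
      using A incseq_L by (intro SUP_emeasure_incseq) (auto simp: incseq_def)
    also have "(\<Union>j. A \<inter> L j) = A"
      using sets.sets_into_space[OF A] UN_L by blast
    finally show ?thesis .
  qed
  ultimately show "(\<lambda>\<omega>. emeasure (glue \<omega>) A) \<in> borel_measurable ?K" by simp
qed (rule glue_in_CM)

lemma restr_glue:
  assumes \<mu>: "\<mu> \<in> CM" and \<omega>: "\<And>i. i \<le> j \<Longrightarrow> \<omega> i = counts (ring i) \<mu>"
  shows "restr (glue \<omega>) (L j) = restr \<mu> (L j)"
proof (rule measure_eqI)
  fix A assume "A \<in> sets (restr (glue \<omega>) (L j))"
  then have A: "A \<in> sets M" by simp
  have "emeasure (restr (glue \<omega>) (L j)) A = emeasure (glue \<omega>) (A \<inter> L j)"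
    using A by (intro emeasure_restr) simp_all
  also have "\<dots> = (\<Sum>i\<le>j. of_nat (card {k. k < number (\<omega> i) \<and> point (\<omega> i) k \<in> A \<inter> ring i}))"
    by (rule emeasure_glue[OF A])
  also have "\<dots> = (\<Sum>i\<le>j. emeasure \<mu> ((A \<inter> ring i) \<inter> ring i))"
  proof (rule sum.cong[OF refl])
    fix i assume "i \<in> {..j}"
    then show "of_nat (card {k. k < number (\<omega> i) \<and> point (\<omega> i) k \<in> A \<inter> ring i}) = emeasure \<mu> ((A \<inter> ring i) \<inter> ring i)"
      using A by (subst emeasure_eq_card_points[OF \<mu> bounded_ring]) (simp_all add: \<omega>)
  qed
  also have "\<dots> = (\<Sum>i\<le>j. emeasure \<mu> (A \<inter> ring i))" by (simp add: Int_assoc)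
  also have "\<dots> = emeasure \<mu> (A \<inter> L j)" by (rule emeasure_sum_rings[OF \<mu> A])
  also have "\<dots> = emeasure (restr \<mu> (L j)) A"
    using A by (intro emeasure_restr[symmetric]) (simp_all add: sets_CM[OF \<mu>])
  finally show "emeasure (restr (glue \<omega>) (L j)) A = emeasure (restr \<mu> (L j)) A" .
qed (simp add: sets_CM[OF \<mu>])

text \<open>
  A configuration is coded by the sequence of its cell counts in the rings, a point of a countable
  product of Polish spaces. Kolmogorov's theorem yields a law of such sequences, and decoding
  turns it into a law on the counting measures.
\<close>

theorem consistent_laws_extend:
  fixes R :: "nat \<Rightarrow> 'a measure measure"
  assumes prob: "\<And>j. prob_space (R j)" and sets: "\<And>j. sets (R j) = sets CA"
    and consistent: "\<And>i j. i \<le> j \<Longrightarrow> distr (R j) CA (\<lambda>\<mu>. restr \<mu> (L i)) = R i"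
  obtains Q where "prob_space Q" "sets Q = sets CA" "\<And>j. distr Q CA (\<lambda>\<mu>. restr \<mu> (L j)) = R j"
proof -
  define z where "z J \<mu> = (\<lambda>i\<in>J. counts (ring i) \<mu>)" for J \<mu>
  have z_meas: "z J \<in> measurable CA (PiM J (\<lambda>_. borel))" for J
    unfolding z_def by (intro measurable_restrict measurable_counts) simp
  have R_meas_PiM: "measurable (R j) N = measurable CA N" for j and N :: "(nat \<Rightarrow> bool list \<Rightarrow> real) measure"
    using sets by (intro measurable_cong_sets) simp_all
  have R_meas_CA: "measurable (R j) CA = measurable CA CA" for j
    using sets by (intro measurable_cong_sets) simp_all
  have space: "space (R j) = CM" for j
    using sets_eq_imp_space_eq[OF sets] by simp
  \<comment> \<open>By consistency, the law of finitely many coordinates can be read off from \<open>R j\<close> for any large \<open>j\<close>.\<close>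
  have marginal: "distr (R j) (PiM J (\<lambda>_. borel)) (z J) = distr (R i) (PiM J (\<lambda>_. borel)) (z J)"
    if J: "J \<subseteq> {..i}" and ij: "i \<le> j" for J i j
  proof -
    have "distr (R i) (PiM J (\<lambda>_. borel)) (z J)
        = distr (distr (R j) CA (\<lambda>\<mu>. restr \<mu> (L i))) (PiM J (\<lambda>_. borel)) (z J)"
      by (simp only: consistent[OF ij])
    also have "\<dots> = distr (R j) (PiM J (\<lambda>_. borel)) (z J \<circ> (\<lambda>\<mu>. restr \<mu> (L i)))"
      by (rule distr_distr[OF z_meas]) (simp add: R_meas_CA)
    also have "\<dots> = distr (R j) (PiM J (\<lambda>_. borel)) (z J)"
    proof (rule distr_cong[OF refl refl])
      fix \<mu> assume "\<mu> \<in> space (R j)"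
      then have "\<mu> \<in> CM" by (simp add: space)
      then show "(z J \<circ> (\<lambda>\<mu>. restr \<mu> (L i))) \<mu> = z J \<mu>"
        unfolding z_def comp_def using J
        by (intro restrict_ext counts_restr) (auto intro: ring_subset[THEN subsetD])
    qed
    finally show ?thesis by (rule sym)
  qed
  define top where "top J = Max (insert 0 J)" for J :: "nat set"
  have top: "J \<subseteq> {..top J}" if "finite J" for J
    using that unfolding top_def by (auto intro: Max_ge)
  have top_mono: "top J \<le> top H" if "J \<subseteq> H" "finite H" for J H
    unfolding top_def using that by (intro Max_mono) auto
  define PJ where "PJ J = distr (R (top J)) (PiM J (\<lambda>_. borel)) (z J)" for J
  interpret K: polish_projective UNIV PJ
  proof (intro polish_projective.intro projective_family.intro)
    fix J H :: "nat set" assume JH: "J \<subseteq> H" "finite H"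
    have restrict_meas: "(\<lambda>f. restrict f J) \<in> measurable (PiM H (\<lambda>_. borel)) (PiM J (\<lambda>_. borel :: (bool list \<Rightarrow> real) measure))"
      by (rule measurable_restrict_subset[OF JH(1)])
    have "distr (PJ H) (PiM J (\<lambda>_. borel)) (\<lambda>f. restrict f J)
        = distr (R (top H)) (PiM J (\<lambda>_. borel)) ((\<lambda>f. restrict f J) \<circ> z H)"
      unfolding PJ_def using z_meas by (intro distr_distr[OF restrict_meas]) (simp add: R_meas_PiM)
    also have "(\<lambda>f. restrict f J) \<circ> z H = z J"
      using JH(1) by (auto simp: z_def fun_eq_iff restrict_def)
    also have "distr (R (top H)) (PiM J (\<lambda>_. borel)) (z J) = PJ J"
      unfolding PJ_def using JH finite_subset[OF JH]
      by (intro marginal top top_mono)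
    finally show "PJ J = distr (PJ H) (PiM J (\<lambda>_. borel)) (\<lambda>f. restrict f J)" by (rule sym)
  next
    fix J :: "nat set"
    show "prob_space (PJ J)"
      unfolding PJ_def using z_meas by (intro prob_space.prob_space_distr[OF prob]) (simp add: R_meas_PiM)
  qed
  have lim_marginal: "distr K.lim (PiM J (\<lambda>_. borel)) (\<lambda>\<omega>. restrict \<omega> J) = PJ J" if J: "finite J" for J
  proof (rule measure_eqI)
    fix X assume "X \<in> sets (distr K.lim (PiM J (\<lambda>_. borel)) (\<lambda>\<omega>. restrict \<omega> J))"
    then have X: "X \<in> sets (PiM J (\<lambda>_. borel))" by simp
    have "emeasure (distr K.lim (PiM J (\<lambda>_. borel)) (\<lambda>\<omega>. restrict \<omega> J)) X
        = emeasure K.lim (prod_emb UNIV (\<lambda>_. borel) J X)"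
      using X by (subst emeasure_distr)
        (simp_all add: prod_emb_def space_PiM cong: measurable_cong_sets
          add: measurable_restrict_subset[OF subset_UNIV])
    also have "\<dots> = emeasure (PJ J) X"
      by (rule K.emeasure_lim_emb[OF subset_UNIV J X])
    finally show "emeasure (distr K.lim (PiM J (\<lambda>_. borel)) (\<lambda>\<omega>. restrict \<omega> J)) X = emeasure (PJ J) X" .
  qed (simp add: PJ_def)
  have lim_meas: "measurable K.lim N = measurable (PiM UNIV (\<lambda>_. borel)) N" for N :: "'a measure measure"
    by (intro measurable_cong_sets) simp_all
  have glue_lim: "glue \<in> measurable K.lim CA"
    unfolding lim_meas by (rule measurable_glue)
  define Q where "Q = distr K.lim CA glue"
  have "prob_space Q"
    unfolding Q_def by (rule K.P.prob_space_distr[OF glue_lim])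
  moreover have "sets Q = sets CA" by (simp add: Q_def)
  moreover have "distr Q CA (\<lambda>\<mu>. restr \<mu> (L j)) = R j" for j
  proof -
    \<comment> \<open>Restricted to \<open>L j\<close>, the glued configuration depends on the coordinates up to \<open>j\<close> only.\<close>
    define ext where "ext \<omega> i = (if i \<le> j then \<omega> i else (\<lambda>_. 0))" for \<omega> :: "nat \<Rightarrow> bool list \<Rightarrow> real" and i
    have ext: "ext \<in> measurable (PiM {..j} (\<lambda>_. borel)) (PiM UNIV (\<lambda>_. borel))"
    proof (rule measurable_PiM_single')
      fix i
      show "(\<lambda>\<omega>. ext \<omega> i) \<in> borel_measurable (PiM {..j} (\<lambda>_. borel))"
        unfolding ext_def by (cases "i \<le> j") (simp_all add: measurable_component_singleton)
    qed (simp add: PiE_UNIV_domain)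
    define g where "g \<omega> = restr (glue (ext \<omega>)) (L j)" for \<omega>
    have restr_meas: "(\<lambda>\<mu>. restr \<mu> (L j)) \<in> measurable CA CA" by measurable
    have g: "g \<in> measurable (PiM {..j} (\<lambda>_. borel)) CA"
      unfolding g_def by (rule measurable_compose[OF measurable_compose[OF ext measurable_glue] restr_meas])
    have g_restrict: "restr (glue \<omega>) (L j) = g (restrict \<omega> {..j})" for \<omega>
    proof (rule measure_eqI)
      fix A assume "A \<in> sets (restr (glue \<omega>) (L j))"
      then have A: "A \<in> sets M" by simp
      have "ext (restrict \<omega> {..j}) i = \<omega> i" if "i \<le> j" for i using that by (simp add: ext_def)
      then show "emeasure (restr (glue \<omega>) (L j)) A = emeasure (g (restrict \<omega> {..j})) A"
        unfolding g_def using A by (simp add: emeasure_restr emeasure_glue)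
    qed (simp add: g_def)
    have "distr Q CA (\<lambda>\<mu>. restr \<mu> (L j)) = distr K.lim CA ((\<lambda>\<mu>. restr \<mu> (L j)) \<circ> glue)"
      unfolding Q_def by (rule distr_distr[OF restr_meas glue_lim])
    also have "(\<lambda>\<mu>. restr \<mu> (L j)) \<circ> glue = g \<circ> (\<lambda>\<omega>. restrict \<omega> {..j})"
      by (simp add: fun_eq_iff g_restrict)
    also have "distr K.lim CA (g \<circ> (\<lambda>\<omega>. restrict \<omega> {..j})) = distr (PJ {..j}) CA g"
    proof -
      have "(\<lambda>\<omega>. restrict \<omega> {..j}) \<in> measurable K.lim (PiM {..j} (\<lambda>_. borel))"
        using measurable_restrict_subset[OF subset_UNIV, of "{..j}" "\<lambda>_. borel"]
        by (simp cong: measurable_cong_sets)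
      from distr_distr[OF g this] show ?thesis by (simp add: lim_marginal)
    qed
    also have "\<dots> = distr (R j) CA (g \<circ> z {..j})"
    proof -
      have "top {..j} = j" unfolding top_def by (rule Max_eqI) auto
      then show ?thesis
        unfolding PJ_def using z_meas[of "{..j}"] by (simp add: distr_distr[OF g] R_meas_PiM)
    qed
    also have "\<dots> = distr (R j) CA (\<lambda>\<mu>. restr \<mu> (L j))"
    proof (rule distr_cong[OF refl refl])
      fix \<mu> assume "\<mu> \<in> space (R j)"
      then have "\<mu> \<in> CM" by (simp add: space)
      then show "(g \<circ> z {..j}) \<mu> = restr \<mu> (L j)"
        unfolding comp_def g_def by (rule restr_glue) (simp add: ext_def z_def)
    qed
    also have "\<dots> = R j" by (rule consistent) simp
    finally show ?thesis .
  qed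
  ultimately show ?thesis by (rule that)
qed

end

section \<open>Local functions\<close>

context localized_space
begin

lemma local_function_L:
  assumes "local_function M L F"
  obtains i where "\<And>j \<mu>. i \<le> j \<Longrightarrow> \<mu> \<in> CM \<Longrightarrow> F (restr \<mu> (L j)) = F \<mu>"
proof -
  obtain B where B: "bounded B" and F: "\<And>\<mu>. \<mu> \<in> CM \<Longrightarrow> F \<mu> = F (restr \<mu> B)"
    using assms unfolding local_function_def by blast
  obtain i where i: "B \<subseteq> L i" using bounded_imp_subset_L[OF B] by blast
  have BM: "B \<in> sets M" using B by (rule bounded_sets_D)
  show thesis
  proof (rule that)
    fix j \<mu> assume ij: "i \<le> j" and \<mu>: "\<mu> \<in> CM"
    have "L j \<inter> B = B" using i incseqD[OF incseq_L ij] by blast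
    then have "F (restr \<mu> (L j)) = F (restr \<mu> B)"
      using F[OF restr_in_CM[OF \<mu> sets_L]] restr_restr[OF \<mu> sets_L BM] by simp
    with F[OF \<mu>] show "F (restr \<mu> (L j)) = F \<mu>" by simp
  qed
qed

lemma tame_function_L:
  assumes "tame_function M L (\<lambda>\<mu>. ereal (F \<mu>))"
  obtains C i where "C \<ge> 0"
    "\<And>j \<mu> l. i \<le> j \<Longrightarrow> \<mu> \<in> CM \<Longrightarrow> emeasure \<mu> (L j) = of_nat l \<Longrightarrow> F \<mu> \<le> C * (1 + real l)"
proof -
  obtain C B where C: "C \<ge> 0" and B: "bounded B"
    and F: "\<And>\<mu>. \<mu> \<in> CM \<Longrightarrow> \<bar>ereal (F \<mu>)\<bar> \<le> ereal C * (1 + enn2ereal (emeasure \<mu> B))"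
    using assms unfolding tame_function_def by blast
  obtain i where i: "B \<subseteq> L i" using bounded_imp_subset_L[OF B] by blast
  show thesis
  proof (rule that[OF C])
    fix j \<mu> l assume ij: "i \<le> j" and \<mu>: "\<mu> \<in> CM" and l: "emeasure \<mu> (L j) = of_nat l"
    obtain b where b: "emeasure \<mu> B = of_nat b" using \<mu> B by (rule emeasure_CM_bounded)
    have "emeasure \<mu> B \<le> emeasure \<mu> (L j)"
      using i incseqD[OF incseq_L ij] sets_CM[OF \<mu>] by (intro emeasure_mono) auto
    then have "b \<le> l" unfolding b l by simp
    have "enn2ereal (emeasure \<mu> B) = ereal (real b)"
      unfolding b by (simp add: ennreal_of_nat_eq_real_of_nat enn2ereal_ennreal)
    with F[OF \<mu>] have "\<bar>F \<mu>\<bar> \<le> C * (1 + real b)"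
      by (simp add: add.commute)
    also have "\<dots> \<le> C * (1 + real l)" using C \<open>b \<le> l\<close> by (intro mult_left_mono) simp_all
    finally show "F \<mu> \<le> C * (1 + real l)" by simp
  qed
qed

lemma point_process_id:
  "prob_space Q \<Longrightarrow> sets Q = sets CA \<Longrightarrow> point_process M L Q (\<lambda>\<mu>. \<mu>)"
  unfolding point_process_def by (simp add: measurable_ident_sets)

end

section \<open>Subsequential limits\<close>

context janossy_sequence
begin

lemma law_consistent:
  assumes "i \<le> j"
  shows "distr (law (L j) n) CA (\<lambda>\<mu>. restr \<mu> (L i)) = law (L i) n"
proof -
  have "distr (law (L j) n) CA (\<lambda>\<mu>. restr \<mu> (L i))
      = distr (P n) CA ((\<lambda>\<mu>. restr \<mu> (L i)) \<circ> (\<lambda>\<omega>. restr (\<eta> n \<omega>) (L j)))"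
    unfolding law_def by (intro distr_distr measurable_restr measurable_restr_\<eta> sets_L)
  also have "\<dots> = law (L i) n"
    unfolding law_def
  proof (rule distr_cong[OF refl refl])
    fix \<omega> assume "\<omega> \<in> space (P n)"
    moreover have "L j \<inter> L i = L i" using incseqD[OF incseq_L assms] by blast
    ultimately show "((\<lambda>\<mu>. restr \<mu> (L i)) \<circ> (\<lambda>\<omega>. restr (\<eta> n \<omega>) (L j))) \<omega> = restr (\<eta> n \<omega>) (L i)"
      by (simp add: restr_restr \<eta>_in_CM)
  qed
  finally show ?thesis .
qed

text \<open>
  For each \<open>j\<close> the laws of \<open>(\<eta> n)\<close> restricted to \<open>L j\<close> converge setwise along one common
  subsequence. Their limits inherit consistency and so come from a single law.
\<close>

lemma subsequential_limit:
  obtains r :: "nat \<Rightarrow> nat" and Q where "strict_mono r" "prob_space Q" "sets Q = sets CA"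
    "\<And>j A. A \<in> sets CA \<Longrightarrow> (\<lambda>k. measure (law (L j) (r k)) A)
       \<longlonglongrightarrow> measure (distr Q CA (\<lambda>\<mu>. restr \<mu> (L j))) A"
proof -
  have "uniformly_countably_additive CA (law (L i))" for i
    unfolding uniformly_countably_additive_def
    by (intro allI impI law_uniformly_countably_additive) (simp_all add: image_subset_iff)
  then obtain r :: "nat \<Rightarrow> nat" and R where r: "strict_mono r"
    and R: "\<And>i. prob_space (R i)" "\<And>i. sets (R i) = sets CA"
      "\<And>i A. A \<in> sets CA \<Longrightarrow> (\<lambda>k. measure (law (L i) (r k)) A) \<longlonglongrightarrow> measure (R i) A"
    using setwise_sequential_compactness[of "\<lambda>i. law (L i)" CA cell_events]
      prob_space_law sets_L countable_cell_events cell_events_subset sets_CA_eq_cell_events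
    by (metis sets_law space_CA)
  have "distr (R j) CA (\<lambda>\<mu>. restr \<mu> (L i)) = R i" if ij: "i \<le> j" for i j
  proof (rule measure_eqI)
    have meas: "(\<lambda>\<mu>. restr \<mu> (L i)) \<in> measurable (R j) CA"
      using measurable_restr[OF sets_L, of i] by (simp add: R(2) cong: measurable_cong_sets)
    interpret D: prob_space "distr (R j) CA (\<lambda>\<mu>. restr \<mu> (L i))"
      by (rule prob_space.prob_space_distr[OF R(1) meas])
    interpret Ri: prob_space "R i" by (rule R(1))
    fix A assume "A \<in> sets (distr (R j) CA (\<lambda>\<mu>. restr \<mu> (L i)))"
    then have A: "A \<in> sets CA" by simp
    let ?A = "(\<lambda>\<mu>. restr \<mu> (L i)) -` A \<inter> CM"
    have A': "?A \<in> sets CA" using measurable_sets[OF measurable_restr[OF sets_L, of i] A] by simp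
    have spR: "space (R j) = CM" using sets_eq_imp_space_eq[OF R(2)] by simp
    have "measure (law (L j) (r k)) ?A = measure (law (L i) (r k)) A" for k
      unfolding law_consistent[OF ij, symmetric]
      using A by (subst measure_distr) (simp_all cong: measurable_cong_sets)
    with R(3)[OF A', of j] have "(\<lambda>k. measure (law (L i) (r k)) A) \<longlonglongrightarrow> measure (R j) ?A" by simp
    from LIMSEQ_unique[OF this R(3)[OF A]] have "measure (R j) ?A = measure (R i) A" .
    moreover have "measure (distr (R j) CA (\<lambda>\<mu>. restr \<mu> (L i))) A = measure (R j) ?A"
      using A by (subst measure_distr[OF meas]) (simp_all add: spR)
    ultimately show "emeasure (distr (R j) CA (\<lambda>\<mu>. restr \<mu> (L i))) A = emeasure (R i) A"
      by (simp add: D.emeasure_eq_measure Ri.emeasure_eq_measure)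
  qed (simp add: R(2))
  then obtain Q where "prob_space Q" "sets Q = sets CA" "\<And>j. distr Q CA (\<lambda>\<mu>. restr \<mu> (L j)) = R j"
    using consistent_laws_extend[of R, OF R(1,2)] by metis
  with r R(3) show ?thesis by (intro that[of r Q]) simp_all
qed

lemma integral_law:
  fixes F :: "'a measure \<Rightarrow> real"
  assumes F: "F \<in> borel_measurable CA" and loc: "\<And>\<mu>. \<mu> \<in> CM \<Longrightarrow> F (restr \<mu> (L j)) = F \<mu>"
  shows "(\<integral>\<omega>. F (\<eta> n \<omega>) \<partial>P n) = (\<integral>\<mu>. F \<mu> \<partial>law (L j) n)"
    and "integrable (P n) (\<lambda>\<omega>. F (\<eta> n \<omega>)) \<Longrightarrow> integrable (law (L j) n) F"
proof -
  have eq: "F (restr (\<eta> n \<omega>) (L j)) = F (\<eta> n \<omega>)" if "\<omega> \<in> space (P n)" for \<omega>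
    using loc[OF \<eta>_in_CM[OF that]] .
  have "(\<integral>\<mu>. F \<mu> \<partial>law (L j) n) = (\<integral>\<omega>. F (restr (\<eta> n \<omega>) (L j)) \<partial>P n)"
    unfolding law_def by (rule integral_distr[OF measurable_restr_\<eta>[OF sets_L] F])
  also have "\<dots> = (\<integral>\<omega>. F (\<eta> n \<omega>) \<partial>P n)"
    by (rule Bochner_Integration.integral_cong[OF refl eq])
  finally show "(\<integral>\<omega>. F (\<eta> n \<omega>) \<partial>P n) = (\<integral>\<mu>. F \<mu> \<partial>law (L j) n)" ..
  assume "integrable (P n) (\<lambda>\<omega>. F (\<eta> n \<omega>))"
  moreover have "integrable (P n) (\<lambda>\<omega>. F (restr (\<eta> n \<omega>) (L j))) \<longleftrightarrow> integrable (P n) (\<lambda>\<omega>. F (\<eta> n \<omega>))"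
    by (rule Bochner_Integration.integrable_cong[OF refl]) (rule eq)
  ultimately have "integrable (P n) (\<lambda>\<omega>. F (restr (\<eta> n \<omega>) (L j)))" by simp
  then show "integrable (law (L j) n) F"
    unfolding law_def by (rule integrable_distr_eq[OF measurable_restr_\<eta>[OF sets_L] F, THEN iffD2])
qed

text \<open>
  A tame function is dominated by a multiple of \<open>1 + \<mu>(L j)\<close>, whose expectation over
  \<open>\<mu>(L j) > m\<close> is at most the tail of a convergent series, uniformly in the sequence.
\<close>

lemma tame_tail_bound:
  fixes F :: "'a measure \<Rightarrow> real"
  assumes F: "F \<in> borel_measurable CA" "\<And>\<mu>. \<mu> \<in> CM \<Longrightarrow> 0 \<le> F \<mu>" and C: "C \<ge> 0"
    and tame: "\<And>\<mu> l. \<mu> \<in> CM \<Longrightarrow> emeasure \<mu> (L j) = of_nat l \<Longrightarrow> F \<mu> \<le> C * (1 + real l)"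
    and sum: "summable (\<lambda>l. C * (1 + real (Suc l)) * c (L j) (Suc l))"
  shows "(\<integral>\<mu>. F \<mu> * indicator (more_than (L j) m) \<mu> \<partial>law (L j) n)
    \<le> (\<Sum>k. C * (1 + real (Suc (k + m))) * c (L j) (Suc (k + m)))"
proof -
  define b where "b l = C * (1 + real (Suc l)) * c (L j) (Suc l)" for l
  have b_nonneg: "0 \<le> b l" for l
    using C c_nonneg[OF bounded_L, of "Suc l" j] by (simp add: b_def)
  have sum_b: "summable (\<lambda>k. b (k + m))"
    using sum unfolding b_def[symmetric] by (rule summable_ignore_initial_segment)
  have term_le: "g k \<le> (\<Sum>k. g k)" for g :: "nat \<Rightarrow> ennreal" and k
    using sum_le_suminf[of g "{k}"] by simp
  have ex: "exactly (L j) l \<in> sets CA" for l by (rule sets_exactly[OF sets_L])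
  have "(\<integral>\<^sup>+\<mu>. ennreal (F \<mu> * indicator (more_than (L j) m) \<mu>) \<partial>law (L j) n)
      \<le> (\<integral>\<^sup>+\<mu>. (\<Sum>k. ennreal (C * (1 + real (Suc (k + m)))) * indicator (exactly (L j) (Suc (k + m))) \<mu>) \<partial>law (L j) n)"
  proof (rule nn_integral_mono)
    fix \<mu> assume "\<mu> \<in> space (law (L j) n)"
    then have \<mu>: "\<mu> \<in> CM" by simp
    let ?g = "\<lambda>k. ennreal (C * (1 + real (Suc (k + m)))) * indicator (exactly (L j) (Suc (k + m))) \<mu>"
    show "ennreal (F \<mu> * indicator (more_than (L j) m) \<mu>) \<le> (\<Sum>k. ?g k)"
    proof (cases "\<mu> \<in> more_than (L j) m")
      case True
      then obtain k where k: "\<mu> \<in> exactly (L j) (Suc (k + m))"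
        unfolding more_than_eq_UN[OF bounded_L] by blast
      then have "F \<mu> \<le> C * (1 + real (Suc (k + m)))"
        using \<mu> by (intro tame) (simp_all add: exactly_def)
      then have "ennreal (F \<mu> * indicator (more_than (L j) m) \<mu>) \<le> ?g k"
        using True k by (simp add: ennreal_leI)
      also have "?g k \<le> (\<Sum>k. ?g k)" by (rule term_le)
      finally show ?thesis .
    qed simp
  qed
  also have "\<dots> = (\<Sum>k. \<integral>\<^sup>+\<mu>. ennreal (C * (1 + real (Suc (k + m)))) * indicator (exactly (L j) (Suc (k + m))) \<mu> \<partial>law (L j) n)"
    using ex by (intro nn_integral_suminf borel_measurable_times_ennreal borel_measurable_indicator) simp_all
  also have "\<dots> = (\<Sum>k. ennreal (C * (1 + real (Suc (k + m)))) * emeasure (law (L j) n) (exactly (L j) (Suc (k + m))))"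
    using ex by (intro suminf_cong nn_integral_cmult_indicator) simp
  also have "\<dots> \<le> (\<Sum>k. ennreal (b (k + m)))"
  proof (rule suminf_le)
    fix k
    have "emeasure (law (L j) n) (exactly (L j) (Suc (k + m))) \<le> ennreal (c (L j) (Suc (k + m)))"
      by (rule law_exactly_le[OF bounded_L]) simp
    then have "ennreal (C * (1 + real (Suc (k + m)))) * emeasure (law (L j) n) (exactly (L j) (Suc (k + m)))
        \<le> ennreal (C * (1 + real (Suc (k + m)))) * ennreal (c (L j) (Suc (k + m)))"
      by (rule mult_left_mono) simp
    also have "\<dots> = ennreal (b (k + m))"
      unfolding b_def using C c_nonneg[OF bounded_L, of "Suc (k + m)" j] by (intro ennreal_mult[symmetric]) simp_all
    finally show "ennreal (C * (1 + real (Suc (k + m)))) * emeasure (law (L j) n) (exactly (L j) (Suc (k + m)))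
        \<le> ennreal (b (k + m))" .
  qed simp_all
  also have "\<dots> = ennreal (\<Sum>k. b (k + m))"
    by (rule suminf_ennreal2[OF b_nonneg sum_b])
  finally have "(\<integral>\<^sup>+\<mu>. ennreal (F \<mu> * indicator (more_than (L j) m) \<mu>) \<partial>law (L j) n) \<le> ennreal (\<Sum>k. b (k + m))" .
  then have "(\<integral>\<mu>. F \<mu> * indicator (more_than (L j) m) \<mu> \<partial>law (L j) n) \<le> (\<Sum>k. b (k + m))"
    using b_nonneg sum_b by (intro integral_real_bounded suminf_nonneg)
  then show ?thesis by (simp only: b_def)
qed

text \<open>
  Cutting \<open>F\<close> off where \<open>\<mu>(L j) > m\<close> makes it bounded. The cut-off part has small expectation,
  uniformly along the sequence by the tail bound and in the limit by integrability.
\<close>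

lemma tame_convergence:
  fixes F :: "'a measure \<Rightarrow> real"
  assumes V: "prob_space V" "sets V = sets CA"
    and conv: "\<And>A. A \<in> sets CA \<Longrightarrow> (\<lambda>k. measure (law (L j) (r k)) A) \<longlonglongrightarrow> measure V A"
    and F: "F \<in> borel_measurable CA" "\<And>\<mu>. \<mu> \<in> CM \<Longrightarrow> 0 \<le> F \<mu>" and C: "C \<ge> 0"
    and tame: "\<And>\<mu> l. \<mu> \<in> CM \<Longrightarrow> emeasure \<mu> (L j) = of_nat l \<Longrightarrow> F \<mu> \<le> C * (1 + real l)"
    and sum: "summable (\<lambda>l. real (Suc l) * c (L j) (Suc l))"
    and int: "\<And>n. integrable (law (L j) (r n)) F" "integrable V F"
  shows "(\<lambda>k. \<integral>\<mu>. F \<mu> \<partial>law (L j) (r k)) \<longlonglongrightarrow> (\<integral>\<mu>. F \<mu> \<partial>V)"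
proof (rule LIMSEQ_I)
  fix \<epsilon> :: real assume \<epsilon>: "0 < \<epsilon>"
  let ?T = "\<lambda>m. more_than (L j) m"
  let ?b = "\<lambda>l. C * (1 + real (Suc l)) * c (L j) (Suc l)"
  have T: "?T m \<in> sets CA" for m by (rule sets_more_than[OF sets_L])
  have sum_b: "summable ?b"
  proof (rule summable_comparison_test'[where N = 0])
    show "summable (\<lambda>l. 2 * C * (real (Suc l) * c (L j) (Suc l)))"
      by (rule summable_mult[OF sum])
    fix l :: nat
    have c0: "0 \<le> c (L j) (Suc l)" by (rule c_nonneg[OF bounded_L]) simp
    have "?b l \<le> C * (2 * real (Suc l)) * c (L j) (Suc l)"
      using C c0 by (intro mult_right_mono mult_left_mono) simp_all
    then show "norm (?b l) \<le> 2 * C * (real (Suc l) * c (L j) (Suc l))"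
      using C c0 by (simp add: algebra_simps)
  qed
  have "(\<lambda>m. \<Sum>k. ?b (k + m)) \<longlonglongrightarrow> 0"
    by (rule suminf_exist_split2[OF sum_b])
  then have ev1: "eventually (\<lambda>m. (\<Sum>k. ?b (k + m)) < \<epsilon> / 3) sequentially"
    using \<epsilon> by (intro order_tendstoD(2)[where y = 0]) simp_all
  have FV: "F \<in> borel_measurable V" and TV: "?T m \<in> sets V" for m
    using F(1) T V(2) by (simp_all cong: measurable_cong_sets)
  have spV: "space V = CM" using sets_eq_imp_space_eq[OF V(2)] by simp
  have "(\<lambda>m. \<integral>\<mu>. F \<mu> * indicator (?T m) \<mu> \<partial>V) \<longlonglongrightarrow> (\<integral>\<mu>. 0 \<partial>V)"
  proof (rule integral_dominated_convergence[where w = F])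
    show "(\<lambda>\<mu>. F \<mu> * indicator (?T m) \<mu>) \<in> borel_measurable V" for m
      using FV TV by (intro borel_measurable_times borel_measurable_indicator)
    show "AE \<mu> in V. (\<lambda>m. F \<mu> * indicator (?T m) \<mu>) \<longlonglongrightarrow> 0"
    proof (rule AE_I2)
      fix \<mu> assume "\<mu> \<in> space V"
      then have "\<mu> \<in> CM" by (simp add: spV)
      then obtain l where l: "emeasure \<mu> (L j) = of_nat l" using bounded_L by (rule emeasure_CM_bounded)
      have "F \<mu> * indicator (?T m) \<mu> = 0" if "m \<ge> l" for m
        using that by (simp add: more_than_def l)
      then have "eventually (\<lambda>m. F \<mu> * indicator (?T m) \<mu> = 0) sequentially"
        unfolding eventually_sequentially by blast
      then show "(\<lambda>m. F \<mu> * indicator (?T m) \<mu>) \<longlonglongrightarrow> 0" by (rule tendsto_eventually)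
    qed
    show "AE \<mu> in V. norm (F \<mu> * indicator (?T m) \<mu>) \<le> F \<mu>" for m
      using F(2) by (intro AE_I2) (simp add: spV indicator_def)
  qed (use int in simp_all)
  then have ev2: "eventually (\<lambda>m. (\<integral>\<mu>. F \<mu> * indicator (?T m) \<mu> \<partial>V) < \<epsilon> / 3) sequentially"
    using \<epsilon> by (intro order_tendstoD(2)[where y = "\<integral>\<mu>. 0 \<partial>V"]) simp_all
  from eventually_conj[OF ev1 ev2] obtain m where m: "(\<Sum>k. ?b (k + m)) < \<epsilon> / 3"
    "(\<integral>\<mu>. F \<mu> * indicator (?T m) \<mu> \<partial>V) < \<epsilon> / 3"
    unfolding eventually_sequentially by blast
  define G where "G \<mu> = F \<mu> * indicator (CM - ?T m) \<mu>" for \<mu>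
  have G_le: "G \<mu> \<le> C * (1 + real m)" if "\<mu> \<in> CM" for \<mu>
  proof (cases "\<mu> \<in> ?T m")
    case False
    obtain l where l: "emeasure \<mu> (L j) = of_nat l"
      by (rule emeasure_CM_bounded[OF \<open>\<mu> \<in> CM\<close> bounded_L])
    then have "l \<le> m" using False that by (simp add: more_than_def)
    have "F \<mu> \<le> C * (1 + real l)" by (rule tame[OF that l])
    also have "\<dots> \<le> C * (1 + real m)" using C \<open>l \<le> m\<close> by (intro mult_left_mono) simp_all
    finally show ?thesis using False that by (simp add: G_def)
  qed (use C in \<open>simp add: G_def\<close>)
  have compl: "CM - ?T m \<in> sets CA" using sets.compl_sets[OF T] by simp
  have "(\<lambda>k. \<integral>\<mu>. G \<mu> \<partial>law (L j) (r k)) \<longlonglongrightarrow> (\<integral>\<mu>. G \<mu> \<partial>V)"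
  proof (rule setwise_convergence_integral[where S = CA and K = "C * (1 + real m)"])
    show "G \<in> borel_measurable CA"
      unfolding G_def using F(1) compl by (intro borel_measurable_times borel_measurable_indicator)
  qed (use V conv F G_le prob_space_law[OF sets_L] in \<open>simp_all add: G_def\<close>)
  then obtain k0 where k0: "\<And>k. k \<ge> k0 \<Longrightarrow>
      norm ((\<integral>\<mu>. G \<mu> \<partial>law (L j) (r k)) - (\<integral>\<mu>. G \<mu> \<partial>V)) < \<epsilon> / 3"
    using LIMSEQ_D[of _ _ "\<epsilon> / 3"] \<epsilon> by (metis divide_pos_pos zero_less_numeral)
  have split: "(\<integral>\<mu>. F \<mu> \<partial>W) = (\<integral>\<mu>. G \<mu> \<partial>W) + (\<integral>\<mu>. F \<mu> * indicator (?T m) \<mu> \<partial>W)"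
    and nonneg: "0 \<le> (\<integral>\<mu>. F \<mu> * indicator (?T m) \<mu> \<partial>W)"
    if W: "sets W = sets CA" "integrable W F" for W
  proof -
    have spW: "space W = CM" using sets_eq_imp_space_eq[OF W(1)] by simp
    have "integrable W G" "integrable W (\<lambda>\<mu>. F \<mu> * indicator (?T m) \<mu>)"
      unfolding G_def using W compl T[of m] by (intro integrable_real_mult_indicator; simp)+
    then have "(\<integral>\<mu>. G \<mu> \<partial>W) + (\<integral>\<mu>. F \<mu> * indicator (?T m) \<mu> \<partial>W) = (\<integral>\<mu>. G \<mu> + F \<mu> * indicator (?T m) \<mu> \<partial>W)"
      by simp
    also have "\<dots> = (\<integral>\<mu>. F \<mu> \<partial>W)"
      by (rule Bochner_Integration.integral_cong[OF refl]) (simp add: G_def spW indicator_def)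
    finally show "(\<integral>\<mu>. F \<mu> \<partial>W) = (\<integral>\<mu>. G \<mu> \<partial>W) + (\<integral>\<mu>. F \<mu> * indicator (?T m) \<mu> \<partial>W)" ..
    show "0 \<le> (\<integral>\<mu>. F \<mu> * indicator (?T m) \<mu> \<partial>W)"
      using F(2) by (intro Bochner_Integration.integral_nonneg_AE AE_I2) (simp add: spW)
  qed
  show "\<exists>k0. \<forall>k\<ge>k0. norm ((\<integral>\<mu>. F \<mu> \<partial>law (L j) (r k)) - (\<integral>\<mu>. F \<mu> \<partial>V)) < \<epsilon>"
  proof (intro exI allI impI)
    fix k assume "k0 \<le> k"
    have sl: "sets (law (L j) (r k)) = sets CA" by simp
    have "(\<integral>\<mu>. F \<mu> * indicator (?T m) \<mu> \<partial>law (L j) (r k)) \<le> (\<Sum>l. ?b (l + m))"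
      by (rule tame_tail_bound[OF F C tame sum_b])
    with k0[OF \<open>k0 \<le> k\<close>] m nonneg[OF sl int(1)] nonneg[OF V(2) int(2)]
    show "norm ((\<integral>\<mu>. F \<mu> \<partial>law (L j) (r k)) - (\<integral>\<mu>. F \<mu> \<partial>V)) < \<epsilon>"
      unfolding split[OF sl int(1)] split[OF V(2) int(2)] real_norm_def by linarith
  qed
qed

theorem subsequence_converges_locally:
  "\<exists>(Q :: 'a measure measure) (\<xi> :: 'a measure \<Rightarrow> 'a measure) (r :: nat \<Rightarrow> nat).
     point_process M L Q \<xi> \<and> strict_mono r \<and>
     (\<forall>F :: 'a measure \<Rightarrow> real.
        F \<in> borel_measurable CA \<and> (\<forall>\<mu>\<in>CM. 0 \<le> F \<mu>) \<and> local_function M L F \<and>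
        (\<exists>K. \<forall>\<mu>\<in>CM. F \<mu> \<le> K)
        \<longrightarrow> (\<lambda>k. \<integral>\<omega>. F (\<eta> (r k) \<omega>) \<partial>P (r k)) \<longlonglongrightarrow> (\<integral>\<omega>. F (\<xi> \<omega>) \<partial>Q)) \<and>
     ((\<forall>B\<in>bounded_sets M L. summable (\<lambda>m. real (Suc m) * c B (Suc m)))
        \<longrightarrow> converges_locally M L (\<lambda>k. P (r k)) (\<lambda>k. \<eta> (r k)) Q \<xi>)"
proof -
  obtain r Q where r: "strict_mono r" and Q: "prob_space Q" "sets Q = sets CA"
    and conv: "\<And>j A. A \<in> sets CA \<Longrightarrow> (\<lambda>k. measure (law (L j) (r k)) A)
       \<longlonglongrightarrow> measure (distr Q CA (\<lambda>\<mu>. restr \<mu> (L j))) A"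
    using subsequential_limit by blast
  define V where "V j = distr Q CA (\<lambda>\<mu>. restr \<mu> (L j))" for j
  have meas: "(\<lambda>\<mu>. restr \<mu> (L j)) \<in> measurable Q CA" for j
    using measurable_restr[OF sets_L, of j] by (simp add: Q(2) cong: measurable_cong_sets)
  have V: "prob_space (V j)" "sets (V j) = sets CA" for j
    unfolding V_def by (simp_all add: prob_space.prob_space_distr[OF Q(1) meas])
  have conv_V: "(\<lambda>k. measure (law (L j) (r k)) A) \<longlonglongrightarrow> measure (V j) A" if "A \<in> sets CA" for j A
    unfolding V_def using that by (rule conv)
  have spQ: "space Q = CM" using sets_eq_imp_space_eq[OF Q(2)] by simp
  have int_V: "(\<integral>\<mu>. F \<mu> \<partial>Q) = (\<integral>\<mu>. F \<mu> \<partial>V j)" "integrable Q F \<Longrightarrow> integrable (V j) F"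
    if F: "F \<in> borel_measurable CA" and loc: "\<And>\<mu>. \<mu> \<in> CM \<Longrightarrow> F (restr \<mu> (L j)) = F \<mu>"
    for F :: "'a measure \<Rightarrow> real" and j
  proof -
    have eq: "F (restr \<mu> (L j)) = F \<mu>" if "\<mu> \<in> space Q" for \<mu>
      using loc that by (simp add: spQ)
    have "(\<integral>\<mu>. F \<mu> \<partial>V j) = (\<integral>\<mu>. F (restr \<mu> (L j)) \<partial>Q)"
      unfolding V_def by (rule integral_distr[OF meas F])
    also have "\<dots> = (\<integral>\<mu>. F \<mu> \<partial>Q)"
      by (rule Bochner_Integration.integral_cong[OF refl eq])
    finally show "(\<integral>\<mu>. F \<mu> \<partial>Q) = (\<integral>\<mu>. F \<mu> \<partial>V j)" ..
    assume "integrable Q F"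
    moreover have "integrable Q (\<lambda>\<mu>. F (restr \<mu> (L j))) \<longleftrightarrow> integrable Q F"
      by (rule Bochner_Integration.integrable_cong[OF refl]) (rule eq)
    ultimately have "integrable Q (\<lambda>\<mu>. F (restr \<mu> (L j)))" by simp
    then show "integrable (V j) F"
      unfolding V_def by (rule integrable_distr_eq[OF meas F, THEN iffD2])
  qed
  have bounded_conv: "(\<lambda>k. \<integral>\<omega>. F (\<eta> (r k) \<omega>) \<partial>P (r k)) \<longlonglongrightarrow> (\<integral>\<mu>. F \<mu> \<partial>Q)"
    if F: "F \<in> borel_measurable CA" "\<forall>\<mu>\<in>CM. 0 \<le> F \<mu>" "local_function M L F" and K: "\<exists>K. \<forall>\<mu>\<in>CM. F \<mu> \<le> K"
    for F :: "'a measure \<Rightarrow> real"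
  proof -
    obtain j where j: "\<And>\<mu>. \<mu> \<in> CM \<Longrightarrow> F (restr \<mu> (L j)) = F \<mu>"
      using local_function_L[OF F(3)] by (metis order_refl)
    obtain K where K: "\<And>\<mu>. \<mu> \<in> CM \<Longrightarrow> F \<mu> \<le> K" using K by blast
    have "(\<lambda>k. \<integral>\<mu>. F \<mu> \<partial>law (L j) (r k)) \<longlonglongrightarrow> (\<integral>\<mu>. F \<mu> \<partial>V j)"
      using F K V conv_V prob_space_law[OF sets_L]
      by (intro setwise_convergence_integral[where S = CA and K = K]) simp_all
    then show ?thesis
      by (simp only: integral_law(1)[OF F(1) j] int_V(1)[OF F(1) j])
  qed
  have local_conv: "converges_locally M L (\<lambda>k. P (r k)) (\<lambda>k. \<eta> (r k)) Q (\<lambda>\<mu>. \<mu>)"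
    if sum: "\<forall>B\<in>bounded_sets M L. summable (\<lambda>m. real (Suc m) * c B (Suc m))"
    unfolding converges_locally_def
  proof (intro allI impI, elim conjE)
    fix F :: "'a measure \<Rightarrow> real"
    assume F: "F \<in> borel_measurable CA" "\<forall>\<mu>\<in>CM. 0 \<le> F \<mu>" "local_function M L F"
      and tame: "tame_function M L (\<lambda>\<mu>. ereal (F \<mu>))"
      and int: "\<forall>n. integrable (P (r n)) (\<lambda>\<omega>. F (\<eta> (r n) \<omega>))" "integrable Q F"
    obtain i1 where i1: "\<And>j \<mu>. i1 \<le> j \<Longrightarrow> \<mu> \<in> CM \<Longrightarrow> F (restr \<mu> (L j)) = F \<mu>"
      using local_function_L[OF F(3)] by metis
    obtain C i2 where C: "C \<ge> 0" and i2: "\<And>j \<mu> l. i2 \<le> j \<Longrightarrow> \<mu> \<in> CM \<Longrightarrow>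
        emeasure \<mu> (L j) = of_nat l \<Longrightarrow> F \<mu> \<le> C * (1 + real l)"
      using tame_function_L[OF tame] by metis
    define j where "j = max i1 i2"
    have j: "F (restr \<mu> (L j)) = F \<mu>" if "\<mu> \<in> CM" for \<mu>
      by (rule i1[OF _ that]) (simp add: j_def)
    have j': "F \<mu> \<le> C * (1 + real l)" if "\<mu> \<in> CM" "emeasure \<mu> (L j) = of_nat l" for \<mu> l
      by (rule i2[OF _ that]) (simp add: j_def)
    have "(\<lambda>k. \<integral>\<mu>. F \<mu> \<partial>law (L j) (r k)) \<longlonglongrightarrow> (\<integral>\<mu>. F \<mu> \<partial>V j)"
    proof (rule tame_convergence[OF V conv_V F(1) _ C j'])
      show "summable (\<lambda>l. real (Suc l) * c (L j) (Suc l))" using sum bounded_L by blast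
      show "integrable (law (L j) (r n)) F" for n
        using int(1) by (intro integral_law(2)[OF F(1) j]) simp_all
      show "integrable (V j) F" by (rule int_V(2)[OF F(1) j int(2)])
    qed (use F(2) in simp_all)
    then show "(\<lambda>n. \<integral>\<omega>. F (\<eta> (r n) \<omega>) \<partial>P (r n)) \<longlonglongrightarrow> (\<integral>\<omega>. F \<omega> \<partial>Q)"
      by (simp only: integral_law(1)[OF F(1) j] int_V(1)[OF F(1) j])
  qed
  show ?thesis
  proof (rule exI[of _ Q], rule exI[of _ "\<lambda>\<mu>. \<mu>"], rule exI[of _ r], intro conjI allI impI)
    show "point_process M L Q (\<lambda>\<mu>. \<mu>)" by (rule point_process_id[OF Q])
  qed (use r bounded_conv local_conv in blast)+
qed

end

section \<open>The limit theorem\<close>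

text \<open>
  The enumeration of points needs a point to start from. On an empty space the null measure is the only
  measure, so all the expectations agree.
\<close>

lemma (in localized_space) empty_space_case:
  assumes empty: "space M = {}" and pp: "\<And>n. point_process M L (P n) (\<eta> n)"
  shows "\<exists>(Q :: 'a measure measure) (\<xi> :: 'a measure \<Rightarrow> 'a measure) (r :: nat \<Rightarrow> nat).
     point_process M L Q \<xi> \<and> strict_mono r \<and>
     (\<forall>F :: 'a measure \<Rightarrow> real.
        F \<in> borel_measurable CA \<and> (\<forall>\<mu>\<in>CM. 0 \<le> F \<mu>) \<and> local_function M L F \<and>
        (\<exists>K. \<forall>\<mu>\<in>CM. F \<mu> \<le> K)
        \<longrightarrow> (\<lambda>k. \<integral>\<omega>. F (\<eta> (r k) \<omega>) \<partial>P (r k)) \<longlonglongrightarrow> (\<integral>\<omega>. F (\<xi> \<omega>) \<partial>Q)) \<and>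
     (S \<longrightarrow> converges_locally M L (\<lambda>k. P (r k)) (\<lambda>k. \<eta> (r k)) Q \<xi>)"
proof -
  let ?o = "null_measure M"
  have sets_M: "A = {}" if "A \<in> sets M" for A
    using sets.sets_into_space[OF that] empty by blast
  have unique: "\<mu> = ?o" if "\<mu> \<in> CM" for \<mu>
  proof (rule measure_eqI)
    fix A assume "A \<in> sets \<mu>"
    then have "A = {}" using sets_M sets_CM[OF that] by blast
    then show "emeasure \<mu> A = emeasure ?o A" by simp
  qed (simp add: sets_CM[OF that])
  have o: "?o \<in> CM"
    by (rule CM_I) (auto intro: exI[of _ 0])
  define Q where "Q = return CA ?o"
  have Q: "prob_space Q" "sets Q = sets CA"
    unfolding Q_def using o by (simp_all add: prob_space_return)
  have const: "(\<integral>\<omega>. F (\<eta> n \<omega>) \<partial>P n) = (\<integral>\<mu>. F \<mu> \<partial>Q)"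
    if F: "F \<in> borel_measurable CA" for F :: "'a measure \<Rightarrow> real" and n
  proof -
    interpret prob_space "P n" using pp[of n] by (simp add: point_process_def)
    have "\<eta> n \<in> measurable (P n) CA" using pp[of n] by (simp add: point_process_def)
    then have "\<eta> n \<omega> = ?o" if "\<omega> \<in> space (P n)" for \<omega>
      using unique[of "\<eta> n \<omega>"] measurable_space[of "\<eta> n" "P n" CA \<omega>] that by simp
    then have "(\<integral>\<omega>. F (\<eta> n \<omega>) \<partial>P n) = (\<integral>\<omega>. F ?o \<partial>P n)"
      by (intro Bochner_Integration.integral_cong) simp_all
    also have "\<dots> = F ?o" by (simp add: prob_space)
    also have "\<dots> = (\<integral>\<mu>. F \<mu> \<partial>Q)"
      unfolding Q_def using o F by (intro integral_return[symmetric]) simp_all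
    finally show ?thesis .
  qed
  show ?thesis
  proof (rule exI[of _ Q], rule exI[of _ "\<lambda>\<mu>. \<mu>"], rule exI[of _ "\<lambda>k. k"], intro conjI impI)
    show "point_process M L Q (\<lambda>\<mu>. \<mu>)" by (rule point_process_id[OF Q])
    show "strict_mono (\<lambda>k::nat. k)" by (simp add: strict_mono_def)
    show "converges_locally M L P \<eta> Q (\<lambda>\<mu>. \<mu>)"
      unfolding converges_locally_def by (intro allI impI, elim conjE) (simp add: const)
  qed (intro allI impI, elim conjE, simp add: const)
qed

theorem theorem7p9:
  fixes M \<nu> :: "'a measure"
    and L :: "nat \<Rightarrow> 'a set"
    and P :: "nat \<Rightarrow> 'w measure"
    and \<eta> :: "nat \<Rightarrow> 'w \<Rightarrow> 'a measure"
    and j :: "nat \<Rightarrow> 'a set \<Rightarrow> nat \<Rightarrow> (nat \<Rightarrow> 'a) \<Rightarrow> ennreal"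
    and c :: "'a set \<Rightarrow> nat \<Rightarrow> real"
  assumes "localizing M L"
    and "substandard_borel M"
    and "locally_finite M L \<nu>"
    and "\<And>n. point_process M L (P n) (\<eta> n)"
    and "\<And>n B m. B \<in> bounded_sets M L \<Longrightarrow> m \<ge> 1 \<Longrightarrow>
           is_janossy_density M \<nu> (P n) (\<eta> n) B m (j n B m)"
    and "\<And>B m. B \<in> bounded_sets M L \<Longrightarrow> m \<ge> 1 \<Longrightarrow>
           ((\<lambda>t::real. SUP n. \<integral>\<^sup>+x. j n B m x * indicator {x. j n B m x \<ge> ennreal t} x
               \<partial>restr_power \<nu> B m) \<longlongrightarrow> 0) at_top"
    and "\<And>B m. B \<in> bounded_sets M L \<Longrightarrow> m \<ge> 1 \<Longrightarrow> 0 \<le> c B m"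
    and "\<And>B. B \<in> bounded_sets M L \<Longrightarrow> summable (\<lambda>m. c B (Suc m))"
    and "\<And>B m. B \<in> bounded_sets M L \<Longrightarrow> m \<ge> 1 \<Longrightarrow>
           (SUP n. \<integral>\<^sup>+x. j n B m x \<partial>restr_power \<nu> B m) \<le> ennreal (c B m)"
  shows "\<exists>(Q :: 'a measure measure) (\<xi> :: 'a measure \<Rightarrow> 'a measure) (r :: nat \<Rightarrow> nat).
           point_process M L Q \<xi> \<and> strict_mono r \<and>
           (\<forall>F :: 'a measure \<Rightarrow> real.
              F \<in> borel_measurable (counting_algebra M L) \<and>
              (\<forall>\<mu>\<in>counting_measures M L. 0 \<le> F \<mu>) \<and>
              local_function M L F \<and>
              (\<exists>K. \<forall>\<mu>\<in>counting_measures M L. F \<mu> \<le> K)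
              \<longrightarrow> (\<lambda>k. \<integral>\<omega>. F (\<eta> (r k) \<omega>) \<partial>P (r k)) \<longlonglongrightarrow> (\<integral>\<omega>. F (\<xi> \<omega>) \<partial>Q)) \<and>
           ((\<forall>B\<in>bounded_sets M L. summable (\<lambda>m. real (Suc m) * c B (Suc m)))
              \<longrightarrow> converges_locally M L (\<lambda>k. P (r k)) (\<lambda>k. \<eta> (r k)) Q \<xi>)"
proof (cases "space M = {}")
  case True
  interpret localized_space M L by unfold_locales (rule assms(1))
  show ?thesis by (rule empty_space_case[OF True assms(4)])
next
  case False
  obtain f :: "'a \<Rightarrow> nat \<Rightarrow> bool" where
    f: "sets M = (\<lambda>A. f -` A \<inter> space M) ` sets cantor_borel" "f ` space M \<in> sets cantor_borel"
    using assms(2) unfolding substandard_borel_def by blast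
  interpret janossy_sequence M L f \<nu> P \<eta> j c
    by unfold_locales (use assms False f in blast)+
  show ?thesis by (rule subsequence_converges_locally)
qed

end
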